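(* Let $f$ be a polynomial skew product on $\mathbb{C}^2$ such that $\Gamma_f$ is infinite, and let $\tilde f(z,w)=(\tilde p(z),\tilde q(z,w))$ be its normalized rational skew product, with $\tilde b_d(z)$ the coefficient of $w^d$ in $\tilde q$. Then the rational map $\tilde f$ is one of the following: (i) $\tilde f(z,w)=(z^\delta,z^lw^d)$; (ii) $\tilde f(z,w)=(z^\delta,\tilde q(w))$, i.e. $\tilde p(z)=z^\delta$ and $\tilde q$ does not depend on $z$, with $\tilde q(w)\ne w^d$; (iii) $\tilde f(z,w)=(\tilde p(z),\tilde b_d(z)w^d)$, with $\tilde p(z)\neq z^\delta$ or $\tilde b_d(z)\ne z^l$; (iv) $\tilde f(z,w)=(z^\delta,\tilde q(z,w))$ with $\tilde q(z,w)\ne\tilde b_d(z)w^d$, and $\tilde f$ is semiconjugate to $(z^\delta,\tilde q(1,w))$ by $\pi(z,w)=(z^r,z^sw)$ for some nonzero coprime integers $r$ and $s$; here, if $l=0$, then $\delta=d$ and $s/r>0$, and if $l\ne0$, then $\delta\ne d$ and $s/r=l/(\delta-d)$. Except in the case $s/r<0$ in (iv), the map $\tilde f$ is polynomial.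
   Context: A polynomial skew product on $\mathbb{C}^2$ is a map $f(z,w)=(p(z),q(z,w))$ with $p(z)=a_\delta z^\delta+a_{\delta-1}z^{\delta-1}+\cdots+a_0$ and $q(z,w)=b_d(z)w^d+b_{d-1}(z)w^{d-1}+\cdots+b_0(z)$, where $a_\delta\ne0$, the $b_j$ are polynomials, $b_d\not\equiv0$ has degree $l\ge0$, $\delta\ge2$, $d\ge2$. Write $q_z(w)=q(z,w)$ and $f^n(z,w)=(p^n(z),Q_z^n(w))$, where $Q_z^n=q_{p^{n-1}(z)}\circ\cdots\circ q_{p(z)}\circ q_z$. Let $K_p=\{z:\{p^n(z)\}_{n\ge1}\text{ bounded}\}$ and $J_p=\partial K_p$. For $z\in K_p$ let $G_z(w)=\lim_{n\to\infty}d^{-n}\log^+|Q_z^n(w)|$ (the limit exists) and $K_z=\{w:G_z(w)=0\}$. The Julia set of $f$ is $J_f=\bigcup_{z\in J_p}\{z\}\times\partial K_z$, where $\partial K_z=\emptyset$ if $K_z=\mathbb{C}$. Let $S$ be the set of maps $\gamma(z,w)=(c_1z+c_2,\,c_3w+c_4(z))$ with $|c_1|=|c_3|=1$, $c_2\in\mathbb{C}$, and $c_4$ a polynomial. Set $\Gamma_f=\{\gamma\in S:\gamma(J_f)=J_f\}$. The centroids of $f$ are the constant $\zeta=-a_{\delta-1}/(\delta a_\delta)$ and the rational function $\zeta_z=-b_{d-1}(z)/(d\,b_d(z))$ of $z$. Let $h(z,w)=(c_1(z-\zeta),c_2(w-\zeta_z))$, where the constants satisfy $c_1^{\delta-1}=a_\delta$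 and $c_1^lc_2^{d-1}$ equals the leading coefficient of $b_d$. This is a birational map. The normalized rational skew product of $f$ is the rational map $\tilde f=hfh^{-1}$, i.e. $hf=\tilde fh$. It has the form $\tilde f(z,w)=(\tilde p(z),\tilde q(z,w))$, $\tilde q(z,w)=\tilde b_d(z)w^d+\tilde b_{d-1}(z)w^{d-1}+\cdots+\tilde b_0(z)$, where $\tilde p$ and $\tilde b_d$ are monic polynomials of degrees $\delta$ and $l$, the coefficient of $z^{\delta-1}$ in $\tilde p$ is $0$, $\tilde b_{d-1}\equiv0$, and the other $\tilde b_j$ are rational functions. $\tilde f$ is semiconjugate to $f_0$ by $\pi$ means $\pi\circ f_0=\tilde f\circ\pi$ (as rational maps). *)

theory Defs
  imports
    "HOL-Analysis.Analysis"
    "HOL-Computational_Algebra.Computational_Algebra"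
    "HOL-Computational_Algebra.Field_as_Ring"
begin

section \<open>Dynamics of polynomial skew products\<close>

text \<open>
  A polynomial skew product is given by a polynomial \<open>p\<close> in \<open>z\<close> and a polynomial \<open>q\<close> in \<open>w\<close>
  whose coefficients \<open>b\<^sub>j = coeff q j\<close> are polynomials in \<open>z\<close>.
\<close>

definition polynomial_skew_product :: "complex poly \<Rightarrow> complex poly poly \<Rightarrow> bool" where
  "polynomial_skew_product p q \<longleftrightarrow> degree p \<ge> 2 \<and> degree q \<ge> 2"

definition skew_map :: "complex poly \<Rightarrow> complex poly poly \<Rightarrow> complex \<times> complex \<Rightarrow> complex \<times> complex"
  where "skew_map p q = (\<lambda>(z, w). (poly p z, poly (map_poly (\<lambda>b. poly b z) q) w))"

definition Q_iter :: "complex poly \<Rightarrow> complex poly poly \<Rightarrow> nat \<Rightarrow> complex \<Rightarrow> complex \<Rightarrow> complex" where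
  "Q_iter p q n z w = snd ((skew_map p q ^^ n) (z, w))"

definition filled_julia_base :: "complex poly \<Rightarrow> complex set" where
  "filled_julia_base p = {z. bounded (range (\<lambda>n. (poly p ^^ n) z))}"

definition julia_base :: "complex poly \<Rightarrow> complex set" where
  "julia_base p = frontier (filled_julia_base p)"

definition log_plus :: "real \<Rightarrow> real" where
  "log_plus x = ln (max 1 x)"

definition green_fibre :: "complex poly \<Rightarrow> complex poly poly \<Rightarrow> complex \<Rightarrow> complex \<Rightarrow> real" where
  "green_fibre p q z w = lim (\<lambda>n. log_plus (cmod (Q_iter p q n z w)) / real (degree q) ^ n)"

definition filled_julia_fibre :: "complex poly \<Rightarrow> complex poly poly \<Rightarrow> complex \<Rightarrow> complex set" where
  "filled_julia_fibre p q z = {w. green_fibre p q z w = 0}"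

definition julia_set :: "complex poly \<Rightarrow> complex poly poly \<Rightarrow> (complex \<times> complex) set" where
  "julia_set p q = (\<Union>z\<in>julia_base p. {z} \<times> frontier (filled_julia_fibre p q z))"

definition skew_isometries :: "(complex \<times> complex \<Rightarrow> complex \<times> complex) set" where
  "skew_isometries =
     {\<gamma>. \<exists>(c1::complex) c2 c3 (c4::complex poly). cmod c1 = 1 \<and> cmod c3 = 1 \<and>
          \<gamma> = (\<lambda>(z, w). (c1 * z + c2, c3 * w + poly c4 z))}"

definition julia_symmetries ::
    "complex poly \<Rightarrow> complex poly poly \<Rightarrow> (complex \<times> complex \<Rightarrow> complex \<times> complex) set" where
  "julia_symmetries p q = {\<gamma> \<in> skew_isometries. \<gamma> ` julia_set p q = julia_set p q}"


section \<open>Rational skew products\<close>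

text \<open>
  The field \<open>\<complex>(z)\<close> is the fraction field of the complex polynomials. A pair \<open>(P, Q)\<close> with
  \<open>P \<in> \<complex>(z)\<close> and \<open>Q \<in> \<complex>(z)[w]\<close> stands for the rational map \<open>(z, w) \<mapsto> (P(z), Q(z, w))\<close>;
  two such rational maps are equal iff the pairs are.
\<close>

type_synonym ratfun = "complex poly fract"
type_synonym rat_skew = "ratfun \<times> ratfun poly"

definition rconst :: "complex \<Rightarrow> ratfun" where
  "rconst c = to_fract [:c:]"

definition Z :: ratfun where
  "Z = to_fract [:0, 1:]"

text \<open>\<open>ratfun_compose R g\<close> is \<open>R \<circ> g\<close>; it is used for nonconstant \<open>g\<close> only, so that the
  denominator below does not vanish.\<close>

definition ratfun_compose :: "ratfun \<Rightarrow> ratfun \<Rightarrow> ratfun" where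
  "ratfun_compose R g =
     poly (map_poly rconst (fst (quot_of_fract R))) g /
     poly (map_poly rconst (snd (quot_of_fract R))) g"

definition regular_at :: "ratfun \<Rightarrow> complex \<Rightarrow> bool" where
  "regular_at R a \<longleftrightarrow> poly (snd (quot_of_fract R)) a \<noteq> 0"

definition ratfun_eval :: "ratfun \<Rightarrow> complex \<Rightarrow> complex" where
  "ratfun_eval R a = poly (fst (quot_of_fract R)) a / poly (snd (quot_of_fract R)) a"

text \<open>\<open>(P\<^sub>1(P\<^sub>2(z)), Q\<^sub>1(P\<^sub>2(z), Q\<^sub>2(z, w)))\<close>, for nonconstant \<open>P\<^sub>2\<close>.\<close>

definition rat_skew_compose :: "rat_skew \<Rightarrow> rat_skew \<Rightarrow> rat_skew" (infixl "\<circ>\<^sub>r" 55) where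
  "F \<circ>\<^sub>r G =
     (ratfun_compose (fst F) (fst G),
      pcompose (map_poly (\<lambda>b. ratfun_compose b (fst G)) (snd F)) (snd G))"

definition rat_skew_of :: "complex poly \<Rightarrow> complex poly poly \<Rightarrow> rat_skew" where
  "rat_skew_of p q = (to_fract p, map_poly to_fract q)"

definition is_polynomial_map :: "rat_skew \<Rightarrow> bool" where
  "is_polynomial_map F \<longleftrightarrow> (\<exists>p q. F = rat_skew_of p q)"


section \<open>Normalization\<close>

definition centroid_base :: "complex poly \<Rightarrow> complex" where
  "centroid_base p = - coeff p (degree p - 1) / (of_nat (degree p) * lead_coeff p)"

definition centroid_fibre :: "complex poly poly \<Rightarrow> ratfun" where
  "centroid_fibre q =
     - to_fract (coeff q (degree q - 1)) / (of_nat (degree q) * to_fract (lead_coeff q))"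

definition normalizing_map :: "complex poly \<Rightarrow> complex poly poly \<Rightarrow> complex \<Rightarrow> complex \<Rightarrow> rat_skew" where
  "normalizing_map p q c1 c2 =
     (rconst c1 * (Z - rconst (centroid_base p)),
      smult (rconst c2) [:- centroid_fibre q, 1:])"

text \<open>The constants \<open>c1\<close> and \<open>c2\<close> are determined only up to roots of unity, hence a relation
  rather than a function. Since the normalizing map \<open>h\<close> is birational, \<open>h f = F h\<close> determines
  \<open>F = h f h\<^sup>-\<^sup>1\<close>.\<close>

definition normalized_skew_product :: "complex poly \<Rightarrow> complex poly poly \<Rightarrow> rat_skew \<Rightarrow> bool" where
  "normalized_skew_product p q F \<longleftrightarrow>
     (\<exists>c1 c2. c1 ^ (degree p - 1) = lead_coeff p \<and>
        c1 ^ degree (lead_coeff q) * c2 ^ (degree q - 1) = lead_coeff (lead_coeff q) \<and>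
        normalizing_map p q c1 c2 \<circ>\<^sub>r rat_skew_of p q = F \<circ>\<^sub>r normalizing_map p q c1 c2)"

definition semiconjugate_by :: "rat_skew \<Rightarrow> rat_skew \<Rightarrow> rat_skew \<Rightarrow> bool" where
  "semiconjugate_by F F0 \<pi> \<longleftrightarrow> \<pi> \<circ>\<^sub>r F0 = F \<circ>\<^sub>r \<pi>"


section \<open>The four normal forms\<close>

definition case_i :: "nat \<Rightarrow> nat \<Rightarrow> nat \<Rightarrow> rat_skew \<Rightarrow> bool" where
  "case_i \<delta> d l F \<longleftrightarrow> F = (Z ^ \<delta>, monom (Z ^ l) d)"

definition case_ii :: "nat \<Rightarrow> nat \<Rightarrow> rat_skew \<Rightarrow> bool" where
  "case_ii \<delta> d F \<longleftrightarrow> (\<exists>q0 :: complex poly. F = (Z ^ \<delta>, map_poly rconst q0) \<and> q0 \<noteq> monom 1 d)"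

definition case_iii :: "nat \<Rightarrow> nat \<Rightarrow> nat \<Rightarrow> rat_skew \<Rightarrow> bool" where
  "case_iii \<delta> d l F \<longleftrightarrow> snd F = monom (coeff (snd F) d) d \<and>
     (fst F \<noteq> Z ^ \<delta> \<or> coeff (snd F) d \<noteq> Z ^ l)"

text \<open>\<open>(z, w) \<mapsto> (z\<^sup>r, z\<^sup>s w)\<close> with integer exponents of any sign.\<close>

definition monomial_map :: "int \<Rightarrow> int \<Rightarrow> rat_skew" where
  "monomial_map r s = (Z powi r, [:0, Z powi s:])"

text \<open>The regularity condition says that the fibre map over \<open>z = 1\<close>, which enters the
  semiconjugacy, is well defined.\<close>

definition case_iv :: "nat \<Rightarrow> nat \<Rightarrow> nat \<Rightarrow> rat_skew \<Rightarrow> int \<Rightarrow> int \<Rightarrow> bool" where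
  "case_iv \<delta> d l F r s \<longleftrightarrow>
     fst F = Z ^ \<delta> \<and> snd F \<noteq> monom (coeff (snd F) d) d \<and>
     r \<noteq> 0 \<and> s \<noteq> 0 \<and> coprime r s \<and>
     (\<forall>j. regular_at (coeff (snd F) j) 1) \<and>
     semiconjugate_by F
       (Z ^ \<delta>, map_poly rconst (map_poly (\<lambda>b. ratfun_eval b 1) (snd F)))
       (monomial_map r s) \<and>
     (l = 0 \<longrightarrow> \<delta> = d \<and> real_of_int s / real_of_int r > 0) \<and>
     (l \<noteq> 0 \<longrightarrow> \<delta> \<noteq> d \<and> real_of_int s / real_of_int r = real l / (real \<delta> - real d))"

end

theory Submission
  imports Defs "HOL-Complex_Analysis.Conformal_Mappings"
begin

text \<open>
  Write \<open>X\<^sub>z\<close> for the boundary of the filled Julia set \<open>K\<^sub>z\<close> of the fibre over \<open>z\<close>. A symmetry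
  \<open>\<gamma>(z, w) = (\<sigma>(z), T\<^sub>z(w))\<close> of the Julia set maps \<open>X\<^sub>z\<close> onto \<open>X\<^bsub>\<sigma>(z)\<^esub>\<close> by the affine map \<open>T\<^sub>z\<close>, and
  the dynamics gives \<open>X\<^sub>z = q\<^sub>z\<^sup>-\<^sup>1(X\<^bsub>p(z)\<^esub>)\<close>. Everything is deduced from one rigidity property
  (\<open>equal_preimages_affine\<close>): if \<open>A\<close> and \<open>B\<close> are compact, \<open>A\<close> has at least two
  points, and two polynomials of the same positive degree satisfy \<open>q\<^sub>1\<^sup>-\<^sup>1(A) = q\<^sub>2\<^sup>-\<^sup>1(B)\<close>, then \<open>q\<^sub>2 = \<alpha> q\<^sub>1 + \<beta>\<close>. The reason is that, up to an
  additive constant, \<open>q\<^sub>1\<close> divided by its leading coefficient is the unique monic polynomial of its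
  degree whose image of \<open>q\<^sub>1\<^sup>-\<^sup>1(A)\<close> has the least diameter; this replaces Green functions and
  Boettcher coordinates.

  Applied to a fibre, it gives \<open>q\<^bsub>\<sigma>(z)\<^esub> \<circ> T\<^sub>z = T' \<circ> q\<^sub>z\<close> with \<open>T'\<close> affine and
  \<open>T'(X\<^bsub>p(z)\<^esub>) = X\<^bsub>p(\<sigma>(z))\<^esub>\<close>, so that the argument can be repeated over \<open>p(z)\<close>
  (\<open>fibre_symmetry_step\<close>). Such affine maps respect centroids; hence in the normalized
  coordinates both are multiplications, by \<open>\<alpha>\<close> and \<open>\<alpha>'\<close> say, and the coefficients
  of \<open>q\<close> satisfy \<open>S\<^sub>j(\<sigma>(z)) \<alpha>\<^sup>j = \<alpha>' S\<^sub>j(z)\<close> (\<open>transfer_fibres\<close>). This needs \<open>z\<close> in the Julia set of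
  \<open>p\<close> for which \<open>X\<^sub>z\<close> is compact with at least two points, which can fail when the orbit of \<open>z\<close>
  comes close to the zeros of the leading coefficient of \<open>q\<close> too fast. An average over the backward
  orbits of a point outside the filled Julia set of \<open>p\<close> shows that infinitely many \<open>z\<close> are good
  (\<open>infinite_log_tame\<close>), and infinitely many suffice to identify rational functions.

  The same rigidity, applied to the set of limit points of the projection of the Julia set to
  the base, shows that every \<open>\<sigma>\<close> fixes the centroid \<open>\<zeta>\<close> of \<open>p\<close>, and that
  \<open>p(z) = \<zeta> + a (z - \<zeta>)\<^sup>\<delta>\<close> as soon as some \<open>\<sigma>\<close> is a rotation of order greater than \<open>\<delta>\<close>
  (\<open>base_power_map\<close>).

  Now let there be infinitely many symmetries. If they induce only finitely many \<open>\<sigma>\<close>, infinitely many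
  of them differ only by rotations of the fibres. Rotations of large order force all coefficients but
  the leading one to vanish: cases (i) and (iii). Otherwise there are \<open>\<sigma>\<close> of
  arbitrarily large order, so the normalized base map is \<open>z\<^sup>\<delta>\<close>, and each \<open>S\<^sub>j / S\<^sub>d\<close> is
  semi-invariant under rotations of large order, hence a monomial \<open>C\<^sub>j z\<^sup>m\<close> with \<open>m\<close> depending on \<open>j\<close>.
  If some \<open>C\<^sub>j\<close> with \<open>j < d\<close> is nonzero, the relation over \<open>p(z)\<close> then gives \<open>S\<^sub>d = z\<^sup>l\<close>, and
  comparing exponents leaves cases (ii) and (iv) (\<open>monomial_classification\<close>).
\<close>

section \<open>Polynomials with equal preimages of compact sets\<close>

lemma root_enumeration:
  fixes h :: "complex poly"
  assumes "h \<noteq> 0"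
  obtains \<zeta> where "h = smult (lead_coeff h) (\<Prod>i<degree h. [:- \<zeta> i, 1:])"
proof -
  obtain A where A: "size A = degree h" "h = smult (lead_coeff h) (\<Prod>x\<in>#A. [:-x, 1:])"
    using alg_closed_imp_factorization[OF assms] by blast
  obtain xs where xs: "mset xs = A" by (metis ex_mset)
  have "(\<Prod>x\<in>#A. [:-x, 1:]) = prod_list (map (\<lambda>x. [:-x, 1:]) xs)"
    by (simp flip: xs prod_mset_prod_list)
  also have "\<dots> = (\<Prod>i<degree h. [:- (xs ! i), 1:])"
    using A(1) by (simp add: prod.list_conv_set_nth atLeast0LessThan flip: xs)
  finally show thesis using A(2) that[of "\<lambda>i. xs ! i"] by simp
qed

lemma degree_diff_const:
  fixes h :: "complex poly"
  shows "degree (h - [:w:]) = degree h"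
proof (cases "degree h > 0")
  case True
  then have "degree (h + - [:w:]) = degree h" by (intro degree_add_eq_left) simp
  then show ?thesis by (simp only: diff_conv_add_uminus)
next
  case False
  then obtain a where "h = [:a:]" by (auto elim: degree_eq_zeroE)
  then show ?thesis by simp
qed

lemma poly_surj:
  fixes h :: "complex poly"
  assumes "degree h > 0"
  obtains x where "poly h x = w"
proof -
  have "degree (h - [:w:]) > 0"
    using assms by (simp add: degree_diff_const)
  then obtain x where "poly (h - [:w:]) x = 0"
    using alg_closed_imp_poly_has_root by blast
  then show thesis using that[of x] by simp
qed

lemma pderiv_prod_linear:
  fixes \<zeta> :: "nat \<Rightarrow> complex"
  shows "pderiv (\<Prod>i<d. [:- \<zeta> i, 1:]) = (\<Sum>i<d. \<Prod>j\<in>{..<d}-{i}. [:- \<zeta> j, 1:])"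
  by (simp add: pderiv_prod pderiv_pCons one_pCons[symmetric])

text \<open>
  Newton's identities. With \<open>N\<^sub>i = h / (x - \<zeta>\<^sub>i)\<close>, synthetic division expresses the coefficients of \<open>N\<^sub>i\<close>
  by powers of \<open>\<zeta>\<^sub>i\<close> and the upper coefficients of \<open>h\<close>; summing over \<open>i\<close> gives \<open>h'\<close>.
\<close>

lemma newton_identity:
  fixes \<zeta> :: "nat \<Rightarrow> complex" and d :: nat
  defines "h \<equiv> (\<Prod>i<d. [:- \<zeta> i, 1:])"
  assumes "j < d"
  shows "of_nat (d - j) * coeff h (d - j) = (\<Sum>t\<le>j. coeff h (d - j + t) * (\<Sum>i<d. \<zeta> i ^ t))"
proof -
  define N where "N i = (\<Prod>j\<in>{..<d}-{i}. [:- \<zeta> j, 1:])" for i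
  have h: "h = [:- \<zeta> i, 1:] * N i" if "i < d" for i
    using that unfolding h_def N_def by (subst prod.remove[of _ i]) auto
  have degN: "coeff (N i) d = 0" if "i < d" for i
  proof -
    have "degree (N i) \<le> (\<Sum>j\<in>{..<d}-{i}. 1)"
      unfolding N_def by (rule order.trans[OF degree_prod_sum_le]) (auto intro!: sum_mono)
    then show ?thesis using that by (intro coeff_eq_0) simp
  qed
  have rec: "coeff (N i) m = coeff h (Suc m) + \<zeta> i * coeff (N i) (Suc m)" if "i < d" for i m
    by (subst h[OF that]) (simp add: coeff_pCons split: nat.split)
  have N: "coeff (N i) (d - 1 - j) = (\<Sum>t\<le>j. coeff h (d - j + t) * \<zeta> i ^ t)"
    if "i < d" "j < d" for i j
    using that(2)
  proof (induction j)
    case 0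
    then show ?case using rec[OF that(1), of "d - 1"] degN[OF that(1)] by simp
  next
    case (Suc j)
    have e: "Suc (d - 1 - Suc j) = d - 1 - j" "d - 1 - j = d - Suc j" using Suc.prems by auto
    have "coeff (N i) (d - 1 - Suc j) = coeff h (d - Suc j) + \<zeta> i * coeff (N i) (d - 1 - j)"
      using rec[OF that(1), of "d - 1 - Suc j"] e by simp
    also have "\<dots> = coeff h (d - Suc j) + (\<Sum>t\<le>j. coeff h (d - Suc j + Suc t) * \<zeta> i ^ Suc t)"
    proof -
      have "d - j = d - Suc j + 1" using Suc.prems by simp
      then show ?thesis using Suc by (simp add: sum_distrib_left algebra_simps)
    qed
    also have "\<dots> = (\<Sum>t\<le>Suc j. coeff h (d - Suc j + t) * \<zeta> i ^ t)"
      by (subst sum.atMost_Suc_shift) simp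
    finally show ?case .
  qed
  have "of_nat (d - j) * coeff h (d - j) = coeff (pderiv h) (d - 1 - j)"
    using assms(2) by (simp add: coeff_pderiv Suc_diff_Suc)
  also have "pderiv h = (\<Sum>i<d. N i)"
    unfolding h_def N_def by (rule pderiv_prod_linear)
  also have "coeff (\<Sum>i<d. N i) (d - 1 - j) = (\<Sum>i<d. \<Sum>t\<le>j. coeff h (d - j + t) * \<zeta> i ^ t)"
    using N[OF _ assms(2)] by (simp add: coeff_sum)
  also have "\<dots> = (\<Sum>t\<le>j. coeff h (d - j + t) * (\<Sum>i<d. \<zeta> i ^ t))"
    by (subst sum.swap) (simp add: sum_distrib_left)
  finally show ?thesis .
qed

lemma prod_linear_monic:
  fixes \<zeta> :: "nat \<Rightarrow> complex"
  shows "degree (\<Prod>i<d. [:- \<zeta> i, 1:]) = d" "coeff (\<Prod>i<d. [:- \<zeta> i, 1:]) d = 1"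
proof -
  show deg: "degree (\<Prod>i<d. [:- \<zeta> i, 1:]) = d"
    by (simp add: degree_prod_eq_sum_degree)
  have "lead_coeff (\<Prod>i<d. [:- \<zeta> i, 1:]) = 1"
    by (simp only: lead_coeff_prod) simp
  then show "coeff (\<Prod>i<d. [:- \<zeta> i, 1:]) d = 1"
    unfolding deg .
qed

text \<open>
  By Newton's identities the power sums of exponent less than \<open>d\<close> are determined by the nonconstant
  coefficients.
\<close>

lemma power_sums_eq:
  fixes \<zeta> \<xi> :: "nat \<Rightarrow> complex"
  assumes "\<And>m. m > 0 \<Longrightarrow> coeff (\<Prod>i<d. [:- \<zeta> i, 1:]) m = coeff (\<Prod>i<d. [:- \<xi> i, 1:]) m"
    and "j < d"
  shows "(\<Sum>i<d. \<zeta> i ^ j) = (\<Sum>i<d. \<xi> i ^ j)"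
  using assms(2)
proof (induction j rule: less_induct)
  case (less j)
  define h where "h \<zeta> = (\<Prod>i<d. [:- \<zeta> i, 1:])" for \<zeta> :: "nat \<Rightarrow> complex"
  have eq: "coeff (h \<zeta>) m = coeff (h \<xi>) m" if "m > 0" for m
    using assms(1)[OF that] by (simp add: h_def)
  have split: "(\<Sum>i<d. \<eta> i ^ j) = of_nat (d - j) * coeff (h \<eta>) (d - j)
      - (\<Sum>t<j. coeff (h \<eta>) (d - j + t) * (\<Sum>i<d. \<eta> i ^ t))" for \<eta>
  proof -
    have "of_nat (d - j) * coeff (h \<eta>) (d - j)
        = (\<Sum>t\<le>j. coeff (h \<eta>) (d - j + t) * (\<Sum>i<d. \<eta> i ^ t))"
      unfolding h_def by (rule newton_identity[OF less.prems])
    moreover have "{..j} = insert j {..<j}" by auto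
    moreover have "coeff (h \<eta>) d = 1" by (simp add: h_def prod_linear_monic)
    ultimately show ?thesis using less.prems by simp
  qed
  have IH: "(\<Sum>i<d. \<zeta> i ^ t) = (\<Sum>i<d. \<xi> i ^ t)" if "t < j" for t
    using less.IH[OF that] that less.prems by simp
  show ?case
    unfolding split[of \<zeta>] split[of \<xi>] using less.prems eq IH by (auto intro!: sum.cong)
qed

text \<open>
  For \<open>deg R < deg q\<close>, the trace of \<open>R\<close> along the fibre of \<open>q\<close> over \<open>w\<close> does not depend on \<open>w\<close>, because
  only the constant coefficient of \<open>q - w\<close> does.
\<close>

lemma sum_poly_over_fibre:
  fixes q R :: "complex poly" and \<zeta> \<xi> :: "nat \<Rightarrow> complex"
  assumes d: "d = degree q" "degree R < d"
    and z: "q - [:w:] = smult (lead_coeff q) (\<Prod>i<d. [:- \<zeta> i, 1:])"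
    and x: "q - [:w':] = smult (lead_coeff q) (\<Prod>i<d. [:- \<xi> i, 1:])"
  shows "(\<Sum>i<d. poly R (\<zeta> i)) = (\<Sum>i<d. poly R (\<xi> i))"
proof -
  have nz: "lead_coeff q \<noteq> 0" using d by auto
  have "coeff (\<Prod>i<d. [:- \<zeta> i, 1:]) m = coeff (\<Prod>i<d. [:- \<xi> i, 1:]) m" if "m > 0" for m
  proof -
    have "coeff (q - [:w:]) m = coeff (q - [:w':]) m"
      using that by (simp add: coeff_pCons split: nat.split)
    then show ?thesis unfolding z x using nz by simp
  qed
  then have p: "(\<Sum>i<d. \<zeta> i ^ j) = (\<Sum>i<d. \<xi> i ^ j)" if "j < d" for j
    using power_sums_eq that by blast
  have "(\<Sum>i<d. poly R (\<eta> i)) = (\<Sum>j\<le>degree R. coeff R j * (\<Sum>i<d. \<eta> i ^ j))" for \<eta>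
    by (simp add: poly_altdef sum_distrib_left) (rule sum.swap)
  then show ?thesis using p d(2) by simp
qed

lemma fibre_enumeration:
  fixes q :: "complex poly"
  assumes "degree q > 0"
  obtains \<zeta> where "q - [:w:] = smult (lead_coeff q) (\<Prod>i<degree q. [:- \<zeta> i, 1:])"
    "\<And>i. i < degree q \<Longrightarrow> poly q (\<zeta> i) = w"
    "\<And>x. poly q x = w \<Longrightarrow> \<exists>i<degree q. x = \<zeta> i"
proof -
  have dq: "degree (q - [:w:]) = degree q" using assms by (simp add: degree_diff_const)
  have lq: "lead_coeff (q - [:w:]) = lead_coeff q"
    using assms by (simp add: dq coeff_pCons split: nat.split)
  have "q - [:w:] \<noteq> 0" using dq assms by auto
  then obtain \<zeta> where z: "q - [:w:] = smult (lead_coeff q) (\<Prod>i<degree q. [:- \<zeta> i, 1:])"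
    using root_enumeration[of "q - [:w:]"] dq lq by metis
  have nz: "lead_coeff q \<noteq> 0" using assms by auto
  have iff: "poly q x = w \<longleftrightarrow> (\<exists>i<degree q. x = \<zeta> i)" for x
  proof -
    have "poly q x = w \<longleftrightarrow> poly (q - [:w:]) x = 0" by simp
    also have "\<dots> \<longleftrightarrow> (\<exists>i<degree q. x = \<zeta> i)"
      unfolding z using nz by (auto simp: poly_prod)
    finally show ?thesis .
  qed
  show thesis using that[OF z] iff by blast
qed

lemma mean_extremal:
  fixes v :: "'a \<Rightarrow> complex"
  assumes "finite I" "\<And>i. i \<in> I \<Longrightarrow> cmod (v i) \<le> cmod m" "(\<Sum>i\<in>I. v i) = of_nat (card I) * m" "i \<in> I"
  shows "v i = m"
proof -
  have le: "Re (v i * cnj m) \<le> (cmod m)\<^sup>2" if "i \<in> I" for i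
  proof -
    have "Re (v i * cnj m) \<le> cmod (v i) * cmod m"
      by (metis complex_Re_le_cmod complex_mod_cnj norm_mult)
    also have "\<dots> \<le> cmod m * cmod m" using assms(2)[OF that] by (intro mult_right_mono) auto
    finally show ?thesis by (simp add: power2_eq_square)
  qed
  have "(\<Sum>i\<in>I. (cmod m)\<^sup>2 - Re (v i * cnj m)) = card I * (cmod m)\<^sup>2 - Re ((\<Sum>i\<in>I. v i) * cnj m)"
    by (simp add: sum_subtractf sum_distrib_right)
  also have "\<dots> = 0"
    unfolding assms(3) 
    by (simp add: cmod_power2) (simp add: power2_eq_square algebra_simps)
  finally have "(cmod m)\<^sup>2 - Re (v i * cnj m) = 0"
    using sum_nonneg_eq_0_iff[OF assms(1), of "\<lambda>i. (cmod m)\<^sup>2 - Re (v i * cnj m)"] le assms(4) by simp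
  moreover have "(cmod (v i - m))\<^sup>2 = (cmod (v i))\<^sup>2 - 2 * Re (v i * cnj m) + (cmod m)\<^sup>2"
    by (simp only: cmod_power2) (simp add: power2_eq_square algebra_simps)
  moreover have "(cmod (v i))\<^sup>2 \<le> (cmod m)\<^sup>2" using assms(2,4) by (simp add: power_mono)
  ultimately have "(cmod (v i - m))\<^sup>2 \<le> 0" by linarith
  then show ?thesis by simp
qed

text \<open>
  Since \<open>h'\<close> is the sum of the \<open>h / (x - \<zeta>\<^sub>i)\<close> and each \<open>x - \<zeta>\<^sub>i\<close> divides \<open>D\<close>, the multiplicities of the
  roots of \<open>h\<close> do no harm.
\<close>

lemma dvd_mult_pderiv:
  fixes h D :: "complex poly"
  assumes "h \<noteq> 0" "\<And>x. poly h x = 0 \<Longrightarrow> poly D x = 0"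
  shows "h dvd D * pderiv h"
proof -
  define c d where "c = lead_coeff h" and "d = degree h"
  obtain \<zeta> where z: "h = smult c (\<Prod>i<d. [:- \<zeta> i, 1:])"
    using root_enumeration[OF assms(1)] unfolding c_def d_def by metis
  have "[:- \<zeta> i, 1:] * (\<Prod>j\<in>{..<d}-{i}. [:- \<zeta> j, 1:]) = (\<Prod>i<d. [:- \<zeta> i, 1:])" if "i < d" for i
    using that by (subst prod.remove[of _ i]) auto
  moreover have "[:- \<zeta> i, 1:] dvd D" if "i < d" for i
  proof -
    have "poly h (\<zeta> i) = 0" unfolding z using that by (auto simp: poly_prod)
    then show ?thesis using assms(2) by (simp add: poly_eq_0_iff_dvd)
  qed
  ultimately have "(\<Prod>i<d. [:- \<zeta> i, 1:]) dvd D * (\<Prod>j\<in>{..<d}-{i}. [:- \<zeta> j, 1:])" if "i < d" for i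
    using that by (metis dvd_refl mult_dvd_mono)
  then have "(\<Prod>i<d. [:- \<zeta> i, 1:]) dvd D * (\<Sum>i<d. \<Prod>j\<in>{..<d}-{i}. [:- \<zeta> j, 1:])"
    by (auto simp: sum_distrib_left intro!: dvd_sum)
  then obtain k where "D * (\<Sum>i<d. \<Prod>j\<in>{..<d}-{i}. [:- \<zeta> j, 1:]) = (\<Prod>i<d. [:- \<zeta> i, 1:]) * k"
    by (elim dvdE)
  then have "smult c (\<Prod>i<d. [:- \<zeta> i, 1:]) dvd D * smult c (\<Sum>i<d. \<Prod>j\<in>{..<d}-{i}. [:- \<zeta> j, 1:])"
    by (intro dvdI[of _ _ k]) simp
  moreover have "pderiv h = smult c (\<Sum>i<d. \<Prod>j\<in>{..<d}-{i}. [:- \<zeta> j, 1:])"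
    by (subst z) (simp add: pderiv_smult pderiv_prod_linear)
  ultimately show ?thesis using z by metis
qed

text \<open>
  Two fibres contain more than \<open>deg q\<close> points. Instead of counting them: the coprime polynomials
  \<open>q - w0\<close> and \<open>q - w1\<close> both divide \<open>D q'\<close>, whose degree is smaller than that of their product.
\<close>

lemma poly_vanishing_on_two_fibres:
  fixes q D :: "complex poly"
  assumes "degree D < degree q" "w0 \<noteq> w1"
    and "\<And>x. poly q x = w0 \<or> poly q x = w1 \<Longrightarrow> poly D x = 0"
  shows "D = 0"
proof -
  define h where "h w = q - [:w:]" for w
  have deg: "degree (h w) = degree q" for w
    unfolding h_def using assms(1) by (simp add: degree_diff_const)
  have nz: "h w \<noteq> 0" for w using deg[of w] assms(1) by auto
  have pd: "pderiv (h w) = pderiv q" for w by (simp add: h_def pderiv_diff pderiv_pCons)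
  have dvd: "h w dvd D * pderiv q" if "w = w0 \<or> w = w1" for w
    using dvd_mult_pderiv[OF nz, of w D] that assms(3) unfolding pd by (auto simp: h_def)
  have "coprime (h w0) (h w1)"
  proof (rule coprimeI)
    fix c assume "c dvd h w0" "c dvd h w1"
    then have "c dvd h w0 - h w1" by (rule dvd_diff)
    moreover have "h w0 - h w1 = [:w1 - w0:]" by (simp add: h_def)
    ultimately show "is_unit c"
      using assms(2) by (simp add: is_unit_triv dvd_unit_imp_unit)
  qed
  then have "h w0 * h w1 dvd D * pderiv q" using dvd by (intro divides_mult) auto
  moreover have "degree (D * pderiv q) < degree (h w0 * h w1)"
  proof -
    have "degree (D * pderiv q) \<le> degree D + (degree q - 1)"
      using degree_mult_le[of D "pderiv q"] by (simp add: degree_pderiv)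
    then show ?thesis using assms(1) by (simp add: degree_mult_eq nz deg)
  qed
  ultimately have "D * pderiv q = 0" using dvd_imp_degree_le[of "h w0 * h w1" "D * pderiv q"] by linarith
  moreover have "pderiv q \<noteq> 0" using assms(1) by (simp add: pderiv_eq_0_iff)
  ultimately show ?thesis by simp
qed

text \<open>
  By \<open>sum_poly_over_fibre\<close> a monic polynomial \<open>P\<close> of degree \<open>deg q\<close> has the same differences of fibre
  means as \<open>q\<close> divided by its leading coefficient.
\<close>

lemma monic_fibre_mean:
  fixes q P :: "complex poly"
  assumes d: "d = degree q" "d > 0" "degree P = d" "lead_coeff P = 1"
    and z: "q - [:w:] = smult (lead_coeff q) (\<Prod>i<d. [:- \<zeta> i, 1:])"
           "\<And>i. i < d \<Longrightarrow> poly q (\<zeta> i) = w"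
    and x: "q - [:w':] = smult (lead_coeff q) (\<Prod>i<d. [:- \<xi> i, 1:])"
           "\<And>i. i < d \<Longrightarrow> poly q (\<xi> i) = w'"
  shows "(\<Sum>(i,j)\<in>{..<d}\<times>{..<d}. poly P (\<zeta> i) - poly P (\<xi> j)) = of_nat (card ({..<d}\<times>{..<d})) * ((w - w') / lead_coeff q)"
proof -
  define b R where "b = lead_coeff q" and "R = P - smult (1/b) q"
  have b: "b \<noteq> 0" using d b_def by auto
  have "degree R < d"
  proof -
    have "degree R \<le> d" unfolding R_def using d by (intro degree_diff_le) auto
    moreover have "coeff R d = 0" unfolding R_def using d b by (simp add: b_def)
    ultimately show ?thesis using d(2) by (metis degree_0 leading_coeff_0_iff le_neq_implies_less)
  qed
  then have RR: "(\<Sum>i<d. poly R (\<zeta> i)) = (\<Sum>i<d. poly R (\<xi> i))"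
    using sum_poly_over_fibre[OF d(1) _ z(1) x(1)] by simp
  have P: "poly P x = poly R x + poly q x / b" for x by (simp add: R_def)
  have "(\<Sum>(i,j)\<in>{..<d}\<times>{..<d}. poly P (\<zeta> i) - poly P (\<xi> j))
      = of_nat d * (\<Sum>i<d. poly P (\<zeta> i)) - of_nat d * (\<Sum>i<d. poly P (\<xi> i))"
    by (simp add: sum.cartesian_product[symmetric] sum_subtractf sum_distrib_left)
  also have "\<dots> = of_nat d * ((\<Sum>i<d. poly R (\<zeta> i)) + of_nat d * (w / b)) - of_nat d * ((\<Sum>i<d. poly R (\<xi> i)) + of_nat d * (w' / b))"
    by (simp add: P sum.distrib z(2) x(2))
  also have "\<dots> = of_nat d * of_nat d * ((w - w') / b)"
    unfolding RR by (simp add: algebra_simps diff_divide_distrib)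
  finally show ?thesis by (simp add: b_def)
qed

text \<open>
  Among the monic polynomials of degree \<open>deg q\<close>, the polynomial \<open>q\<close> divided by its leading coefficient
  gives \<open>K = q\<^sup>-\<^sup>1(A)\<close> an image of least diameter: for two points of \<open>A\<close> at distance
  \<open>diameter A\<close>, the mean difference of \<open>P\<close> between their fibres is fixed by
  \<open>monic_fibre_mean\<close>. If \<open>P\<close> attains the minimum, all these differences equal their mean, so
  \<open>P\<close> minus the normalized \<open>q\<close> is one constant on both fibres, and therefore everywhere.
\<close>

lemma monic_image_diameter:
  fixes q P :: "complex poly" and A K :: "complex set"
  assumes A: "compact A" "A \<noteq> {}" and K: "K = poly q -` A"
    and d: "degree q > 0" "degree P = degree q" "lead_coeff P = 1"
    and D: "\<And>x y. x \<in> K \<Longrightarrow> y \<in> K \<Longrightarrow> cmod (poly P x - poly P y) \<le> D"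
  shows "diameter A / cmod (lead_coeff q) \<le> D"
    and "(\<And>a. A \<noteq> {a}) \<Longrightarrow> D = diameter A / cmod (lead_coeff q) \<Longrightarrow> \<exists>c. P = smult (1 / lead_coeff q) q + [:c:]"
proof -
  define b d where "b = lead_coeff q" and "d = degree q"
  have b: "b \<noteq> 0" using d b_def by auto
  obtain w w' where w: "w \<in> A" "w' \<in> A" "dist w w' = diameter A"
    using diameter_compact_attained[OF A] by auto
  obtain \<zeta> where z: "q - [:w:] = smult b (\<Prod>i<d. [:- \<zeta> i, 1:])"
    "\<And>i. i < d \<Longrightarrow> poly q (\<zeta> i) = w" "\<And>x. poly q x = w \<Longrightarrow> \<exists>i<d. x = \<zeta> i"
    using fibre_enumeration[OF d(1)] unfolding b_def d_def by metis
  obtain \<xi> where x: "q - [:w':] = smult b (\<Prod>i<d. [:- \<xi> i, 1:])"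
    "\<And>i. i < d \<Longrightarrow> poly q (\<xi> i) = w'" "\<And>x. poly q x = w' \<Longrightarrow> \<exists>i<d. x = \<xi> i"
    using fibre_enumeration[OF d(1)] unfolding b_def d_def by metis
  define I where "I = {..<d}\<times>{..<d}"
  have dpos: "d > 0" using d d_def by auto
  have card: "card I > 0" "finite I" using dpos by (auto simp: I_def)
  define v where "v = (\<lambda>(i,j). poly P (\<zeta> i) - poly P (\<xi> j))"
  have mean: "(\<Sum>i\<in>I. v i) = of_nat (card I) * ((w - w') / b)"
    unfolding v_def I_def b_def
    by (rule monic_fibre_mean) (use z x d dpos in \<open>auto simp: b_def d_def\<close>)
  have vD: "cmod (v i) \<le> D" if "i \<in> I" for i
    using that D z(2) x(2) w K by (auto simp: v_def I_def)
  have "card I * cmod ((w - w') / b) = cmod (\<Sum>i\<in>I. v i)" by (simp only: mean norm_mult) simp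
  also have "\<dots> \<le> card I * D" using sum_norm_bound[of I v D] vD by simp
  finally have le: "cmod ((w - w') / b) \<le> D" using card by simp
  then show "diameter A / cmod (lead_coeff q) \<le> D"
    using w by (simp add: norm_divide dist_norm b_def)
  assume ns: "\<And>a. A \<noteq> {a}" and "D = diameter A / cmod (lead_coeff q)"
  then have "D = cmod ((w - w') / b)" using w by (simp add: norm_divide dist_norm b_def)
  then have eq: "v i = (w - w') / b" if "i \<in> I" for i
    using mean_extremal[OF card(2) _ mean that] vD by simp
  have ww: "w \<noteq> w'"
  proof
    assume "w = w'"
    then have dA: "diameter A = 0" using w by simp
    have "x = w" if "x \<in> A" for x
      using diameter_bounded_bound[OF compact_imp_bounded[OF A(1)] that w(1)] dA by simp
    then show False using ns[of w] w by blast
  qed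
  define c where "c = poly P (\<zeta> 0) - w / b"
  have c1: "poly P y = w / b + c" if yw: "poly q y = w" for y
  proof -
    obtain i where i: "i < d" "y = \<zeta> i" using z(3)[OF yw] by blast
    have "poly P (\<zeta> i) - poly P (\<xi> 0) = poly P (\<zeta> 0) - poly P (\<xi> 0)"
      using eq[of "(i, 0)"] eq[of "(0, 0)"] dpos i by (simp add: v_def I_def)
    then show ?thesis using i by (simp add: c_def)
  qed
  have c2: "poly P y = w' / b + c" if yw: "poly q y = w'" for y
  proof -
    obtain i where i: "i < d" "y = \<xi> i" using x(3)[OF yw] by blast
    have "poly P (\<zeta> 0) - poly P (\<xi> i) = (w - w') / b"
      using eq[of "(0, i)"] dpos i by (simp add: v_def I_def)
    then show ?thesis using i by (simp add: c_def diff_divide_distrib algebra_simps)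
  qed
  \<comment> \<open>the leading terms cancel, so \<open>E\<close> has degree less than \<open>d\<close>\<close>
  define E where "E = P - smult (1/b) q - [:c:]"
  have "degree E < degree q"
  proof -
    have "degree E \<le> d" unfolding E_def using d dpos by (intro degree_diff_le) (auto simp: d_def)
    moreover have "coeff E d = 0" unfolding E_def using d b dpos by (simp add: b_def d_def coeff_pCons split: nat.split)
    ultimately show ?thesis using dpos by (metis d_def degree_0 leading_coeff_0_iff le_neq_implies_less)
  qed
  moreover have "poly E y = 0" if "poly q y = w \<or> poly q y = w'" for y
    using that
  proof
    assume "poly q y = w"
    with c1[OF this] show ?thesis by (simp add: E_def)
  next
    assume "poly q y = w'"
    with c2[OF this] show ?thesis by (simp add: E_def)
  qed
  ultimately have "E = 0"
    using poly_vanishing_on_two_fibres[OF _ ww, of E q] by blast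
  then show "\<exists>c. P = smult (1 / lead_coeff q) q + [:c:]"
    by (auto simp: E_def b_def algebra_simps)
qed

text \<open>
  Both normalized polynomials have degree \<open>deg q1\<close> and minimise the diameter of the image of the same
  set, so the minimal values agree and uniqueness of the minimiser applies.
\<close>

theorem equal_preimages_affine:
  fixes q1 q2 :: "complex poly" and A B :: "complex set"
  assumes A: "compact A" "A \<noteq> {}" "\<And>a. A \<noteq> {a}" and B: "compact B"
    and deg: "degree q1 > 0" "degree q2 = degree q1"
    and eq: "poly q1 -` A = poly q2 -` B"
  obtains \<alpha> \<beta> where "\<alpha> \<noteq> 0" "q2 = smult \<alpha> q1 + [:\<beta>:]"
proof -
  define b1 b2 where "b1 = lead_coeff q1" and "b2 = lead_coeff q2"
  have b: "b1 \<noteq> 0" "b2 \<noteq> 0"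
  proof -
    have "q1 \<noteq> 0" "q2 \<noteq> 0" using deg by auto
    then show "b1 \<noteq> 0" "b2 \<noteq> 0" unfolding b1_def b2_def by simp_all
  qed
  have ne: "B \<noteq> {}"
  proof -
    obtain w where "w \<in> A" using A by blast
    then obtain x where "x \<in> poly q1 -` A" using poly_surj[OF deg(1), of w] by auto
    then show ?thesis unfolding eq by auto
  qed
  have diam: "cmod (poly (smult (1 / lead_coeff q) q) x - poly (smult (1 / lead_coeff q) q) y)
      \<le> diameter C / cmod (lead_coeff q)"
    if "compact C" "x \<in> poly q -` C" "y \<in> poly q -` C" for q C x y
  proof -
    have "cmod (poly q x - poly q y) \<le> diameter C"
      using diameter_bounded_bound[OF compact_imp_bounded[OF that(1)], of "poly q x" "poly q y"] that
      by (simp add: dist_norm)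
    then show ?thesis
      by (simp add: norm_divide divide_right_mono flip: diff_divide_distrib)
  qed
  have monic: "degree (smult (1 / lead_coeff q) q) = degree q" "lead_coeff (smult (1 / lead_coeff q) q) = 1"
    if "degree q > 0" for q :: "complex poly"
    using that by auto
  have d2: "degree q2 > 0" using deg by simp
  define M1 M2 where "M1 = smult (1 / lead_coeff q1) q1" and "M2 = smult (1 / lead_coeff q2) q2"
  have M1: "degree M1 = degree q2" "lead_coeff M1 = 1"
    using monic[OF deg(1)] unfolding M1_def deg(2) by auto
  have M2: "degree M2 = degree q1" "lead_coeff M2 = 1"
    using monic[OF d2] unfolding M2_def deg(2)[symmetric] by auto
  have diam1: "cmod (poly M1 x - poly M1 y) \<le> diameter A / cmod b1"
    if "x \<in> poly q2 -` B" "y \<in> poly q2 -` B" for x y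
    using diam[OF A(1)] that unfolding M1_def b1_def eq[symmetric] by blast
  have diam2: "cmod (poly M2 x - poly M2 y) \<le> diameter B / cmod b2"
    if "x \<in> poly q1 -` A" "y \<in> poly q1 -` A" for x y
    using diam[OF B] that unfolding M2_def b2_def eq by blast
  have le1: "diameter A / cmod b1 \<le> diameter B / cmod b2"
    unfolding b1_def by (rule monic_image_diameter(1)[OF A(1,2) refl deg(1) M2 diam2])
  have le2: "diameter B / cmod b2 \<le> diameter A / cmod b1"
    unfolding b2_def by (rule monic_image_diameter(1)[OF B ne refl d2 M1 diam1])
  have "diameter B / cmod b2 = diameter A / cmod (lead_coeff q1)"
    using le1 le2 by (simp add: b1_def)
  from monic_image_diameter(2)[OF A(1,2) refl deg(1) M2 diam2 A(3) this]
  have "\<exists>c. M2 = smult (1 / lead_coeff q1) q1 + [:c:]" .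
  then obtain c where "smult (1 / b2) q2 = smult (1 / b1) q1 + [:c:]"
    by (auto simp: b1_def b2_def M2_def)
  then have "smult b2 (smult (1 / b2) q2) = smult b2 (smult (1 / b1) q1 + [:c:])" by simp
  then have "q2 = smult (b2 / b1) q1 + [:b2 * c:]" using b by (simp add: smult_add_right)
  then show thesis using that[of "b2 / b1" "b2 * c"] b by simp
qed

section \<open>Filled Julia sets of sequences of polynomials\<close>

primrec seq_orbit :: "(nat \<Rightarrow> complex poly) \<Rightarrow> nat \<Rightarrow> complex \<Rightarrow> complex" where
  "seq_orbit g 0 w = w"
| "seq_orbit g (Suc n) w = poly (g n) (seq_orbit g n w)"

definition filled_set :: "nat \<Rightarrow> (nat \<Rightarrow> complex poly) \<Rightarrow> complex set" where
  "filled_set d g = {w. lim (\<lambda>n. log_plus (cmod (seq_orbit g n w)) / real d ^ n) = 0}"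

text \<open>
  The third condition keeps the leading coefficients away from 0 on the exponential scale \<open>d\<^sup>n\<close> on
  which escape is measured; it is what makes the Green function finite and positive somewhere.
\<close>

definition tame_sequence :: "nat \<Rightarrow> (nat \<Rightarrow> complex poly) \<Rightarrow> bool" where
  "tame_sequence d g \<longleftrightarrow> (\<forall>n. degree (g n) = d) \<and> (\<exists>M. \<forall>n j. cmod (coeff (g n) j) \<le> M) \<and>
     summable (\<lambda>n. ln (cmod (lead_coeff (g n))) / real d ^ n)"

lemma seq_orbit_shift:
  "seq_orbit g (Suc n) w = seq_orbit (\<lambda>k. g (Suc k)) n (poly (g 0) w)"
  by (induction n) auto

lemma log_plus_nonneg: "log_plus x \<ge> 0"
  by (simp add: log_plus_def)

lemma tame_shift:
  assumes "tame_sequence d g"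
  shows "tame_sequence d (\<lambda>k. g (Suc k))"
proof -
  have "summable (\<lambda>n. ln (cmod (lead_coeff (g n))) / real d ^ n)"
    using assms unfolding tame_sequence_def by blast
  from summable_mult[OF summable_ignore_initial_segment[OF this, of 1], of "real d"]
  have "summable (\<lambda>n. real d * (ln (cmod (lead_coeff (g (Suc n)))) / real d ^ Suc n))"
    by simp
  moreover have "real d * (ln (cmod (lead_coeff (g (Suc n)))) / real d ^ Suc n)
      = ln (cmod (lead_coeff (g (Suc n)))) / real d ^ n \<or> d = 0" for n
    by simp
  moreover have "d = 0 \<Longrightarrow> summable (\<lambda>n. ln (cmod (lead_coeff (g (Suc n)))) / real d ^ n)"
    by (rule summable_finite[of "{0}"]) auto
  ultimately show ?thesis using assms unfolding tame_sequence_def by (cases "d = 0") auto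
qed

text \<open>
  The defining sequence of the shifted orbit is \<open>d\<close> times the shift of the original one. If they
  diverge, both limits are the same unspecified number, so the equation needs no convergence.
\<close>

lemma filled_set_vimage:
  assumes "d > 0"
  shows "filled_set d g = poly (g 0) -` filled_set d (\<lambda>k. g (Suc k))"
proof -
  have "(lim (\<lambda>n. log_plus (cmod (seq_orbit g n w)) / real d ^ n) = 0) \<longleftrightarrow>
     (lim (\<lambda>n. log_plus (cmod (seq_orbit (\<lambda>k. g (Suc k)) n (poly (g 0) w))) / real d ^ n) = 0)"
    (is "lim ?x = 0 \<longleftrightarrow> lim ?y = 0") for w
  proof -
    have yx: "?y n = real d * ?x (Suc n)" for n
      using assms by (simp only: seq_orbit_shift) simp
    have lims: "?x \<longlonglongrightarrow> L \<longleftrightarrow> ?y \<longlonglongrightarrow> real d * L" for L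
    proof -
      have "?y \<longlonglongrightarrow> real d * L \<longleftrightarrow> (\<lambda>n. ?x (Suc n)) \<longlonglongrightarrow> L"
        unfolding yx using assms by (intro tendsto_mult_left_iff) simp
      then show ?thesis using filterlim_sequentially_Suc[of ?x] by blast
    qed
    show ?thesis
    proof (cases "convergent ?x")
      case True
      then obtain L where L: "?x \<longlonglongrightarrow> L" by (auto simp: convergent_def)
      then have "lim ?x = L" "lim ?y = real d * L" using lims by (auto intro: limI)
      then show ?thesis using assms by simp
    next
      case False
      then have nx: "\<not> ?x \<longlonglongrightarrow> L" for L by (auto simp: convergent_def)
      have ny: "\<not> ?y \<longlonglongrightarrow> L" for L
        using nx[of "L / real d"] lims[of "L / real d"] assms by simp
      have "lim ?x = lim ?y" unfolding lim_def using nx ny by simp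
      then show ?thesis by simp
    qed
  qed
  then show ?thesis by (auto simp: filled_set_def)
qed

lemma tame_growth:
  fixes h :: "complex poly"
  assumes h: "degree h = d" "d > 0" "\<And>j. cmod (coeff h j) \<le> M" "M > 0"
    and w: "cmod w \<ge> 2 * real d * M / cmod (lead_coeff h)" "cmod w \<ge> 1"
  shows "cmod (lead_coeff h) * cmod w ^ d / 2 \<le> cmod (poly h w)"
    and "cmod (poly h w) \<le> 2 * (cmod (lead_coeff h) * cmod w ^ d)"
proof -
  define b where "b = cmod (lead_coeff h)"
  have b: "b > 0" using h by (auto simp: b_def)
  have "poly h w = (\<Sum>j<d. coeff h j * w ^ j) + lead_coeff h * w ^ d"
    by (simp add: poly_altdef h(1) lessThan_Suc_atMost[symmetric])
  moreover have "cmod (\<Sum>j<d. coeff h j * w ^ j) \<le> b * cmod w ^ d / 2"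
  proof -
    have "cmod (\<Sum>j<d. coeff h j * w ^ j) \<le> real (card {..<d}) * (M * cmod w ^ (d - 1))"
    proof (rule sum_norm_bound)
      fix j assume "j \<in> {..<d}"
      then have "cmod w ^ j \<le> cmod w ^ (d - 1)" using w(2) by (intro power_increasing) auto
      then show "cmod (coeff h j * w ^ j) \<le> M * cmod w ^ (d - 1)"
        using h(3)[of j] h(4) by (simp add: norm_mult norm_power mult_mono)
    qed
    also have "\<dots> = (2 * d * M / b) * b / 2 * cmod w ^ (d - 1)" using b by simp
    also have "\<dots> \<le> cmod w * b / 2 * cmod w ^ (d - 1)"
      using w(1) b unfolding b_def by (intro mult_right_mono divide_right_mono) auto
    also have "\<dots> = b * cmod w ^ d / 2"
      using h(2) by (cases d) auto
    finally show ?thesis .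
  qed
  moreover have "cmod (lead_coeff h * w ^ d) = b * cmod w ^ d"
    by (simp add: norm_mult norm_power b_def)
  ultimately show "cmod (lead_coeff h) * cmod w ^ d / 2 \<le> cmod (poly h w)"
    and "cmod (poly h w) \<le> 2 * (cmod (lead_coeff h) * cmod w ^ d)"
    using norm_diff_ineq[of "lead_coeff h * w ^ d" "\<Sum>j<d. coeff h j * w ^ j"]
      norm_triangle_ineq[of "\<Sum>j<d. coeff h j * w ^ j" "lead_coeff h * w ^ d"]
      b by (auto simp: b_def add.commute)
qed

lemma summable_geometric_real: "d \<ge> 2 \<Longrightarrow> summable (\<lambda>n. c / real d ^ n)"
proof -
  assume "d \<ge> 2"
  then have "summable (\<lambda>n. c * (1 / real d) ^ n)"
    by (intro summable_mult summable_geometric) simp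
  then show ?thesis by (simp add: power_divide)
qed

text \<open>
  With \<open>a\<^sub>n = ln (2 d M / \<bar>b\<^sub>n\<bar>)\<close> and \<open>T\<^sub>n\<close> the sum of the \<open>a\<^bsub>n+k\<^esub> / d\<^sup>k\<close>, the radii \<open>S\<^sub>n = exp T\<^sub>n\<close>
  satisfy \<open>T\<^bsub>n+1\<^esub> = d T\<^sub>n - d a\<^sub>n\<close>: outside the disc of radius \<open>S\<^sub>n\<close> the leading term dominates and
  points are mapped outside the disc of radius \<open>S\<^bsub>n+1\<^esub>\<close>. There \<open>ln \<bar>w\<^sub>k\<bar> / d\<^sup>k\<close> changes by
  summable amounts and its limit is at least \<open>T\<^sub>n - T\<^sub>n / d > 0\<close>.
\<close>

lemma tame_escape_radii:
  assumes tame: "tame_sequence d g" and d: "d \<ge> 2"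
  obtains S where "\<And>n. S n \<ge> 1" "(\<lambda>n. ln (S n) / real d ^ n) \<longlonglongrightarrow> 0"
    "\<And>n w. cmod w > S n \<Longrightarrow> cmod (poly (g n) w) > S (Suc n)"
    "\<And>n w. cmod w \<ge> S n \<Longrightarrow> w \<notin> filled_set d (\<lambda>k. g (k + n))"
proof -
  obtain M0 where M0: "\<And>n j. cmod (coeff (g n) j) \<le> M0"
    using tame by (auto simp: tame_sequence_def)
  define M where "M = max 1 M0"
  have M: "M \<ge> 1" "\<And>n j. cmod (coeff (g n) j) \<le> M"
    using M0 by (auto simp: M_def le_max_iff_disj)
  define b where "b n = cmod (lead_coeff (g n))" for n
  have deg: "degree (g n) = d" for n using tame by (auto simp: tame_sequence_def)
  have b: "b n > 0" "b n \<le> M" for n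
    using deg[of n] d M(2)[of n] by (auto simp: b_def)
  define a where "a n = ln (2 * real d * M / b n)" for n
  have a_eq: "a n = ln (2 * real d * M) - ln (b n)" for n
    using b[of n] M d by (simp add: a_def ln_div)
  have ea: "exp (a n) = 2 * real d * M / b n" for n
    using b[of n] M d by (simp add: a_def)
  have a0: "a n \<ge> 0" for n
  proof -
    have "1 * M \<le> 2 * real d * M" using M(1) d by (intro mult_right_mono) auto
    then have "b n \<le> 2 * real d * M" using b(2)[of n] by simp
    then show ?thesis using b[of n] unfolding a_def by (intro ln_ge_zero) simp
  qed
  define s where "s n = a n / real d ^ n" for n
  have s: "summable s"
  proof -
    have "summable (\<lambda>n. ln (2 * real d * M) / real d ^ n - ln (b n) / real d ^ n)"
      using tame unfolding tame_sequence_def b_def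
      by (intro summable_diff summable_geometric_real d) auto
    moreover have "s = (\<lambda>n. ln (2 * real d * M) / real d ^ n - ln (b n) / real d ^ n)"
      by (rule ext) (simp add: s_def a_eq diff_divide_distrib)
    ultimately show ?thesis by simp
  qed
  have s0: "s n \<ge> 0" for n using a0 by (simp add: s_def)
  define T where "T n = real d ^ n * (\<Sum>k. s (k + n))" for n
  have s_shift: "summable (\<lambda>k. s (k + n))" for n using s by (simp add: summable_iff_shift)
  have T0: "T n \<ge> 0" for n
    unfolding T_def using s0 s_shift by (intro mult_nonneg_nonneg suminf_nonneg) auto
  have T_rec: "T n = a n + T (Suc n) / d" for n
  proof -
    have "(\<Sum>k. s (k + n)) = s n + (\<Sum>k. s (k + Suc n))"
      using suminf_split_head[OF s_shift[of n]] by simp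
    then have "T n = real d ^ n * s n + real d ^ n * (\<Sum>k. s (k + Suc n))"
      by (simp only: T_def distrib_left)
    moreover have "real d ^ n * s n = a n" using d by (simp add: s_def)
    moreover have "T (Suc n) / d = real d ^ n * (\<Sum>k. s (k + Suc n))" using d by (simp add: T_def)
    ultimately show ?thesis by linarith
  qed
  have Ta: "T n \<ge> a n" for n using T_rec[of n] T0[of "Suc n"] by simp
  have T_tendsto: "(\<lambda>n. T n / real d ^ n) \<longlonglongrightarrow> 0"
  proof -
    have "T n / real d ^ n = suminf s - (\<Sum>i<n. s i)" for n
      using d by (simp add: T_def suminf_minus_initial_segment[OF s])
    moreover have "(\<lambda>n. suminf s - (\<Sum>i<n. s i)) \<longlonglongrightarrow> suminf s - suminf s"
      by (intro tendsto_intros summable_LIMSEQ s)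
    ultimately show ?thesis by simp
  qed
  have step: "d * ln (cmod w) - a n \<le> ln (cmod (poly (g n) w))"
    "ln (cmod (poly (g n) w)) \<le> d * ln (cmod w) + ln (2 * M)"
    "poly (g n) w \<noteq> 0"
    if w: "cmod w \<ge> exp (T n)" for n w
  proof -
    have w1: "cmod w \<ge> 1" using w T0[of n] by (metis exp_ge_add_one_self one_le_exp_iff order.trans)
    have w2: "cmod w \<ge> 2 * real d * M / cmod (lead_coeff (g n))"
      using w Ta[of n] ea[of n] unfolding b_def by (metis exp_le_cancel_iff order.trans)
    have g: "b n * cmod w ^ d / 2 \<le> cmod (poly (g n) w)" "cmod (poly (g n) w) \<le> 2 * (b n * cmod w ^ d)"
      using tame_growth[OF deg _ M(2) _ w2 w1] d M unfolding b_def by auto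
    have pos: "b n * cmod w ^ d > 0" using b(1)[of n] one_le_power[OF w1, of d]
      by (intro mult_pos_pos) linarith+
    then have pos': "cmod (poly (g n) w) > 0" using g by linarith
    then show "poly (g n) w \<noteq> 0" by auto
    have lnp: "ln (b n * cmod w ^ d) = ln (b n) + d * ln (cmod w)"
      using b(1)[of n] w1 one_le_power[OF w1, of d]
      by (subst ln_mult_pos) (auto simp: ln_realpow simp del: one_le_power)
    have "ln (b n * cmod w ^ d / 2) \<le> ln (cmod (poly (g n) w))"
      using g pos pos' by (intro ln_mono) linarith+
    moreover have "ln (b n * cmod w ^ d / 2) = ln (b n) + d * ln (cmod w) - ln 2"
      by (simp only: ln_divide_pos[OF pos zero_less_numeral] lnp)
    moreover have "ln (2 * real d * M) \<ge> ln 2"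
    proof -
      have "1 * 1 \<le> real d * M" using d M by (intro mult_mono) auto
      then show ?thesis by (intro ln_mono) auto
    qed
    ultimately show "d * ln (cmod w) - a n \<le> ln (cmod (poly (g n) w))" by (simp add: a_eq)
    have "ln (cmod (poly (g n) w)) \<le> ln (2 * (b n * cmod w ^ d))"
      using g pos pos' by (intro ln_mono) linarith+
    moreover have "ln (2 * (b n * cmod w ^ d)) = ln 2 + (ln (b n) + d * ln (cmod w))"
      by (simp only: ln_mult_pos[OF zero_less_numeral pos] lnp)
    moreover have "ln (2 * M) = ln 2 + ln M" using M(1) by (subst ln_mult_pos) linarith+
    moreover have "ln (b n) \<le> ln M" using b[of n] M(1) by (intro ln_mono) linarith+
    ultimately show "ln (cmod (poly (g n) w)) \<le> d * ln (cmod w) + ln (2 * M)" by linarith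
  qed
  \<comment> \<open>one factor \<open>a n\<close> of the recursion covers the leading coefficient and the lower terms\<close>
  have T_next: "T (Suc n) \<le> d * T n - a n" for n
  proof -
    have "d * T n = d * a n + d * (T (Suc n) / d)" by (subst T_rec) (simp only: distrib_left)
    then have "T (Suc n) = d * T n - d * a n" using d by simp
    moreover have "1 * a n \<le> d * a n" using a0[of n] d by (intro mult_right_mono) auto
    ultimately show ?thesis by simp
  qed
  have grow: "cmod (poly (g n) w) \<ge> exp (T (Suc n))" if "cmod w \<ge> exp (T n)" for n w
  proof -
    have pos: "cmod w > 0" using that by (metis exp_gt_zero less_le_trans)
    have "T n \<le> ln (cmod w)" using that pos by (simp add: ln_ge_iff)
    then have "d * T n \<le> d * ln (cmod w)" by (intro mult_left_mono) auto
    then have "T (Suc n) \<le> ln (cmod (poly (g n) w))" using T_next[of n] step(1)[OF that] by linarith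
    then show ?thesis using step(3)[OF that] by (simp add: ln_ge_iff)
  qed
  have grow': "cmod (poly (g n) w) > exp (T (Suc n))" if "cmod w > exp (T n)" for n w
  proof -
    have pos: "cmod w > 0" using that by (metis exp_gt_zero less_trans)
    have w: "cmod w \<ge> exp (T n)" using that by simp
    have "T n < ln (cmod w)" using that pos by (metis exp_less_cancel_iff exp_ln)
    then have "d * T n < d * ln (cmod w)" using d by simp
    then have "T (Suc n) < ln (cmod (poly (g n) w))" using T_next[of n] step(1)[OF w] by linarith
    then show ?thesis using step(3)[OF w] by (metis exp_less_cancel_iff exp_ln zero_less_norm_iff)
  qed
  have escape: "w \<notin> filled_set d (\<lambda>k. g (k + n))" if w: "cmod w \<ge> exp (T n)" for n w
  proof -
    define u where "u k = seq_orbit (\<lambda>k. g (k + n)) k w" for k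
    have u: "cmod (u k) \<ge> exp (T (k + n))" for k
    proof (induction k)
      case 0 then show ?case using w by (simp add: u_def)
    next
      case (Suc k) then show ?case using grow[of "k + n" "u k"] by (simp add: u_def)
    qed
    have u1: "cmod (u k) \<ge> 1" for k
      using u[of k] T0[of "k + n"] by (metis one_le_exp_iff order.trans)
    define x where "x k = ln (cmod (u k)) / real d ^ k" for k
    define e where "e k = x (Suc k) - x k" for k
    have uS: "u (Suc k) = poly (g (k + n)) (u k)" for k by (simp add: u_def)
    have e_eq: "e k = (ln (cmod (u (Suc k))) - d * ln (cmod (u k))) / real d ^ Suc k" for k
      using d by (simp add: e_def x_def field_simps)
    \<comment> \<open>lower bound for the growth; it sums to \<open>- T n / d\<close>\<close>
    have e1: "- (a (k + n) / real d ^ Suc k) \<le> e k" for k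
      unfolding e_eq uS minus_divide_left using step(1)[OF u[of k]] by (intro divide_right_mono) auto
    have e2: "e k \<le> ln (2 * M) / real d ^ Suc k" for k
      unfolding e_eq uS using step(2)[OF u[of k]] by (intro divide_right_mono) auto
    have sum_a: "summable (\<lambda>k. a (k + n) / real d ^ Suc k)"
      "(\<Sum>k. a (k + n) / real d ^ Suc k) = T n / d"
    proof -
      have eq: "a (k + n) / real d ^ Suc k = real d ^ n / d * s (k + n)" for k
        using d by (simp add: s_def field_simps power_add)
      show "summable (\<lambda>k. a (k + n) / real d ^ Suc k)"
        unfolding eq by (intro summable_mult s_shift)
      show "(\<Sum>k. a (k + n) / real d ^ Suc k) = T n / d"
        unfolding eq T_def by (subst suminf_mult[OF s_shift]) simp
    qed
    have sum_M: "summable (\<lambda>k. ln (2 * M) / real d ^ Suc k)"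
      using summable_ignore_initial_segment[OF summable_geometric_real[OF d, of "ln (2 * M)"], of 1]
      by simp
    have sum_e: "summable e"
    proof (rule summable_comparison_test)
      have "norm (e k) \<le> a (k + n) / real d ^ Suc k + ln (2 * M) / real d ^ Suc k" for k
      proof -
        have "a (k + n) / real d ^ Suc k \<ge> 0" "ln (2 * M) / real d ^ Suc k \<ge> 0"
          using a0[of "k + n"] M by auto
        then show ?thesis using e1[of k] e2[of k] by simp
      qed
      then show "\<exists>N. \<forall>k\<ge>N. norm (e k) \<le> a (k + n) / real d ^ Suc k + ln (2 * M) / real d ^ Suc k"
        by blast
      show "summable (\<lambda>k. a (k + n) / real d ^ Suc k + ln (2 * M) / real d ^ Suc k)"
        by (intro summable_add sum_a sum_M)
    qed
    have x_eq: "x k = ln (cmod w) + (\<Sum>j<k. e j)" for k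
      by (induction k) (auto simp: e_def x_def u_def)
    have "x \<longlonglongrightarrow> ln (cmod w) + suminf e"
      unfolding x_eq by (intro tendsto_intros summable_LIMSEQ sum_e)
    moreover have "log_plus (cmod (u k)) / real d ^ k = x k" for k
      using u1[of k] by (simp add: log_plus_def x_def max_def)
    ultimately have "lim (\<lambda>k. log_plus (cmod (u k)) / real d ^ k) = ln (cmod w) + suminf e"
      by (simp add: limI)
    moreover have "ln (cmod w) + suminf e > 0"
    proof -
      have "- (T n / d) = (\<Sum>k. - (a (k + n) / real d ^ Suc k))"
        using suminf_minus[OF sum_a(1)] sum_a(2) by simp
      also have "\<dots> \<le> suminf e" using e1 sum_e sum_a by (intro suminf_le summable_minus) auto
      finally have 1: "suminf e \<ge> - (T n / d)" .
      have "b n * 1 < 2 * real d * M"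
      proof -
        have "1 * M < 2 * real d * M" using M(1) d by (intro mult_strict_right_mono) auto
        then show ?thesis using b(2)[of n] by simp
      qed
      then have "a n > 0" using b(1)[of n] unfolding a_def by (intro ln_gt_zero) (simp add: field_simps)
      then have Tpos: "T n > 0" using Ta[of n] by linarith
      have "T n / d < T n" using Tpos d by (simp add: field_simps)
      moreover have "T n \<le> ln (cmod w)" using w
        by (metis exp_gt_zero ln_ge_iff less_le_trans)
      ultimately show ?thesis using 1 by linarith
    qed
    ultimately show ?thesis unfolding filled_set_def u_def by simp
  qed
  show thesis
  proof (rule that[of "\<lambda>n. exp (T n)"])
    show "1 \<le> exp (T n)" for n using T0[of n] by simp
    show "(\<lambda>n. ln (exp (T n)) / real d ^ n) \<longlonglongrightarrow> 0" using T_tendsto by simp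
    show "cmod (poly (g n) w) > exp (T (Suc n))" if "cmod w > exp (T n)" for n w by (rule grow'[OF that])
    show "w \<notin> filled_set d (\<lambda>k. g (k + n))" if "cmod w \<ge> exp (T n)" for n w by (rule escape[OF that])
  qed
qed

lemma open_poly_image:
  fixes q :: "complex poly"
  assumes "degree q > 0" "open U"
  shows "open (poly q ` U)"
proof (rule open_mapping_thm[of _ UNIV])
  show "\<not> poly q constant_on UNIV"
  proof
    assume "poly q constant_on UNIV"
    then obtain c where "\<And>x. poly q x = c" by (auto simp: constant_on_def)
    then have "poly q = poly [:c:]" by auto
    then have "q = [:c:]" by (simp only: poly_eq_poly_eq_iff)
    then show False using assms by simp
  qed
qed (use assms in \<open>auto intro: holomorphic_intros\<close>)

lemma poly_vimage_frontier:
  fixes q :: "complex poly"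
  assumes "degree q > 0"
  shows "frontier (poly q -` A) = poly q -` frontier A"
proof -
  have int: "interior (poly q -` B) = poly q -` interior B" for B
  proof
    show "poly q -` interior B \<subseteq> interior (poly q -` B)"
    proof (rule interior_maximal)
      show "open (poly q -` interior B)"
        by (intro open_vimage) (auto intro: continuous_intros)
    qed (use interior_subset in auto)
    have "poly q ` interior (poly q -` B) \<subseteq> interior B"
      by (rule interior_maximal[OF _ open_poly_image[OF assms]]) (use interior_subset in auto)
    then show "interior (poly q -` B) \<subseteq> poly q -` interior B" by auto
  qed
  show ?thesis
    unfolding frontier_def closure_interior int[of A] vimage_Compl[symmetric] int by auto
qed

lemma tame_bounded:
  assumes "tame_sequence d g" "d \<ge> 2"
  shows "bounded (filled_set d g)"
proof -
  obtain S where "\<And>n w. cmod w \<ge> S n \<Longrightarrow> w \<notin> filled_set d (\<lambda>k. g (k + n))"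
    by (rule tame_escape_radii[OF assms]) blast
  from this[of 0] have "\<And>w. cmod w \<ge> S 0 \<Longrightarrow> w \<notin> filled_set d g" by simp
  then show ?thesis unfolding bounded_iff by (intro exI[of _ "S 0"]) force
qed

lemma subexponential_in_filled_set:
  assumes d: "d \<ge> 2" and S: "\<And>n. S n \<ge> 1" "(\<lambda>n. ln (S n) / real d ^ n) \<longlonglongrightarrow> 0"
    and C: "C \<ge> 1" "\<And>n. cmod (seq_orbit g n w) \<le> C * S n"
  shows "w \<in> filled_set d g"
proof -
  have "(\<lambda>n. ln C / real d ^ n) \<longlonglongrightarrow> 0"
    by (rule summable_LIMSEQ_zero[OF summable_geometric_real[OF d]])
  from tendsto_add[OF this S(2)]
  have lim0: "(\<lambda>n. ln (C * S n) / real d ^ n) \<longlonglongrightarrow> 0"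
  proof -
    have "ln C / real d ^ n + ln (S n) / real d ^ n = ln (C * S n) / real d ^ n" for n
      using C(1) S(1)[of n] by (subst ln_mult_pos) (auto simp: add_divide_distrib)
    then show ?thesis using tendsto_add[OF \<open>(\<lambda>n. ln C / real d ^ n) \<longlonglongrightarrow> 0\<close> S(2)] by simp
  qed
  have "(\<lambda>n. log_plus (cmod (seq_orbit g n w)) / real d ^ n) \<longlonglongrightarrow> 0"
  proof (rule tendsto_sandwich[OF _ _ tendsto_const lim0])
    show "\<forall>\<^sub>F n in sequentially. 0 \<le> log_plus (cmod (seq_orbit g n w)) / real d ^ n"
      by (simp add: log_plus_nonneg)
    have "1 \<le> C * S n" for n using mult_mono[of 1 C 1 "S n"] C(1) S(1)[of n] by simp
    then have "log_plus (cmod (seq_orbit g n w)) \<le> ln (C * S n)" for n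
      using C(2)[of n] unfolding log_plus_def by (intro ln_mono) auto
    then show "\<forall>\<^sub>F n in sequentially. log_plus (cmod (seq_orbit g n w)) / real d ^ n \<le> ln (C * S n) / real d ^ n"
      by (simp add: divide_right_mono)
  qed
  then show ?thesis unfolding filled_set_def by (simp add: limI)
qed

lemma seq_orbit_surj:
  assumes "\<And>n. degree (g n) > 0"
  shows "\<exists>w. seq_orbit g n w = y"
proof (induction n arbitrary: y)
  case (Suc n)
  obtain x where "poly (g n) x = y" using poly_surj[OF assms[of n]] by blast
  then show ?case using Suc[of x] by auto
qed auto

lemma continuous_seq_orbit: "continuous_on UNIV (seq_orbit g n)"
  by (induction n) (auto intro!: continuous_intros)

text \<open>
  The sets of points whose orbit stays in the disc of radius \<open>S\<^sub>n\<close> up to time \<open>n\<close> are nested, compact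
  and nonempty.
\<close>

lemma tame_nonempty:
  assumes "tame_sequence d g" and d: "d \<ge> 2"
  shows "filled_set d g \<noteq> {}"
proof -
  obtain S where S: "\<And>n. S n \<ge> 1" "(\<lambda>n. ln (S n) / real d ^ n) \<longlonglongrightarrow> 0"
    "\<And>n w. cmod w > S n \<Longrightarrow> cmod (poly (g n) w) > S (Suc n)"
    by (rule tame_escape_radii[OF assms]) blast
  define C where "C n = {w. cmod (seq_orbit g n w) \<le> S n}" for n
  have nested: "C (Suc n) \<subseteq> C n" for n
  proof
    fix w assume w: "w \<in> C (Suc n)"
    show "w \<in> C n"
    proof (rule ccontr)
      assume "w \<notin> C n"
      then have "cmod (seq_orbit g n w) > S n" by (simp add: C_def)
      from S(3)[OF this] w show False by (simp add: C_def)
    qed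
  qed
  then have dec: "C n \<subseteq> C m" if "m \<le> n" for m n
    using that lift_Suc_antimono_le[of C] by blast
  have "compact (C n)" for n
  proof -
    have "closed (C n)" unfolding C_def
      by (intro closed_Collect_le continuous_on_norm continuous_seq_orbit continuous_on_const)
    moreover have "C n \<subseteq> cball 0 (S 0)" using dec[of 0 n] by (auto simp: C_def)
    ultimately show ?thesis by (metis bounded_cball bounded_subset compact_eq_bounded_closed)
  qed
  moreover have "C n \<noteq> {}" for n
  proof -
    have "degree (g k) > 0" for k using assms by (auto simp: tame_sequence_def)
    then obtain w where "seq_orbit g n w = 0" using seq_orbit_surj by blast
    then have "w \<in> C n" using S(1)[of n] by (simp add: C_def)
    then show ?thesis by blast
  qed
  ultimately have "(\<Inter>n. C n) \<noteq> {}" using compact_nest[of C] dec by blast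
  then obtain w where "\<And>n. w \<in> C n" by blast
  then have "w \<in> filled_set d g"
    using subexponential_in_filled_set[OF d S(1,2), of 1 g w] by (auto simp: C_def)
  then show ?thesis by blast
qed

lemma frontier_nonempty_compact:
  fixes K :: "complex set"
  assumes "bounded K" "K \<noteq> {}"
  shows "frontier K \<noteq> {}" "compact (frontier K)"
proof -
  have "K \<noteq> UNIV" using assms(1) not_bounded_UNIV by blast
  then show "frontier K \<noteq> {}" using assms(2) frontier_not_empty by blast
  show "compact (frontier K)" using assms(1) by (rule compact_frontier_bounded)
qed

lemma poly_single_fibre:
  fixes q :: "complex poly"
  assumes "degree q > 0" "\<And>x. poly q x = w \<Longrightarrow> x = a"
  shows "poly q x - w = lead_coeff q * (x - a) ^ degree q"
proof -
  obtain \<zeta> where z: "q - [:w:] = smult (lead_coeff q) (\<Prod>i<degree q. [:- \<zeta> i, 1:])"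
    "\<And>i. i < degree q \<Longrightarrow> poly q (\<zeta> i) = w"
    using fibre_enumeration[OF assms(1), of w] by metis
  have "poly q x - w = poly (q - [:w:]) x" by simp
  also have "\<dots> = lead_coeff q * (\<Prod>i<degree q. x - \<zeta> i)"
    unfolding z(1) by (simp add: poly_prod)
  also have "(\<Prod>i<degree q. x - \<zeta> i) = (\<Prod>i<degree q. x - a)"
    using assms(2) z(2) by (intro prod.cong) auto
  finally show ?thesis by simp
qed

text \<open>
  A superattracting orbit with uniform constants attracts a disc: \<open>M (1 / M)\<^sup>d \<le> 1 / M\<close> for \<open>d \<ge> 2\<close>.
\<close>

lemma centred_powers_contract:
  assumes "d \<ge> 2" "M \<ge> 1" "\<And>n x. poly (g n) x - c (Suc n) = L n * (x - c n) ^ d"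
    and "\<And>n. cmod (L n) \<le> M" "cmod (w - c 0) \<le> 1 / M"
  shows "cmod (seq_orbit g n w - c n) \<le> 1 / M"
proof (induction n)
  case (Suc n)
  have "cmod (seq_orbit g (Suc n) w - c (Suc n)) = cmod (L n) * cmod (seq_orbit g n w - c n) ^ d"
    using assms(3)[of n] by (simp add: norm_mult norm_power)
  also have "\<dots> \<le> M * (1 / M) ^ d"
    using Suc assms(2,4) by (intro mult_mono power_mono) auto
  also have "\<dots> \<le> M * (1 / M) ^ 2"
    using assms(1,2) by (intro mult_left_mono power_decreasing) auto
  also have "\<dots> = 1 / M" using assms(2) by (simp add: power2_eq_square)
  finally show ?case .
qed (use assms(5) in simp)

text \<open>
  If the boundary were one point, so would be all its images, and every \<open>g\<^sub>n\<close> would be a centred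
  \<open>d\<close>-th power; then a disc around the point has bounded distance to its orbit, and the
  point is interior.
\<close>

lemma tame_frontier_not_singleton:
  assumes tame: "tame_sequence d g" and d: "d \<ge> 2"
  shows "frontier (filled_set d g) \<noteq> {a}"
proof
  assume a: "frontier (filled_set d g) = {a}"
  obtain S where S: "\<And>n. S n \<ge> 1" "(\<lambda>n. ln (S n) / real d ^ n) \<longlonglongrightarrow> 0"
    "\<And>n w. cmod w \<ge> S n \<Longrightarrow> w \<notin> filled_set d (\<lambda>k. g (k + n))"
    by (rule tame_escape_radii[OF assms]) blast
  have deg: "degree (g n) = d" for n using tame by (auto simp: tame_sequence_def)
  define X where "X n = frontier (filled_set d (\<lambda>k. g (k + n)))" for n
  have X: "X n = poly (g n) -` X (Suc n)" for n
  proof -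
    have "filled_set d (\<lambda>k. g (k + n)) = poly (g n) -` filled_set d (\<lambda>k. g (k + Suc n))"
      using filled_set_vimage[of d "\<lambda>k. g (k + n)"] d by simp
    then show ?thesis unfolding X_def using deg[of n] d by (simp add: poly_vimage_frontier)
  qed
  define c where "c n = seq_orbit g n a" for n
  have Xc: "X n = {c n}" for n
  proof (induction n)
    case 0 then show ?case using a by (simp add: X_def c_def)
  next
    case (Suc n)
    have "y = c (Suc n)" if "y \<in> X (Suc n)" for y
    proof -
      obtain x where x: "poly (g n) x = y" using poly_surj[of "g n"] deg[of n] d by auto
      then have "x \<in> X n" using that X[of n] by blast
      then show ?thesis using Suc x by (simp add: c_def)
    qed
    moreover have "c (Suc n) \<in> X (Suc n)" using X[of n] Suc by (auto simp: c_def)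
    ultimately show ?case by blast
  qed
  have g: "poly (g n) x - c (Suc n) = lead_coeff (g n) * (x - c n) ^ d" for n x
  proof -
    have "y = c n" if "poly (g n) y = c (Suc n)" for y
    proof -
      have "y \<in> X n" using that Xc[of "Suc n"] X[of n] by blast
      then show ?thesis using Xc[of n] by simp
    qed
    then show ?thesis
      using poly_single_fibre[of "g n" "c (Suc n)" "c n" x] deg[of n] d by simp
  qed
  obtain M0 where M0: "\<And>n j. cmod (coeff (g n) j) \<le> M0"
    using tame by (auto simp: tame_sequence_def)
  define M where "M = max 1 M0"
  have M: "M \<ge> 1" "\<And>n j. cmod (coeff (g n) j) \<le> M"
    using M0 by (auto simp: M_def le_max_iff_disj)
  have near: "cmod (seq_orbit g n w - c n) \<le> 1 / M" if w: "cmod (w - a) \<le> 1 / M" for w n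
    by (rule centred_powers_contract[where L = "\<lambda>n. lead_coeff (g n)", OF d M(1) g M(2)])
      (use w in \<open>simp add: c_def\<close>)
  have cS: "cmod (c n) \<le> S n" for n
  proof -
    have "filled_set d (\<lambda>k. g (k + n)) \<subseteq> cball 0 (S n)"
      using S(3)[of n] by (force simp: not_le)
    then have "X n \<subseteq> cball 0 (S n)"
      unfolding X_def frontier_def by (metis Diff_subset closed_cball closure_minimal order.trans)
    then show ?thesis using Xc[of n] by simp
  qed
  have "cball a (1 / M) \<subseteq> filled_set d g"
  proof
    fix w assume "w \<in> cball a (1 / M)"
    then have w: "cmod (w - a) \<le> 1 / M" by (simp add: dist_norm norm_minus_commute)
    have "cmod (seq_orbit g n w) \<le> 2 * S n" for n
    proof -
      have "cmod (seq_orbit g n w) \<le> cmod (seq_orbit g n w - c n) + cmod (c n)"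
        by (metis add.commute diff_add_cancel norm_triangle_ineq)
      also have "\<dots> \<le> 1 / M + S n" using near[OF w] cS by (intro add_mono)
      also have "\<dots> \<le> 2 * S n"
      proof -
        have "1 / M \<le> 1" using M(1) by simp
        then show ?thesis using S(1)[of n] by linarith
      qed
      finally show ?thesis .
    qed
    then show "w \<in> filled_set d g"
      using subexponential_in_filled_set[OF d S(1,2), of 2 g w] by simp
  qed
  then have "a \<in> interior (filled_set d g)"
    using M(1) by (intro interiorI[of "ball a (1 / M)"]) auto
  then show False using a by (auto simp: frontier_def)
qed

section \<open>Julia points whose orbits approach a finite set slowly\<close>

lemma sum_inverse_powers_le: "d \<ge> 2 \<Longrightarrow> (\<Sum>k<n. 1 / real d ^ k) \<le> 2"
proof -
  assume d: "d \<ge> 2"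
  have "(\<Sum>k<n. 1 / real d ^ k) \<le> (\<Sum>k<n. (1 / 2) ^ k)"
    using d by (intro sum_mono) (simp add: power_divide divide_left_mono power_mono)
  also have "\<dots> \<le> 2" by (simp add: sum_gp_strict)
  finally show ?thesis .
qed

lemma sum_log_fibre:
  fixes p :: "complex poly" and \<delta> :: nat
  assumes x: "p - [:y:] = smult (lead_coeff p) (\<Prod>t<\<delta>. [:- x t, 1:])" and v: "poly p v \<noteq> y"
  shows "(\<Sum>t<\<delta>. ln (cmod (v - x t))) = ln (cmod (poly p v - y)) - ln (cmod (lead_coeff p))"
proof -
  have e: "poly p v - y = lead_coeff p * (\<Prod>t<\<delta>. v - x t)"
  proof -
    have "poly p v - y = poly (p - [:y:]) v" by simp
    also have "\<dots> = lead_coeff p * (\<Prod>t<\<delta>. v - x t)" unfolding x by (simp add: poly_prod)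
    finally show ?thesis .
  qed
  have nz: "lead_coeff p \<noteq> 0" "(\<Prod>t<\<delta>. v - x t) \<noteq> 0"
  proof -
    have "lead_coeff p * (\<Prod>t<\<delta>. v - x t) \<noteq> 0" using v unfolding e[symmetric] by simp
    then show "lead_coeff p \<noteq> 0" "(\<Prod>t<\<delta>. v - x t) \<noteq> 0"
      by (metis mult_zero_left, metis mult_zero_right)
  qed
  have "cmod (poly p v - y) = cmod (lead_coeff p) * (\<Prod>t<\<delta>. cmod (v - x t))"
    unfolding e by (simp add: norm_mult prod_norm)
  moreover have "(\<Prod>t<\<delta>. cmod (v - x t)) > 0" using nz(2) by (simp add: prod_norm)
  ultimately have "ln (cmod (poly p v - y)) = ln (cmod (lead_coeff p)) + ln (\<Prod>t<\<delta>. cmod (v - x t))"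
    using nz(1) by (simp add: ln_mult_pos)
  also have "ln (\<Prod>t<\<delta>. cmod (v - x t)) = (\<Sum>t<\<delta>. ln (cmod (v - x t)))"
    
  proof (rule ln_prod)
    show "cmod (v - x t) \<noteq> 0" if "t \<in> {..<\<delta>}" for t
    proof
      assume "cmod (v - x t) = 0"
      then have "(\<Prod>t<\<delta>. v - x t) = 0" using that by (intro prod_zero) auto
      then show False using nz(2) by simp
    qed
  qed simp
  finally show ?thesis by simp
qed

text \<open>
  The mean of \<open>ln \<bar>v - x\<bar>\<close> over the preimages \<open>x\<close> of \<open>y\<close> is \<open>(ln \<bar>p(v) - y\<bar> - ln \<bar>a\<bar>) / \<delta>\<close>. Hence the
  weighted sum of the logarithmic distances of a backward orbit of \<open>y\<close> to given points, averaged
  over all backward orbits of length \<open>n\<close>, is explicit, and some backward orbit is at least as good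
  as the average. The function \<open>tm\<close> is the \<open>m\<close>-step average.
\<close>

lemma backward_orbit_average:
  fixes p :: "complex poly" and \<beta> :: "nat \<Rightarrow> 'i \<Rightarrow> complex" and u :: "nat \<Rightarrow> real"
  assumes \<delta>: "\<delta> = degree p" "\<delta> > 0"
    and avoid: "\<And>k i m. i \<in> I \<Longrightarrow> (poly p ^^ Suc m) (\<beta> k i) \<noteq> y"
  defines "tm \<equiv> \<lambda>m b y. ln (cmod ((poly p ^^ m) b - y)) / real \<delta> ^ m
                    - (\<Sum>j<m. 1 / real \<delta> ^ Suc j) * ln (cmod (lead_coeff p))"
  shows "\<exists>z. (poly p ^^ n) z = y \<and> (\<forall>k<n. \<forall>i\<in>I. (poly p ^^ k) z \<noteq> \<beta> k i) \<and>
    (\<Sum>k<n. u k * (\<Sum>i\<in>I. tm (n - k) (\<beta> k i) y)) \<le> (\<Sum>k<n. u k * (\<Sum>i\<in>I. ln (cmod ((poly p ^^ k) z - \<beta> k i))))"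
  using avoid
proof (induction n arbitrary: y)
  case 0
  then show ?case by auto
next
  case (Suc n)
  obtain x where x: "p - [:y:] = smult (lead_coeff p) (\<Prod>t<\<delta>. [:- x t, 1:])"
    "\<And>t. t < \<delta> \<Longrightarrow> poly p (x t) = y"
    using fibre_enumeration[of p y] \<delta> by metis
  \<comment> \<open>what a backward orbit of length \<open>n\<close> ending at a preimage \<open>w\<close> of \<open>y\<close> can achieve\<close>
  define f where "f w = (\<Sum>k<Suc n. u k * (\<Sum>i\<in>I. tm (n - k) (\<beta> k i) w))" for w
  have mean_tm: "(\<Sum>t<\<delta>. tm m b (x t)) = \<delta> * tm (Suc m) b y" if b: "(poly p ^^ Suc m) b \<noteq> y" for m b
  proof -
    have "(\<Sum>t<\<delta>. tm m b (x t)) = (\<Sum>t<\<delta>. ln (cmod ((poly p ^^ m) b - x t))) / real \<delta> ^ m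
        - \<delta> * ((\<Sum>j<m. 1 / real \<delta> ^ Suc j) * ln (cmod (lead_coeff p)))"
      by (simp add: tm_def sum_subtractf sum_divide_distrib)
    also have "(\<Sum>t<\<delta>. ln (cmod ((poly p ^^ m) b - x t)))
        = ln (cmod ((poly p ^^ Suc m) b - y)) - ln (cmod (lead_coeff p))"
      using sum_log_fibre[OF x(1), of "(poly p ^^ m) b"] b by simp
    also have "(ln (cmod ((poly p ^^ Suc m) b - y)) - ln (cmod (lead_coeff p))) / real \<delta> ^ m
        - \<delta> * ((\<Sum>j<m. 1 / real \<delta> ^ Suc j) * ln (cmod (lead_coeff p))) = \<delta> * tm (Suc m) b y"
    proof -
      define A B E where "A = ln (cmod ((poly p ^^ Suc m) b - y))" and "B = ln (cmod (lead_coeff p))"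
        and "E = (\<Sum>j<m. 1 / real \<delta> ^ Suc j)"
      have "tm (Suc m) b y = A / real \<delta> ^ Suc m - (E + 1 / real \<delta> ^ Suc m) * B"
        by (simp add: tm_def A_def B_def E_def)
      then have "\<delta> * tm (Suc m) b y = (A - B) / real \<delta> ^ m - \<delta> * (E * B)"
      proof -
        have "\<delta> * (A / real \<delta> ^ Suc m) = A / real \<delta> ^ m" "\<delta> * (1 / real \<delta> ^ Suc m) = 1 / real \<delta> ^ m"
          using \<delta>(2) by simp_all
        moreover have "\<delta> * (A / real \<delta> ^ Suc m - (E + 1 / real \<delta> ^ Suc m) * B)
            = \<delta> * (A / real \<delta> ^ Suc m) - \<delta> * (1 / real \<delta> ^ Suc m) * B - \<delta> * (E * B)"
          by (simp only: distrib_right right_diff_distrib distrib_left mult.assoc diff_diff_eq add.commute)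
        ultimately show ?thesis
          by (simp only: \<open>tm (Suc m) b y = _\<close>) (simp add: diff_divide_distrib)
      qed
      then show ?thesis by (simp only: A_def B_def E_def)
    qed
    finally show ?thesis .
  qed
  have "(\<Sum>t<\<delta>. f (x t)) = (\<Sum>k<Suc n. u k * (\<Sum>i\<in>I. \<Sum>t<\<delta>. tm (n - k) (\<beta> k i) (x t)))"
  proof -
    have "(\<Sum>t<\<delta>. f (x t)) = (\<Sum>k<Suc n. \<Sum>t<\<delta>. u k * (\<Sum>i\<in>I. tm (n - k) (\<beta> k i) (x t)))"
      unfolding f_def by (rule sum.swap)
    also have "\<dots> = (\<Sum>k<Suc n. u k * (\<Sum>t<\<delta>. \<Sum>i\<in>I. tm (n - k) (\<beta> k i) (x t)))"
      by (simp only: sum_distrib_left)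
    also have "\<dots> = (\<Sum>k<Suc n. u k * (\<Sum>i\<in>I. \<Sum>t<\<delta>. tm (n - k) (\<beta> k i) (x t)))"
      by (intro sum.cong refl arg_cong2[where f = "(*)"] sum.swap)
    finally show ?thesis .
  qed
  also have "\<dots> = (\<Sum>k<Suc n. u k * (\<Sum>i\<in>I. \<delta> * tm (Suc n - k) (\<beta> k i) y))"
  proof (intro sum.cong refl arg_cong2[where f = "(*)"])
    fix k i assume "k \<in> {..<Suc n}" "i \<in> I"
    then show "(\<Sum>t<\<delta>. tm (n - k) (\<beta> k i) (x t)) = \<delta> * tm (Suc n - k) (\<beta> k i) y"
      using mean_tm[OF Suc.prems[of i "n - k" k]] by (simp add: Suc_diff_le)
  qed
  also have "\<dots> = \<delta> * (\<Sum>k<Suc n. u k * (\<Sum>i\<in>I. tm (Suc n - k) (\<beta> k i) y))" (is "_ = real \<delta> * ?r")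
    by (simp only: sum_distrib_left mult.left_commute)
  finally have mean: "(\<Sum>t<\<delta>. f (x t)) = \<delta> * ?r" .
  have "\<exists>t<\<delta>. ?r \<le> f (x t)"
  proof (rule ccontr)
    assume "\<not> (\<exists>t<\<delta>. ?r \<le> f (x t))"
    then have "(\<Sum>t<\<delta>. f (x t)) < (\<Sum>t<\<delta>. ?r)"
      using \<delta>(2) by (intro sum_strict_mono) auto
    then show False using mean by simp
  qed
  then obtain t where t: "t < \<delta>" "?r \<le> f (x t)" by blast
  have px: "poly p (x t) = y" using x(2) t by simp
  have "(poly p ^^ Suc m) (\<beta> k i) \<noteq> x t" if "i \<in> I" for k i m
  proof
    assume "(poly p ^^ Suc m) (\<beta> k i) = x t"
    then have "(poly p ^^ Suc (Suc m)) (\<beta> k i) = y" using px by simp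
    then show False using Suc.prems[OF that, of "Suc m" k] by simp
  qed
  from Suc.IH[OF this] obtain z where z: "(poly p ^^ n) z = x t"
    "\<And>k i. k < n \<Longrightarrow> i \<in> I \<Longrightarrow> (poly p ^^ k) z \<noteq> \<beta> k i"
    "(\<Sum>k<n. u k * (\<Sum>i\<in>I. tm (n - k) (\<beta> k i) (x t))) \<le> (\<Sum>k<n. u k * (\<Sum>i\<in>I. ln (cmod ((poly p ^^ k) z - \<beta> k i))))"
    by blast
  have "(poly p ^^ n) z \<noteq> \<beta> n i" if "i \<in> I" for i
    using Suc.prems[OF that, of 0 n] px z(1) by auto
  then have "\<forall>k<Suc n. \<forall>i\<in>I. (poly p ^^ k) z \<noteq> \<beta> k i" using z(2) by (auto simp: less_Suc_eq)
  moreover have "(poly p ^^ Suc n) z = y" using z(1) px by simp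
  moreover have "?r \<le> (\<Sum>k<Suc n. u k * (\<Sum>i\<in>I. ln (cmod ((poly p ^^ k) z - \<beta> k i))))"
  proof -
    have "f (x t) = (\<Sum>k<n. u k * (\<Sum>i\<in>I. tm (n - k) (\<beta> k i) (x t))) + u n * (\<Sum>i\<in>I. ln (cmod ((poly p ^^ n) z - \<beta> n i)))"
      by (simp add: f_def tm_def z(1) norm_minus_commute)
    then show ?thesis using t(2) z(3) by simp
  qed
  ultimately show ?case by blast
qed

lemma poly_escape_radius:
  fixes p :: "complex poly"
  assumes "degree p \<ge> 2"
  obtains R where "R \<ge> 1" "\<And>z. cmod z \<ge> R \<Longrightarrow> cmod (poly p z) \<ge> 2 * cmod z"
proof -
  obtain a p' where p: "p = pCons a p'" by (cases p)
  then have "degree p' \<ge> 1" using assms by (auto split: if_splits)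
  then obtain b p'' where p': "p' = pCons b p''" "p'' \<noteq> 0"
    by (cases p') (auto split: if_splits)
  obtain r where r: "\<And>z. r \<le> cmod z \<Longrightarrow> 3 \<le> cmod (poly p' z)"
    using poly_infinity[OF p'(2), of 3 b] p'(1) by auto
  show thesis
  proof (rule that[of "max 1 (max r (cmod a))"])
    fix z assume z: "max 1 (max r (cmod a)) \<le> cmod z"
    have "3 * cmod z \<le> cmod (poly p' z) * cmod z" using r[of z] z by (intro mult_right_mono) auto
    also have "\<dots> = cmod (z * poly p' z)" by (simp add: norm_mult)
    also have "\<dots> \<le> cmod (poly p z) + cmod a"
      using norm_triangle_ineq4[of "poly p z" a] by (simp add: p)
    finally show "2 * cmod z \<le> cmod (poly p z)" using z by simp
  qed simp
qed

lemma escape_growth: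
  fixes p :: "complex poly"
  assumes "R \<ge> 1" "\<And>z. cmod z \<ge> R \<Longrightarrow> cmod (poly p z) \<ge> 2 * cmod z" "cmod z \<ge> R"
  shows "cmod ((poly p ^^ m) z) \<ge> 2 ^ m * cmod z"
proof (induction m)
  case (Suc m)
  have "1 * cmod z \<le> 2 ^ m * cmod z" by (intro mult_right_mono) auto
  then have "R \<le> cmod ((poly p ^^ m) z)" using Suc assms(3) by linarith
  then show ?case using assms(2)[of "(poly p ^^ m) z"] Suc by simp
qed simp

text \<open>
  Take \<open>y\<close> outside the filled Julia set with its distance from the forward orbits of all \<open>\<beta>\<^sub>k\<close> bounded
  below. The averages of \<open>backward_orbit_average\<close> with weights \<open>1 / d\<^sup>k\<close> are then bounded below uniformly in \<open>n\<close>.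
  The good backward orbits start at points \<open>\<zeta>\<^sub>n\<close> that escape only after time \<open>n\<close>, so a limit point of them
  lies in the Julia set; truncating the sums, whose terms \<open>t\<close> are nonnegative, the bound passes to the limit.
  The targets \<open>\<beta>\<^sub>k\<close> may depend on the time \<open>k\<close>, which is needed to treat a point and its rotation
  simultaneously.
\<close>

lemma julia_point_avoiding:
  fixes p :: "complex poly" and \<beta> :: "nat \<Rightarrow> 'i \<Rightarrow> complex"
  assumes p: "degree p \<ge> 2" and d: "d \<ge> 2" and I: "finite I"
    and R: "R \<ge> 1" "\<And>z. cmod z \<ge> R \<Longrightarrow> cmod (poly p z) \<ge> 2 * cmod z" and y: "cmod y \<ge> R"
    and \<epsilon>: "\<epsilon> > 0" "\<And>k i m. i \<in> I \<Longrightarrow> cmod ((poly p ^^ Suc m) (\<beta> k i) - y) \<ge> \<epsilon>"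
    and L0: "\<And>k i. i \<in> I \<Longrightarrow> cmod (\<beta> k i) \<le> L0"
  obtains z where "z \<in> julia_base p" "\<And>i k. i \<in> I \<Longrightarrow> (poly p ^^ k) z \<noteq> \<beta> k i"
    "\<And>i. i \<in> I \<Longrightarrow> summable (\<lambda>k. ln (cmod ((poly p ^^ k) z - \<beta> k i)) / real d ^ k)"
proof -
  define \<delta> where "\<delta> = degree p"
  have \<delta>: "\<delta> \<ge> 2" using p by (simp add: \<delta>_def)
  define \<rho> L where "\<rho> = cmod y" and "L = max 1 (\<rho> + L0)"
  have L: "L \<ge> 1" "\<rho> + L0 \<le> L" by (auto simp: L_def)
  define u where "u k = 1 / real d ^ k" for k
  have u: "u k > 0" for k using d by (simp add: u_def)
  have avoid: "(poly p ^^ Suc m) (\<beta> k i) \<noteq> y" if "i \<in> I" for k i m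
    using \<epsilon>(2)[OF that, of m k] \<epsilon>(1) by auto
  define tm where "tm m b y = ln (cmod ((poly p ^^ m) b - y)) / real \<delta> ^ m
                    - (\<Sum>j<m. 1 / real \<delta> ^ Suc j) * ln (cmod (lead_coeff p))" for m b y
  \<comment> \<open>\<open>P n z\<close>: the point \<open>z\<close> starts a good backward orbit of length \<open>n\<close>\<close>
  define P where "P n z \<longleftrightarrow> (poly p ^^ n) z = y \<and> (\<forall>k<n. \<forall>i\<in>I. (poly p ^^ k) z \<noteq> \<beta> k i) \<and>
    (\<Sum>k<n. u k * (\<Sum>i\<in>I. tm (n - k) (\<beta> k i) y)) \<le> (\<Sum>k<n. u k * (\<Sum>i\<in>I. ln (cmod ((poly p ^^ k) z - \<beta> k i))))" for n z
  have "\<exists>z. P n z" for n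
    unfolding P_def tm_def by (rule backward_orbit_average[OF \<delta>_def _ avoid]) (use \<delta> in auto)
  then have "\<forall>n. P n (SOME z. P n z)" by (blast intro: someI_ex)
  then obtain \<zeta> where "\<forall>n. P n (\<zeta> n)" by (rule that[of "\<lambda>n. SOME z. P n z"])
  then have \<zeta>: "\<And>n. (poly p ^^ n) (\<zeta> n) = y"
    "\<And>n k i. k < n \<Longrightarrow> i \<in> I \<Longrightarrow> (poly p ^^ k) (\<zeta> n) \<noteq> \<beta> k i"
    "\<And>n. (\<Sum>k<n. u k * (\<Sum>i\<in>I. tm (n - k) (\<beta> k i) y)) \<le> (\<Sum>k<n. u k * (\<Sum>i\<in>I. ln (cmod ((poly p ^^ k) (\<zeta> n) - \<beta> k i))))"
    unfolding P_def by blast+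
  have orbit_le: "cmod ((poly p ^^ k) (\<zeta> n)) \<le> \<rho>" if "k \<le> n" for k n
  proof (rule ccontr)
    assume "\<not> ?thesis"
    then have g: "cmod ((poly p ^^ k) (\<zeta> n)) > \<rho>" by simp
    have "cmod ((poly p ^^ (n - k)) ((poly p ^^ k) (\<zeta> n))) \<ge> 2 ^ (n - k) * cmod ((poly p ^^ k) (\<zeta> n))"
      using g y by (intro escape_growth[OF R]) (auto simp: \<rho>_def)
    moreover have "(poly p ^^ (n - k)) ((poly p ^^ k) (\<zeta> n)) = y"
    proof -
      have "(poly p ^^ ((n - k) + k)) (\<zeta> n) = y" using \<zeta>(1)[of n] that by simp
      then show ?thesis by (simp only: funpow_add comp_apply)
    qed
    moreover have "1 * cmod ((poly p ^^ k) (\<zeta> n)) \<le> 2 ^ (n - k) * cmod ((poly p ^^ k) (\<zeta> n))"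
      by (intro mult_right_mono) auto
    ultimately show False using g by (simp add: \<rho>_def)
  qed
  define c where "c = \<bar>ln \<epsilon>\<bar> + \<bar>ln (cmod (lead_coeff p))\<bar>"
  have tm_ge: "tm (Suc m) (\<beta> k i) y \<ge> - c" if i: "i \<in> I" for m k i
  proof -
    have pos: "cmod ((poly p ^^ Suc m) (\<beta> k i) - y) \<ge> \<epsilon>" using \<epsilon>(2)[OF i] .
    have 1: "ln (cmod ((poly p ^^ Suc m) (\<beta> k i) - y)) \<ge> ln \<epsilon>"
      using pos \<epsilon>(1) by (intro ln_mono) linarith+
    have d1: "real \<delta> ^ Suc m \<ge> 1" using \<delta> by (intro one_le_power) auto
    have "ln (cmod ((poly p ^^ Suc m) (\<beta> k i) - y)) / real \<delta> ^ Suc m \<ge> - \<bar>ln \<epsilon>\<bar> / real \<delta> ^ Suc m"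
      using 1 d1 by (intro divide_right_mono) linarith+
    moreover have "\<bar>ln \<epsilon>\<bar> / real \<delta> ^ Suc m \<le> \<bar>ln \<epsilon>\<bar> / 1"
      using d1 by (intro divide_left_mono) auto
    ultimately have 2: "ln (cmod ((poly p ^^ Suc m) (\<beta> k i) - y)) / real \<delta> ^ Suc m \<ge> - \<bar>ln \<epsilon>\<bar>"
      by simp
    define E where "E = (\<Sum>j<Suc m. 1 / real \<delta> ^ Suc j)"
    have "E = (\<Sum>j<Suc m. 1 / real \<delta> ^ j) / \<delta>"
      unfolding E_def sum_divide_distrib by (simp add: mult.commute)
    also have "\<dots> \<le> 2 / \<delta>" by (intro divide_right_mono sum_inverse_powers_le \<delta>) auto
    also have "\<dots> \<le> 1" using \<delta> by simp
    finally have E: "E \<le> 1" .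
    have E0: "E \<ge> 0" unfolding E_def by (intro sum_nonneg) auto
    have "E * ln (cmod (lead_coeff p)) \<le> E * \<bar>ln (cmod (lead_coeff p))\<bar>"
      using E0 by (intro mult_left_mono) auto
    also have "\<dots> \<le> 1 * \<bar>ln (cmod (lead_coeff p))\<bar>" using E by (intro mult_right_mono) auto
    finally show ?thesis using 2 unfolding tm_def c_def E_def by linarith
  qed
  define t where "t k i z = ln L - ln (cmod ((poly p ^^ k) z - \<beta> k i))" for k i z
  define C where "C = 2 * (card I * (ln L + c))"
  have t0: "t k i z \<ge> 0" if "i \<in> I" "cmod ((poly p ^^ k) z) \<le> \<rho>" "(poly p ^^ k) z \<noteq> \<beta> k i" for k i z
  proof -
    have "cmod ((poly p ^^ k) z - \<beta> k i) \<le> L"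
      using norm_triangle_ineq4[of "(poly p ^^ k) z" "\<beta> k i"] that(2) L0[OF that(1), of k] L by linarith
    then have "ln (cmod ((poly p ^^ k) z - \<beta> k i)) \<le> ln L" using that(3) by (intro ln_mono) auto
    then show ?thesis unfolding t_def by simp
  qed
  have total: "(\<Sum>k<n. u k * (\<Sum>i\<in>I. t k i (\<zeta> n))) \<le> C" for n
  proof -
    have "(\<Sum>k<n. u k * (\<Sum>i\<in>I. t k i (\<zeta> n)))
        = (\<Sum>k<n. u k * (card I * ln L)) - (\<Sum>k<n. u k * (\<Sum>i\<in>I. ln (cmod ((poly p ^^ k) (\<zeta> n) - \<beta> k i))))"
      unfolding t_def by (simp add: sum_subtractf right_diff_distrib)
    also have "\<dots> \<le> (\<Sum>k<n. u k * (card I * ln L)) - (\<Sum>k<n. u k * (\<Sum>i\<in>I. tm (n - k) (\<beta> k i) y))"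
      using \<zeta>(3)[of n] by linarith
    finally have upper: "(\<Sum>k<n. u k * (\<Sum>i\<in>I. t k i (\<zeta> n))) \<le> \<dots>" .
    have "(\<Sum>k<n. u k * (\<Sum>i\<in>I. tm (n - k) (\<beta> k i) y)) \<ge> (\<Sum>k<n. u k * (card I * (- c)))"
    proof (intro sum_mono mult_left_mono)
      fix k assume "k \<in> {..<n}"
      then have e: "n - k = Suc (n - Suc k)" by auto
      have "(\<Sum>i\<in>I. - c) \<le> (\<Sum>i\<in>I. tm (n - k) (\<beta> k i) y)"
        unfolding e by (intro sum_mono tm_ge)
      then show "card I * - c \<le> (\<Sum>i\<in>I. tm (n - k) (\<beta> k i) y)" by simp
    qed (use u in \<open>auto intro: less_imp_le\<close>)
    with upper have "(\<Sum>k<n. u k * (\<Sum>i\<in>I. t k i (\<zeta> n))) \<le> (\<Sum>k<n. u k * (card I * ln L)) - (\<Sum>k<n. u k * (card I * (- c)))"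
      by linarith
    also have "\<dots> = (\<Sum>k<n. u k) * (card I * (ln L + c))"
      unfolding sum_distrib_right sum_subtractf[symmetric] by (intro sum.cong) (auto simp: algebra_simps)
    also have "\<dots> \<le> 2 * (card I * (ln L + c))"
      using L(1) sum_inverse_powers_le[OF d] by (intro mult_right_mono) (auto simp: u_def c_def)
    finally show ?thesis by (simp add: C_def)
  qed
  have single: "(\<Sum>k<N. u k * t k i (\<zeta> n)) \<le> C" if i: "i \<in> I" and n: "N \<le> n" for N n i
  proof -
    have nonneg: "t k i (\<zeta> n) \<ge> 0" if "i \<in> I" "k < n" for k i
      using t0[OF that(1) orbit_le \<zeta>(2)[OF that(2,1)]] that(2) by simp
    have "(\<Sum>k<N. u k * t k i (\<zeta> n)) \<le> (\<Sum>k<n. u k * t k i (\<zeta> n))"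
      using n nonneg[OF i] less_imp_le[OF u] by (intro sum_mono2) (auto intro!: mult_nonneg_nonneg)
    also have "\<dots> \<le> (\<Sum>k<n. u k * (\<Sum>i\<in>I. t k i (\<zeta> n)))"
    proof (intro sum_mono mult_left_mono)
      fix k assume "k \<in> {..<n}"
      then show "t k i (\<zeta> n) \<le> (\<Sum>i\<in>I. t k i (\<zeta> n))"
        using nonneg by (intro member_le_sum I i) auto
    qed (use u in \<open>auto intro: less_imp_le\<close>)
    finally show ?thesis using total[of n] by linarith
  qed
  \<comment> \<open>no single term can be large; so the limit point does not hit a target\<close>
  have dist_ge: "cmod ((poly p ^^ k) (\<zeta> n) - \<beta> k i) \<ge> L * exp (- (C / u k))" if i: "i \<in> I" and n: "k < n" for i k n
  proof -
    have "u k * t k i (\<zeta> n) \<le> (\<Sum>k<Suc k. u k * t k i (\<zeta> n))"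
    proof -
      have "0 \<le> (\<Sum>k<k. u k * t k i (\<zeta> n))"
      proof (intro sum_nonneg mult_nonneg_nonneg)
        fix j assume "j \<in> {..<k}"
        then show "0 \<le> t j i (\<zeta> n)" using t0[OF i orbit_le \<zeta>(2)[OF _ i]] n by simp
      qed (use u in \<open>auto intro: less_imp_le\<close>)
      then show ?thesis by simp
    qed
    also have "\<dots> \<le> C" using single[OF i, of "Suc k" n] n by simp
    finally have "t k i (\<zeta> n) \<le> C / u k" using u[of k] by (simp add: pos_le_divide_eq mult.commute)
    then have "ln L - C / u k \<le> ln (cmod ((poly p ^^ k) (\<zeta> n) - \<beta> k i))" by (simp add: t_def)
    moreover have "cmod ((poly p ^^ k) (\<zeta> n) - \<beta> k i) > 0" using \<zeta>(2)[OF n i] by simp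
    ultimately have "exp (ln L - C / u k) \<le> cmod ((poly p ^^ k) (\<zeta> n) - \<beta> k i)"
      by (metis exp_le_cancel_iff exp_ln)
    then show ?thesis using L(1) by (simp add: exp_diff exp_minus field_simps)
  qed
  have "\<forall>n. \<zeta> n \<in> cball 0 \<rho>" using orbit_le[of 0] by simp
  then obtain z r where r: "strict_mono r" "(\<zeta> \<circ> r) \<longlonglongrightarrow> z"
    using compact_cball[of "0::complex" \<rho>] unfolding compact_def by blast
  have cont: "isCont (poly p ^^ k) w" for k w
    by (induction k) (auto intro!: continuous_intros simp: o_def isCont_o2[where g = "poly p"])
  have lim: "(\<lambda>n. (poly p ^^ k) (\<zeta> (r n))) \<longlonglongrightarrow> (poly p ^^ k) z" for k
    using isCont_tendsto_compose[OF cont r(2)] by (simp add: o_def)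
  have ev: "\<forall>\<^sub>F n in sequentially. k < r n" for k
    using eventually_gt_at_top[of k] by eventually_elim (use seq_suble[OF r(1)] in \<open>auto intro: less_le_trans\<close>)
  have z_orbit: "cmod ((poly p ^^ k) z) \<le> \<rho>" for k
  proof (rule tendsto_upperbound[OF tendsto_norm[OF lim]])
    show "\<forall>\<^sub>F n in sequentially. cmod ((poly p ^^ k) (\<zeta> (r n))) \<le> \<rho>"
      using ev[of k] by eventually_elim (use orbit_le in auto)
  qed simp
  have z_dist: "cmod ((poly p ^^ k) z - \<beta> k i) \<ge> L * exp (- (C / u k))" if "i \<in> I" for k i
  proof (rule tendsto_lowerbound[OF tendsto_norm[OF tendsto_diff[OF lim tendsto_const]]])
    show "\<forall>\<^sub>F n in sequentially. L * exp (- (C / u k)) \<le> cmod ((poly p ^^ k) (\<zeta> (r n)) - \<beta> k i)"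
      using ev[of k] by eventually_elim (use dist_ge[OF that] in auto)
  qed simp
  have z_ne: "(poly p ^^ k) z \<noteq> \<beta> k i" if "i \<in> I" for k i
    using z_dist[OF that, of k] L(1) by (auto simp: mult_le_0_iff not_le)
  have z_sum: "(\<Sum>k<N. u k * t k i z) \<le> C" if i: "i \<in> I" for N i
  proof (rule tendsto_upperbound)
    show "(\<lambda>n. \<Sum>k<N. u k * t k i (\<zeta> (r n))) \<longlonglongrightarrow> (\<Sum>k<N. u k * t k i z)"
      unfolding t_def using z_ne[OF i] by (intro tendsto_intros lim) auto
    show "\<forall>\<^sub>F n in sequentially. (\<Sum>k<N. u k * t k i (\<zeta> (r n))) \<le> C"
      using ev[of N] by eventually_elim (use single[OF i] in auto)
  qed simp
  have "z \<in> filled_julia_base p"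
    using z_orbit by (auto simp: filled_julia_base_def bounded_iff)
  moreover have "z \<in> closure (- filled_julia_base p)"
  proof -
    have "\<zeta> n \<notin> filled_julia_base p" for n
    proof
      assume "\<zeta> n \<in> filled_julia_base p"
      then obtain B where B: "\<And>m. cmod ((poly p ^^ m) (\<zeta> n)) \<le> B"
        by (auto simp: filled_julia_base_def bounded_iff)
      obtain m where m: "2 ^ m > B" using real_arch_pow[of 2 B] by auto
      have "(poly p ^^ (m + n)) (\<zeta> n) = (poly p ^^ m) y" by (simp add: funpow_add \<zeta>(1))
      moreover have "cmod ((poly p ^^ m) y) \<ge> 2 ^ m * cmod y" by (rule escape_growth[OF R y])
      moreover have "2 ^ m * cmod y \<ge> 2 ^ m * 1" using y R by (intro mult_left_mono) auto
      moreover have "cmod ((poly p ^^ (m + n)) (\<zeta> n)) \<le> B" by (rule B)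
      ultimately show False using m by (simp only:)
    qed
    then show ?thesis unfolding closure_sequential using r(2)
      by (intro exI[of _ "\<zeta> \<circ> r"]) auto
  qed
  ultimately have zJ: "z \<in> julia_base p"
    using closure_subset by (auto simp: julia_base_def frontier_closures)
  have "summable (\<lambda>k. ln (cmod ((poly p ^^ k) z - \<beta> k i)) / real d ^ k)" if i: "i \<in> I" for i
  proof -
    have "summable (\<lambda>k. u k * t k i z)"
      by (rule bounded_imp_summable[where B = C])
        (use t0[OF i z_orbit z_ne[OF i]] less_imp_le[OF u] z_sum[OF i, of "Suc _"] in
          \<open>auto simp: lessThan_Suc_atMost intro!: mult_nonneg_nonneg\<close>)
    moreover have "summable (\<lambda>k. u k * ln L)"
    proof -
      have "summable (\<lambda>k. (1 / real d) ^ k)" using d by (intro summable_geometric) simp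
      then show ?thesis unfolding u_def by (intro summable_mult2) (simp add: power_divide)
    qed
    ultimately have "summable (\<lambda>k. u k * ln L - u k * t k i z)" by (rule summable_diff[rotated])
    then show ?thesis by (simp add: t_def u_def right_diff_distrib)
  qed
  then show thesis using that[OF zJ] z_ne by blast
qed

text \<open>
  The distances of a forward orbit from \<open>c\<close> are either bounded or tend to infinity, so in some
  interval \<open>[R1, R1 + 1]\<close> only finitely many values occur.
\<close>

lemma radius_avoiding_orbits:
  fixes p :: "complex poly"
  assumes R: "R \<ge> 1" "\<And>z. cmod z \<ge> R \<Longrightarrow> cmod (poly p z) \<ge> 2 * cmod z" and B: "finite B"
  obtains y \<epsilon> where "cmod y \<ge> R" "\<epsilon> > 0"
    "\<And>b m. b \<in> B \<Longrightarrow> \<bar>cmod ((poly p ^^ m) b - c) - cmod (y - c)\<bar> \<ge> \<epsilon>"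
proof -
  define V where "V b = range (\<lambda>m. cmod ((poly p ^^ m) b - c))" for b
  have "\<exists>R1. \<forall>R2. finite (V b \<inter> {R1..R2})" for b
  proof (cases "\<exists>m. cmod ((poly p ^^ m) b) \<ge> R")
    case True
    then obtain m0 where m0: "cmod ((poly p ^^ m0) b) \<ge> R" by blast
    have "finite (V b \<inter> {0..R2})" for R2
    proof -
      obtain j0 where j0: "2 ^ j0 > R2 + cmod c" using real_arch_pow[of 2 "R2 + cmod c"] by auto
      have big: "cmod ((poly p ^^ m) b - c) > R2" if "m \<ge> m0 + j0" for m
      proof -
        have "(poly p ^^ m) b = (poly p ^^ (m - m0)) ((poly p ^^ m0) b)"
        proof -
          have "(poly p ^^ ((m - m0) + m0)) b = (poly p ^^ (m - m0)) ((poly p ^^ m0) b)"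
            by (simp only: funpow_add comp_apply)
          then show ?thesis using that by simp
        qed
        then have "cmod ((poly p ^^ m) b) \<ge> 2 ^ (m - m0) * cmod ((poly p ^^ m0) b)"
          using escape_growth[OF R m0] by simp
        moreover have "2 ^ (m - m0) * cmod ((poly p ^^ m0) b) \<ge> 2 ^ j0 * 1"
          using that m0 R(1) by (intro mult_mono power_increasing) auto
        ultimately have "cmod ((poly p ^^ m) b) > R2 + cmod c" using j0 by simp
        then show ?thesis using norm_triangle_ineq2[of "(poly p ^^ m) b" c] by linarith
      qed
      have "V b \<inter> {0..R2} \<subseteq> (\<lambda>m. cmod ((poly p ^^ m) b - c)) ` {..<m0 + j0}"
      proof
        fix v assume "v \<in> V b \<inter> {0..R2}"
        then obtain m where m: "v = cmod ((poly p ^^ m) b - c)" "v \<le> R2" by (auto simp: V_def)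
        then have "\<not> m \<ge> m0 + j0" using big[of m] by auto
        then show "v \<in> (\<lambda>m. cmod ((poly p ^^ m) b - c)) ` {..<m0 + j0}" using m(1) by simp
      qed
      then show ?thesis by (rule finite_subset) simp
    qed
    then show ?thesis by blast
  next
    case False
    have "V b \<inter> {R + cmod c + 1..R2} = {}" for R2
    proof -
      have "cmod ((poly p ^^ m) b - c) < R + cmod c + 1" for m
      proof -
        have "cmod ((poly p ^^ m) b) < R" using False by (simp add: not_le)
        then show ?thesis using norm_triangle_ineq4[of "(poly p ^^ m) b" c] by linarith
      qed
      then have "\<not> R + cmod c + 1 \<le> v" if "v \<in> V b" for v
        using that by (auto simp: V_def not_le)
      then show ?thesis by auto
    qed
    then show ?thesis by (metis finite.emptyI)
  qed
  then obtain r where r: "\<And>b R2. finite (V b \<inter> {r b..R2})" by metis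
  define R1 where "R1 = Max (insert (R + cmod c) (r ` B))"
  have R1: "R1 \<ge> R + cmod c" "\<And>b. b \<in> B \<Longrightarrow> r b \<le> R1" using B by (auto simp: R1_def)
  define F where "F = (\<Union>b\<in>B. V b \<inter> {R1..R1 + 1}) \<union> {R1, R1 + 1}"
  have F: "finite F"
  proof -
    have "finite (V b \<inter> {R1..R1 + 1})" if "b \<in> B" for b
      by (rule finite_subset[OF _ r[of b "R1 + 1"]]) (use R1(2)[OF that] in auto)
    then show ?thesis using B unfolding F_def by blast
  qed
  have "infinite ({R1<..<R1 + 1} - F)" using F infinite_Ioo[of R1 "R1 + 1"] by simp
  then obtain \<rho> where \<rho>: "R1 < \<rho>" "\<rho> < R1 + 1" "\<rho> \<notin> F"
    by (metis Diff_iff ex_in_conv finite.emptyI greaterThanLessThan_iff)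
  define \<epsilon> where "\<epsilon> = Min ((\<lambda>v. \<bar>v - \<rho>\<bar>) ` F)"
  have FF: "finite ((\<lambda>v. \<bar>v - \<rho>\<bar>) ` F)" "(\<lambda>v. \<bar>v - \<rho>\<bar>) ` F \<noteq> {}" using F by (auto simp: F_def)
  have \<epsilon>0: "\<epsilon> > 0" unfolding \<epsilon>_def using \<rho>(3) by (subst Min_gr_iff[OF FF]) auto
  have \<epsilon>F: "\<epsilon> \<le> \<bar>v - \<rho>\<bar>" if "v \<in> F" for v unfolding \<epsilon>_def using FF that by (intro Min_le) auto
  define y where "y = c + of_real \<rho>"
  have \<rho>0: "\<rho> \<ge> 0" using \<rho>(1) R1(1) R(1) norm_ge_zero[of c] by linarith
  have yc: "cmod (y - c) = \<rho>" using \<rho>0 by (simp add: y_def)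
  have "cmod y \<ge> R"
    using norm_triangle_ineq4[of y c] yc \<rho>(1) R1(1) by linarith
  moreover have "\<bar>v - \<rho>\<bar> \<ge> \<epsilon>" if "v \<in> V b" "b \<in> B" for v b
  proof (cases "v \<in> {R1..R1 + 1}")
    case True then show ?thesis using that by (intro \<epsilon>F) (auto simp: F_def)
  next
    case False
    then show ?thesis using \<epsilon>F[of R1] \<epsilon>F[of "R1 + 1"] \<rho> by (auto simp: F_def)
  qed
  ultimately show thesis using that[of y \<epsilon>] \<epsilon>0 yc by (auto simp: V_def)
qed

text \<open>
  For \<open>b\<close> the leading coefficient of \<open>q\<close>, these are the conditions of \<open>tame_sequence\<close> on the leading
  coefficients of the fibre maps along the orbit of \<open>z\<close>.
\<close>

definition log_tame :: "nat \<Rightarrow> complex poly \<Rightarrow> complex poly \<Rightarrow> complex \<Rightarrow> bool" where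
  "log_tame d p b z \<longleftrightarrow> (\<forall>k. poly b ((poly p ^^ k) z) \<noteq> 0) \<and>
     summable (\<lambda>k. ln (cmod (poly b ((poly p ^^ k) z))) / real d ^ k)"

text \<open>
  The hypothesis on \<open>p\<close> says that rotations by \<open>c\<close> and its \<open>\<delta>\<^sup>k\<close>-th powers are carried along by the dynamics; it
  holds trivially for \<open>c = 1\<close>, and for all \<open>c\<close> if \<open>p\<close> is a centred power. The distance at time \<open>k\<close> from the
  orbit of the rotated point to a root \<open>x\<close> of \<open>b\<close> is the distance from the orbit of \<open>z\<close> to \<open>x\<close> rotated
  back \<open>\<delta>\<^sup>k\<close> times, which is the time-dependent target \<open>\<beta>\<close>. If there were only finitely many
  such points, adding them to the targets would produce another one.
\<close>

lemma infinite_log_tame: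
  fixes p b :: "complex poly"
  assumes p: "degree p \<ge> 2" and d: "d \<ge> 2" and b: "b \<noteq> 0" and c: "cmod c = 1"
    and rot: "\<And>k z. poly p (\<zeta> + c ^ (degree p ^ k) * z) - \<zeta> = c ^ (degree p ^ Suc k) * (poly p (\<zeta> + z) - \<zeta>)"
  shows "infinite {z \<in> julia_base p. log_tame d p b z \<and> log_tame d p b (\<zeta> + c * (z - \<zeta>))}"
proof
  assume fin: "finite {z \<in> julia_base p. log_tame d p b z \<and> log_tame d p b (\<zeta> + c * (z - \<zeta>))}" (is "finite ?G")
  define \<delta> where "\<delta> = degree p"
  have c0: "c \<noteq> 0" using c by auto
  obtain x where x: "b = smult (lead_coeff b) (\<Prod>i<degree b. [:- x i, 1:])"
    using root_enumeration[OF b] by metis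
  \<comment> \<open>besides the roots of \<open>b\<close>, the points found so far are to be avoided\<close>
  define B where "B = x ` {..<degree b} \<union> ?G"
  have B: "finite B" using fin by (simp add: B_def)
  define I where "I = B \<times> (UNIV :: bool set)"
  define \<beta> where "\<beta> k i = (if snd i then \<zeta> + (fst i - \<zeta>) / c ^ (\<delta> ^ k) else fst i)" for k and i :: "complex \<times> bool"
  obtain R where R: "R \<ge> 1" "\<And>z. cmod z \<ge> R \<Longrightarrow> cmod (poly p z) \<ge> 2 * cmod z"
    using poly_escape_radius[OF p] by blast
  obtain y \<epsilon> where y: "cmod y \<ge> R" "\<epsilon> > 0"
    "\<And>b m. b \<in> B \<Longrightarrow> \<bar>cmod ((poly p ^^ m) b - \<zeta>) - cmod (y - \<zeta>)\<bar> \<ge> \<epsilon>"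
    by (rule radius_avoiding_orbits[OF R B, of \<zeta>]) auto
  have bwd: "(poly p ^^ m) (\<zeta> + (w - \<zeta>) / c ^ (\<delta> ^ k)) = \<zeta> + ((poly p ^^ m) w - \<zeta>) / c ^ (\<delta> ^ (k + m))" for m k w
  proof (induction m)
    case (Suc m)
    define v where "v = (poly p ^^ m) w"
    have "poly p (\<zeta> + c ^ (\<delta> ^ (k + m)) * ((v - \<zeta>) / c ^ (\<delta> ^ (k + m)))) - \<zeta>
        = c ^ (\<delta> ^ Suc (k + m)) * (poly p (\<zeta> + (v - \<zeta>) / c ^ (\<delta> ^ (k + m))) - \<zeta>)"
      unfolding \<delta>_def by (rule rot)
    then have "poly p v - \<zeta> = c ^ (\<delta> ^ Suc (k + m)) * (poly p (\<zeta> + (v - \<zeta>) / c ^ (\<delta> ^ (k + m))) - \<zeta>)"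
      using c0 by simp
    then have "poly p (\<zeta> + (v - \<zeta>) / c ^ (\<delta> ^ (k + m))) = \<zeta> + (poly p v - \<zeta>) / c ^ (\<delta> ^ Suc (k + m))"
      using c0 by simp
    then show ?case using Suc by (simp add: v_def)
  qed simp
  have forw: "(poly p ^^ k) (\<zeta> + c * (w - \<zeta>)) = \<zeta> + c ^ (\<delta> ^ k) * ((poly p ^^ k) w - \<zeta>)" for k w
  proof (induction k)
    case (Suc k)
    have "poly p (\<zeta> + c ^ (\<delta> ^ k) * ((poly p ^^ k) w - \<zeta>)) - \<zeta> = c ^ (\<delta> ^ Suc k) * (poly p (\<zeta> + ((poly p ^^ k) w - \<zeta>)) - \<zeta>)"
      unfolding \<delta>_def by (rule rot)
    then show ?case using Suc by (simp add: diff_eq_eq add.commute)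
  qed simp
  have far: "cmod ((poly p ^^ Suc m) (\<beta> k i) - y) \<ge> \<epsilon>" if iI: "i \<in> I" for k i m
  proof -
    obtain w s where i: "i = (w, s)" "w \<in> B" using iI by (auto simp: I_def)
    have "(poly p ^^ Suc m) (\<zeta> + (w - \<zeta>) / c ^ (\<delta> ^ k)) - \<zeta> = ((poly p ^^ Suc m) w - \<zeta>) / c ^ (\<delta> ^ (k + Suc m))"
      unfolding bwd by simp
    then have "cmod ((poly p ^^ Suc m) (\<beta> k i) - \<zeta>) = cmod ((poly p ^^ Suc m) w - \<zeta>)"
      using c by (cases s) (simp_all add: i \<beta>_def norm_divide norm_power del: funpow.simps)
    then have "\<epsilon> \<le> \<bar>cmod ((poly p ^^ Suc m) (\<beta> k i) - \<zeta>) - cmod (y - \<zeta>)\<bar>"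
      using y(3)[OF i(2), of "Suc m"] by simp
    also have "\<dots> \<le> cmod (((poly p ^^ Suc m) (\<beta> k i) - \<zeta>) - (y - \<zeta>))" by (rule norm_triangle_ineq3)
    finally show ?thesis by simp
  qed
  define L0 where "L0 = cmod \<zeta> + Max (insert 0 ((\<lambda>w. cmod (w - \<zeta>)) ` B))"
  have L0: "cmod (\<beta> k i) \<le> L0" if iI: "i \<in> I" for k i
  proof -
    obtain w s where i: "i = (w, s)" "w \<in> B" using iI by (auto simp: I_def)
    have "cmod (\<beta> k i - \<zeta>) = cmod (w - \<zeta>)"
      using c by (cases s) (simp_all add: i \<beta>_def norm_divide norm_power)
    moreover have "cmod (w - \<zeta>) \<le> Max (insert 0 ((\<lambda>w. cmod (w - \<zeta>)) ` B))"
      using B i(2) by (intro Max_ge) auto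
    moreover have "cmod (\<beta> k i) \<le> cmod \<zeta> + cmod (\<beta> k i - \<zeta>)"
      by (metis add.commute diff_add_cancel norm_triangle_ineq)
    ultimately show ?thesis by (simp add: L0_def)
  qed
  have I: "finite I" using B by (simp add: I_def)
  obtain z where z: "z \<in> julia_base p" "\<And>i k. i \<in> I \<Longrightarrow> (poly p ^^ k) z \<noteq> \<beta> k i"
    "\<And>i. i \<in> I \<Longrightarrow> summable (\<lambda>k. ln (cmod ((poly p ^^ k) z - \<beta> k i)) / real d ^ k)"
  proof (rule julia_point_avoiding[where \<beta> = \<beta>, OF p d I R y(1,2) far L0])
    fix z assume "z \<in> julia_base p" "\<And>i k. i \<in> I \<Longrightarrow> (poly p ^^ k) z \<noteq> \<beta> k i"
      "\<And>i. i \<in> I \<Longrightarrow> summable (\<lambda>k. ln (cmod ((poly p ^^ k) z - \<beta> k i)) / real d ^ k)"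
    then show thesis by (rule that)
  qed
  have rot_dist: "cmod ((poly p ^^ k) (\<zeta> + c * (z - \<zeta>)) - w) = cmod ((poly p ^^ k) z - \<beta> k (w, True))" for k w
  proof -
    have "(poly p ^^ k) (\<zeta> + c * (z - \<zeta>)) - w = c ^ (\<delta> ^ k) * ((poly p ^^ k) z - \<beta> k (w, True))"
      unfolding forw using c0 by (simp add: \<beta>_def field_simps)
    then show ?thesis using c by (simp add: norm_mult norm_power)
  qed
  have tame: "log_tame d p b z'" if "\<And>k i. i < degree b \<Longrightarrow> (poly p ^^ k) z' \<noteq> x i"
    "\<And>i. i < degree b \<Longrightarrow> summable (\<lambda>k. ln (cmod ((poly p ^^ k) z' - x i)) / real d ^ k)" for z'
  proof -
    have bz: "poly b w = lead_coeff b * (\<Prod>i<degree b. w - x i)" for w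
      by (subst x) (simp add: poly_prod)
    have "ln (cmod (poly b ((poly p ^^ k) z'))) = ln (cmod (lead_coeff b)) + (\<Sum>i<degree b. ln (cmod ((poly p ^^ k) z' - x i)))" for k
    proof -
      have pos: "cmod ((poly p ^^ k) z' - x i) > 0" if "i < degree b" for i
        using \<open>\<And>k i. i < degree b \<Longrightarrow> (poly p ^^ k) z' \<noteq> x i\<close>[OF that] by simp
      have "cmod (poly b ((poly p ^^ k) z')) = cmod (lead_coeff b) * (\<Prod>i<degree b. cmod ((poly p ^^ k) z' - x i))"
        unfolding bz by (simp add: norm_mult prod_norm)
      moreover have "(\<Prod>i<degree b. cmod ((poly p ^^ k) z' - x i)) > 0" using pos by (intro prod_pos) auto
      ultimately have "ln (cmod (poly b ((poly p ^^ k) z'))) = ln (cmod (lead_coeff b)) + ln (\<Prod>i<degree b. cmod ((poly p ^^ k) z' - x i))"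
        using b by (simp add: ln_mult_pos)
      also have "ln (\<Prod>i<degree b. cmod ((poly p ^^ k) z' - x i)) = (\<Sum>i<degree b. ln (cmod ((poly p ^^ k) z' - x i)))"
        by (intro ln_prod) (use pos in auto)
      finally show ?thesis .
    qed
    moreover have "summable (\<lambda>k. ln (cmod (lead_coeff b)) / real d ^ k + (\<Sum>i<degree b. ln (cmod ((poly p ^^ k) z' - x i)) / real d ^ k))"
    proof (intro summable_add summable_sum)
      have "summable (\<lambda>k. ln (cmod (lead_coeff b)) * (1 / real d) ^ k)"
        using d by (intro summable_mult summable_geometric) simp
      then show "summable (\<lambda>k. ln (cmod (lead_coeff b)) / real d ^ k)" by (simp add: power_divide)
    qed (use that in auto)
    ultimately show ?thesis
      using that(1) b by (simp add: log_tame_def bz add_divide_distrib sum_divide_distrib prod_zero_iff)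
  qed
  have "log_tame d p b z"
  proof (rule tame)
    fix i assume "i < degree b"
    then have "(x i, False) \<in> I" by (auto simp: I_def B_def)
    then show "(poly p ^^ k) z \<noteq> x i" "summable (\<lambda>k. ln (cmod ((poly p ^^ k) z - x i)) / real d ^ k)" for k
      using z(2)[of "(x i, False)" k] z(3)[of "(x i, False)"] by (auto simp: \<beta>_def)
  qed
  moreover have "log_tame d p b (\<zeta> + c * (z - \<zeta>))"
  proof (rule tame)
    fix i assume "i < degree b"
    then have I: "(x i, True) \<in> I" by (auto simp: I_def B_def)
    show "(poly p ^^ k) (\<zeta> + c * (z - \<zeta>)) \<noteq> x i" for k
      using z(2)[OF I, of k] rot_dist[of k "x i"] by auto
    show "summable (\<lambda>k. ln (cmod ((poly p ^^ k) (\<zeta> + c * (z - \<zeta>)) - x i)) / real d ^ k)"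
      using z(3)[OF I] by (simp add: rot_dist)
  qed
  ultimately have "z \<in> ?G" using z(1) by simp
  then have "(z, False) \<in> I" by (auto simp: I_def B_def)
  then show False using z(2)[of "(z, False)" 0] by (simp add: \<beta>_def)
qed

section \<open>Values of rational functions\<close>

text \<open>
  A form of evaluation that refers to arbitrary representing fractions, not only to the one in lowest
  terms, and therefore is compatible with the field operations for obvious reasons.
\<close>

definition has_value :: "ratfun \<Rightarrow> complex \<Rightarrow> complex \<Rightarrow> bool" where
  "has_value R a x \<longleftrightarrow> (\<exists>u v. R * to_fract v = to_fract u \<and> poly v a \<noteq> 0 \<and> x * poly v a = poly u a)"

lemma ratfun_quot:
  "R * to_fract (snd (quot_of_fract R)) = to_fract (fst (quot_of_fract R))" for R :: ratfun
proof -
  have "R = to_fract (fst (quot_of_fract R)) / to_fract (snd (quot_of_fract R))"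
    by (metis Fract_conv_to_fract Fract_quot_of_fract)
  then show ?thesis by (simp add: nonzero_eq_divide_eq)
qed

lemma has_value_regular: "regular_at R a \<Longrightarrow> has_value R a (ratfun_eval R a)"
  unfolding has_value_def regular_at_def ratfun_eval_def using ratfun_quot[of R]
  by (intro exI[of _ "fst (quot_of_fract R)"] exI[of _ "snd (quot_of_fract R)"]) simp

lemma has_value_unique:
  assumes "has_value R a x" "has_value R a y"
  shows "x = y"
proof -
  obtain u v where 1: "R * to_fract v = to_fract u" "poly v a \<noteq> 0" "x * poly v a = poly u a"
    using assms(1) by (auto simp: has_value_def)
  obtain u' v' where 2: "R * to_fract v' = to_fract u'" "poly v' a \<noteq> 0" "y * poly v' a = poly u' a"
    using assms(2) by (auto simp: has_value_def)
  have "to_fract (u * v') = to_fract (u' * v)"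
    by (simp only: to_fract_mult flip: 1(1) 2(1)) (simp only: mult_ac)
  then have "u * v' = u' * v" by (simp only: to_fract_eq_iff)
  then have "poly (u * v') a = poly (u' * v) a" by simp
  then have "(x * poly v a) * poly v' a = (y * poly v' a) * poly v a" unfolding 1(3) 2(3) by simp
  then show ?thesis using 1(2) 2(2) by simp
qed

lemma has_value_imp_regular:
  assumes "has_value R a x"
  shows "regular_at R a"
proof -
  define u0 v0 where "u0 = fst (quot_of_fract R)" and "v0 = snd (quot_of_fract R)"
  obtain u v where 1: "R * to_fract v = to_fract u" "poly v a \<noteq> 0"
    using assms by (auto simp: has_value_def)
  have R: "R * to_fract v0 = to_fract u0" unfolding u0_def v0_def by (rule ratfun_quot)
  have "to_fract (u * v0) = to_fract (u0 * v)"
    by (simp only: to_fract_mult flip: 1(1) R) (simp only: mult_ac)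
  then have e: "u * v0 = u0 * v" by (simp only: to_fract_eq_iff)
  have "poly v0 a \<noteq> 0"
  proof
    assume v0: "poly v0 a = 0"
    then have "poly (u0 * v) a = 0" by (simp flip: e)
    then have "poly u0 a = 0" using 1(2) by simp
    then have "[:-a, 1:] dvd u0" "[:-a, 1:] dvd v0" using v0 by (simp_all add: poly_eq_0_iff_dvd)
    moreover have "coprime u0 v0" unfolding u0_def v0_def by (rule coprime_quot_of_fract)
    ultimately have "[:-a, 1:] dvd 1" by (metis coprime_common_divisor)
    then show False by (auto simp: is_unit_poly_iff)
  qed
  then show ?thesis by (simp add: regular_at_def v0_def)
qed

lemma has_value_iff: "has_value R a x \<longleftrightarrow> regular_at R a \<and> x = ratfun_eval R a"
  using has_value_imp_regular has_value_regular has_value_unique by blast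

lemma has_value_to_fract: "has_value (to_fract p) a (poly p a)"
  unfolding has_value_def by (intro exI[of _ p] exI[of _ 1]) simp

lemma has_value_rconst: "has_value (rconst c) a c"
  using has_value_to_fract[of "[:c:]" a] by (simp add: rconst_def)

lemma has_value_0: "has_value 0 a 0"
  using has_value_to_fract[of 0 a] by simp

lemma has_value_Z: "has_value Z a a"
  using has_value_to_fract[of "[:0, 1:]" a] by (simp add: Z_def)

lemma has_value_add:
  assumes "has_value R a x" "has_value S a y"
  shows "has_value (R + S) a (x + y)"
proof -
  obtain u v where 1: "R * to_fract v = to_fract u" "poly v a \<noteq> 0" "x * poly v a = poly u a"
    using assms(1) by (auto simp: has_value_def)
  obtain u' v' where 2: "S * to_fract v' = to_fract u'" "poly v' a \<noteq> 0" "y * poly v' a = poly u' a"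
    using assms(2) by (auto simp: has_value_def)
  have "(R + S) * to_fract (v * v') = (R * to_fract v) * to_fract v' + (S * to_fract v') * to_fract v"
    by (simp add: algebra_simps)
  also have "\<dots> = to_fract (u * v' + u' * v)" unfolding 1(1) 2(1) by simp
  finally show ?thesis unfolding has_value_def using 1 2
    by (intro exI[of _ "u * v' + u' * v"] exI[of _ "v * v'"]) (simp add: algebra_simps flip: 1(3) 2(3))
qed

lemma has_value_mult:
  assumes "has_value R a x" "has_value S a y"
  shows "has_value (R * S) a (x * y)"
proof -
  obtain u v where 1: "R * to_fract v = to_fract u" "poly v a \<noteq> 0" "x * poly v a = poly u a"
    using assms(1) by (auto simp: has_value_def)
  obtain u' v' where 2: "S * to_fract v' = to_fract u'" "poly v' a \<noteq> 0" "y * poly v' a = poly u' a"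
    using assms(2) by (auto simp: has_value_def)
  have "(R * S) * to_fract (v * v') = (R * to_fract v) * (S * to_fract v')"
    by (simp add: algebra_simps)
  also have "\<dots> = to_fract (u * u')" unfolding 1(1) 2(1) by simp
  finally show ?thesis unfolding has_value_def using 1 2
    by (intro exI[of _ "u * u'"] exI[of _ "v * v'"]) (simp add: algebra_simps flip: 1(3) 2(3))
qed

lemma has_value_uminus:
  assumes "has_value R a x"
  shows "has_value (- R) a (- x)"
proof -
  have "[:- 1:] = - (1 :: complex poly)" by (simp add: one_pCons)
  then have "to_fract [:- 1:] * R = - R" by (simp only: to_fract_uminus to_fract_1) simp
  then show ?thesis
    using has_value_mult[OF has_value_to_fract[of "[:- 1:]" a] assms] by simp
qed

lemma has_value_diff: "has_value R a x \<Longrightarrow> has_value S a y \<Longrightarrow> has_value (R - S) a (x - y)"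
  using has_value_add[OF _ has_value_uminus] by fastforce

lemma has_value_inverse:
  assumes "has_value R a x" "x \<noteq> 0"
  shows "has_value (inverse R) a (inverse x)"
proof -
  obtain u v where 1: "R * to_fract v = to_fract u" "poly v a \<noteq> 0" "x * poly v a = poly u a"
    using assms(1) by (auto simp: has_value_def)
  have ua: "poly u a \<noteq> 0" using 1(2) assms(2) by (simp flip: 1(3))
  then have "R \<noteq> 0" using 1(1) by auto
  then have "inverse R * to_fract u = to_fract v" unfolding 1(1)[symmetric] by simp
  then show ?thesis unfolding has_value_def using ua 1(2) assms(2)
    by (intro exI[of _ v] exI[of _ u]) (simp add: 1(3)[symmetric])
qed

lemma has_value_divide:
  "has_value R a x \<Longrightarrow> has_value S a y \<Longrightarrow> y \<noteq> 0 \<Longrightarrow> has_value (R / S) a (x / y)"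
  unfolding divide_inverse by (intro has_value_mult has_value_inverse)

lemma has_value_sum:
  "(\<And>i. i \<in> I \<Longrightarrow> has_value (R i) a (x i)) \<Longrightarrow> has_value (sum R I) a (sum x I)"
  by (induction I rule: infinite_finite_induct) (auto intro: has_value_0 has_value_add)

lemma has_value_power: "has_value R a x \<Longrightarrow> has_value (R ^ n) a (x ^ n)"
  by (induction n) (use has_value_rconst[of 1 a] in \<open>auto intro: has_value_mult simp: rconst_def one_pCons[symmetric]\<close>)

lemma has_value_powi: "has_value R a x \<Longrightarrow> x \<noteq> 0 \<Longrightarrow> has_value (R powi m) a (x powi m)"
  by (auto simp: power_int_def intro!: has_value_power has_value_inverse simp flip: power_inverse)

lemma finite_not_regular: "finite {a. \<not> regular_at R a}"
  unfolding regular_at_def using poly_roots_finite[of "snd (quot_of_fract R)"] by simp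

text \<open>
  The numerator of the difference has infinitely many roots. This is how relations over single good
  points become identities between rational functions.
\<close>

lemma ratfun_eqI:
  assumes "infinite A" "\<And>a. a \<in> A \<Longrightarrow> \<exists>x. has_value R a x \<and> has_value S a x"
  shows "R = S"
proof -
  define u where "u = fst (quot_of_fract (R - S))"
  have "poly u a = 0" if a: "a \<in> A" for a
  proof -
    obtain x where "has_value R a x" "has_value S a x" using assms(2)[OF a] by blast
    then have "has_value (R - S) a 0" using has_value_diff by fastforce
    then have "ratfun_eval (R - S) a = 0" "regular_at (R - S) a" by (auto simp: has_value_iff)
    then show ?thesis by (simp add: u_def ratfun_eval_def regular_at_def)
  qed
  then have "A \<subseteq> {a. poly u a = 0}" by blast
  then have "u = 0" using assms(1) poly_roots_finite finite_subset by blast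
  then show ?thesis by (simp add: u_def)
qed

lemma rconst_simps [simp]: "rconst 0 = 0" "rconst 1 = 1" "rconst x = 0 \<longleftrightarrow> x = 0"
  "rconst (x * y) = rconst x * rconst y"
  by (simp_all add: rconst_def one_pCons[symmetric] flip: to_fract_mult)

lemma Z_nonzero [simp]: "Z \<noteq> 0" by (simp add: Z_def)

lemma to_fract_power: "to_fract (p ^ n) = to_fract p ^ n"
  by (induction n) auto

lemma to_fract_monom: "to_fract (monom a n) = rconst a * Z ^ n"
proof -
  have "monom a n = [:a:] * [:0, 1:] ^ n" by (simp add: monom_altdef)
  then show ?thesis by (simp only: rconst_def Z_def to_fract_mult to_fract_power)
qed

lemma has_value_poly_map:
  assumes "has_value g a y"
  shows "has_value (poly (map_poly rconst u) g) a (poly u y)"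
proof (induction u)
  case (pCons c u)
  have "map_poly rconst (pCons c u) = pCons (rconst c) (map_poly rconst u)"
    using pCons(1) by (simp add: map_poly_pCons)
  then show ?case using pCons assms by (auto intro!: has_value_add has_value_mult has_value_rconst)
qed (simp add: has_value_0)

lemma has_value_compose:
  assumes "has_value g a y" "regular_at R y"
  shows "has_value (ratfun_compose R g) a (ratfun_eval R y)"
  unfolding ratfun_compose_def ratfun_eval_def
  using assms by (intro has_value_divide has_value_poly_map) (auto simp: regular_at_def)

lemma ratfun_compose_0 [simp]: "ratfun_compose 0 g = 0"
  by (simp add: ratfun_compose_def)

definition has_values :: "ratfun poly \<Rightarrow> complex \<Rightarrow> complex poly \<Rightarrow> bool" where
  "has_values S a s \<longleftrightarrow> (\<forall>j. has_value (coeff S j) a (coeff s j))"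

lemma has_values_unique: "has_values S a s \<Longrightarrow> has_values S a t \<Longrightarrow> s = t"
  by (intro poly_eqI) (auto simp: has_values_def intro: has_value_unique)

lemma has_values_add: "has_values S a s \<Longrightarrow> has_values T a t \<Longrightarrow> has_values (S + T) a (s + t)"
  by (auto simp: has_values_def intro: has_value_add)

lemma has_values_mult: "has_values S a s \<Longrightarrow> has_values T a t \<Longrightarrow> has_values (S * T) a (s * t)"
  by (auto simp: has_values_def coeff_mult intro!: has_value_sum has_value_mult)

lemma has_values_pCons: "has_value R a x \<Longrightarrow> has_values S a s \<Longrightarrow> has_values (pCons R S) a (pCons x s)"
  by (auto simp: has_values_def coeff_pCons split: nat.split)

lemma has_values_0: "has_values 0 a 0"
  by (simp add: has_values_def has_value_0)

lemma has_values_pcompose: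
  "has_values S a s \<Longrightarrow> has_values T a t \<Longrightarrow> has_values (pcompose S T) a (pcompose s t)"
proof (induction S arbitrary: s)
  case 0
  then have "s = 0" by (metis has_values_0 has_values_unique)
  then show ?case by (simp add: has_values_0)
next
  case (pCons c S)
  obtain x s' where s: "s = pCons x s'" by (cases s)
  have "has_value c a x" using pCons.prems(1) unfolding has_values_def s by (metis coeff_pCons_0)
  moreover have "has_values S a s'"
    unfolding has_values_def
  proof
    fix j show "has_value (coeff S j) a (coeff s' j)"
      using pCons.prems(1) unfolding has_values_def s by (metis coeff_pCons_Suc)
  qed
  ultimately show ?case unfolding s pcompose_pCons
    by (intro has_values_add has_values_mult has_values_pCons has_values_0 pCons)
qed

lemma has_values_regular:
  assumes "\<And>j. regular_at (coeff S j) a"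
  shows "has_values S a (map_poly (\<lambda>b. ratfun_eval b a) S)"
proof -
  have "ratfun_eval 0 a = 0" by (simp add: ratfun_eval_def)
  then show ?thesis using assms by (simp add: has_values_def coeff_map_poly has_value_regular)
qed

lemma finite_not_regular_coeff: "finite {a. \<exists>j. \<not> regular_at (coeff S j) a}"
proof -
  have "regular_at 0 a" for a by (simp add: regular_at_def)
  then have "{a. \<exists>j. \<not> regular_at (coeff S j) a} \<subseteq> (\<Union>j\<le>degree S. {a. \<not> regular_at (coeff S j) a})"
    by (auto, metis atMost_iff coeff_eq_0 linorder_not_le)
  then show ?thesis by (rule finite_subset) (simp add: finite_not_regular)
qed

section \<open>Monomials in one variable\<close>

lemma ratfun_compose_monomial:
  "ratfun_compose (rconst C * Z powi m) g = rconst C * g powi m"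
proof (cases "m \<ge> 0 \<or> C = 0")
  case True
  define n where "n = nat m"
  show ?thesis
  proof (cases "C = 0")
    case False
    then have "Z powi m = Z ^ n" "g powi m = g ^ n" using True by (simp_all add: power_int_def n_def)
    then have "rconst C * Z powi m = to_fract (monom C n)" by (simp add: to_fract_monom)
    then show ?thesis using \<open>g powi m = g ^ n\<close>
      by (simp add: ratfun_compose_def map_poly_monom poly_monom)
  qed simp
next
  case False
  define n where "n = nat (- m)"
  have "Z powi m = inverse (Z ^ n)" and g: "g powi m = inverse (g ^ n)"
    using False by (simp_all add: power_int_def n_def power_inverse)
  then have R: "rconst C * Z powi m = to_fract [:C:] / to_fract (monom 1 n)"
    unfolding to_fract_monom by (simp add: rconst_def divide_inverse flip: one_pCons)
  have "quot_of_fract (quot_to_fract ([:C:], monom 1 n)) = ([:C:], monom 1 n)"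
  proof (rule quot_of_fract_quot_to_fract')
    have "is_unit [:C:]" using False by (simp add: is_unit_triv)
    then have "coprime [:C:] (monom 1 n)" by (rule is_unit_left_imp_coprime)
    moreover have "unit_factor (monom 1 n :: complex poly) = 1"
      by (simp add: unit_factor_poly_def degree_monom_eq one_pCons)
    ultimately show "([:C:], monom 1 n) \<in> normalized_fracts" by (simp add: normalized_fracts_def)
  qed
  moreover have "quot_to_fract ([:C:], monom 1 n) = rconst C * Z powi m"
    by (simp add: quot_to_fract_def R Fract_conv_to_fract)
  ultimately show ?thesis
    by (simp add: ratfun_compose_def g map_poly_monom poly_monom map_poly_pCons divide_inverse)
qed

text \<open>
  A nonzero root would produce \<open>deg u + 1\<close> distinct roots on its orbit under the rotation.
\<close>

lemma rotation_invariant_roots: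
  fixes u :: "complex poly"
  assumes u: "u \<noteq> 0" and c: "c \<noteq> 0" "\<And>k. 1 \<le> k \<Longrightarrow> k \<le> degree u \<Longrightarrow> c ^ k \<noteq> 1"
    and inv: "\<And>x. poly u x = 0 \<Longrightarrow> poly u (c * x) = 0"
  shows "u = monom (lead_coeff u) (degree u)"
proof -
  have zero: "x = 0" if x: "poly u x = 0" for x
  proof (rule ccontr)
    assume x0: "x \<noteq> 0"
    have root: "poly u (c ^ k * x) = 0" for k
      by (induction k) (use x inv in \<open>auto simp: mult.assoc\<close>)
    have "inj_on (\<lambda>k. c ^ k * x) {..degree u}"
    proof (rule linorder_inj_onI)
      fix i j assume ij: "i < j" "i \<in> {..degree u}" "j \<in> {..degree u}"
      show "c ^ i * x \<noteq> c ^ j * x"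
      proof
        assume "c ^ i * x = c ^ j * x"
        then have "c ^ i = c ^ (i + (j - i))" using x0 ij by simp
        then have "c ^ i * 1 = c ^ i * c ^ (j - i)" by (simp only: power_add mult_1_right)
        then have "c ^ (j - i) = 1" using c(1) by (metis mult_cancel_left power_eq_0_iff)
        moreover have "1 \<le> j - i" "j - i \<le> degree u" using ij by auto
        ultimately show False using c(2)[of "j - i"] by blast
      qed
    qed auto
    then have "card ((\<lambda>k. c ^ k * x) ` {..degree u}) = Suc (degree u)" by (simp add: card_image)
    moreover have "(\<lambda>k. c ^ k * x) ` {..degree u} \<subseteq> {x. poly u x = 0}" using root by auto
    then have "card ((\<lambda>k. c ^ k * x) ` {..degree u}) \<le> card {x. poly u x = 0}"
      using poly_roots_finite[OF u] by (intro card_mono)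
    ultimately show False using card_poly_roots_bound[OF u] by simp
  qed
  obtain \<zeta> where z: "u = smult (lead_coeff u) (\<Prod>i<degree u. [:- \<zeta> i, 1:])"
    using root_enumeration[OF u] by metis
  have "\<zeta> i = 0" if "i < degree u" for i
  proof (rule zero)
    show "poly u (\<zeta> i) = 0" by (subst z) (use that in \<open>auto simp: poly_prod\<close>)
  qed
  then have "(\<Prod>i<degree u. [:- \<zeta> i, 1:]) = (\<Prod>i<degree u. [:0, 1:])" by (intro prod.cong) auto
  then have "(\<Prod>i<degree u. [:- \<zeta> i, 1:]) = [:0, 1:] ^ degree u" by simp
  then show ?thesis using z by (metis monom_altdef)
qed

text \<open>
  In lowest terms, semi-invariance makes the roots of the numerator and those of the
  denominator separately invariant under the rotation.
\<close>

lemma rotation_semiinvariant_monomial: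
  fixes R :: ratfun
  assumes c: "c \<noteq> 0" "\<And>k. 1 \<le> k \<Longrightarrow> k \<le> N \<Longrightarrow> c ^ k \<noteq> 1"
    and N: "degree (fst (quot_of_fract R)) \<le> N" "degree (snd (quot_of_fract R)) \<le> N"
    and A: "infinite A"
    and ev: "\<And>x. x \<in> A \<Longrightarrow> regular_at R x \<and> regular_at R (c * x) \<and> ratfun_eval R (c * x) = \<kappa> * ratfun_eval R x"
  obtains C m where "R = rconst C * Z powi m"
proof (cases "R = 0")
  case True
  then show thesis using that[of 0 0] by simp
next
  case False
  define u v where "u = fst (quot_of_fract R)" and "v = snd (quot_of_fract R)"
  have nz: "u \<noteq> 0" "v \<noteq> 0" using False by (simp_all add: u_def v_def)
  have cop: "coprime u v" unfolding u_def v_def by (rule coprime_quot_of_fract)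
  have nocommon: "\<not> (poly u x = 0 \<and> poly v x = 0)" for x
  proof
    assume "poly u x = 0 \<and> poly v x = 0"
    then have "[:-x, 1:] dvd u" "[:-x, 1:] dvd v" by (simp_all add: poly_eq_0_iff_dvd)
    then have "[:-x, 1:] dvd 1" using cop by (metis coprime_common_divisor)
    then show False by (auto simp: is_unit_poly_iff)
  qed
  define D where "D = pcompose u [:0, c:] * v - smult \<kappa> (u * pcompose v [:0, c:])"
  have "poly D x = 0" if "x \<in> A" for x
    using ev[OF that] by (auto simp: D_def poly_pcompose ratfun_eval_def regular_at_def u_def v_def field_simps)
  then have "A \<subseteq> {x. poly D x = 0}" by blast
  then have "D = 0" using A poly_roots_finite finite_subset by blast
  then have eq: "poly u (c * x) * poly v x = \<kappa> * (poly u x * poly v (c * x))" for x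
  proof -
    have "poly D x = 0" using \<open>D = 0\<close> by simp
    then show ?thesis by (simp add: D_def poly_pcompose mult.commute)
  qed
  have k: "\<kappa> \<noteq> 0"
  proof
    assume "\<kappa> = 0"
    then have "pcompose u [:0, c:] * v = 0" using \<open>D = 0\<close> by (simp add: D_def)
    then have "pcompose u [:0, c:] = 0" using nz by simp
    then show False using nz(1) c(1) by (subst (asm) pcompose_eq_0_iff) auto
  qed
  have u: "u = monom (lead_coeff u) (degree u)"
  proof (rule rotation_invariant_roots[OF nz(1) c(1)])
    show "poly u (c * x) = 0" if "poly u x = 0" for x
      using eq[of x] that nocommon[of x] by simp
  qed (use c(2) N in \<open>auto simp: u_def\<close>)
  have v: "v = monom (lead_coeff v) (degree v)"
  proof (rule rotation_invariant_roots[OF nz(2) c(1)])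
    show "poly v (c * x) = 0" if "poly v x = 0" for x
      using eq[of x] that nocommon[of x] k by simp
  qed (use c(2) N in \<open>auto simp: v_def\<close>)
  have "R * to_fract v = to_fract u" unfolding u_def v_def by (rule ratfun_quot)
  then have "R = to_fract u / to_fract v" using nz by (simp add: nonzero_eq_divide_eq)
  also have "\<dots> = (rconst (lead_coeff u) * Z ^ degree u) / (rconst (lead_coeff v) * Z ^ degree v)"
    by (subst (1) u, subst (1) v) (simp only: to_fract_monom)
  also have "\<dots> = rconst (lead_coeff u / lead_coeff v) * (Z ^ degree u / Z ^ degree v)"
  proof -
    have "rconst (lead_coeff u) = rconst (lead_coeff u / lead_coeff v) * rconst (lead_coeff v)"
      using nz(2) by (simp flip: rconst_simps(4))
    then show ?thesis using nz(2) by simp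
  qed
  also have "Z ^ degree u / Z ^ degree v = Z powi (int (degree u) - int (degree v))"
    by (simp add: power_int_diff)
  finally show thesis by (rule that)
qed

section \<open>Coefficients that are semi-invariant under rotations\<close>

lemma powi_eq_one_imp_zero:
  fixes c :: complex and e :: int
  assumes "c \<noteq> 0" "\<And>k. 1 \<le> k \<Longrightarrow> k \<le> N \<Longrightarrow> c ^ k \<noteq> 1" "nat \<bar>e\<bar> \<le> N" "c powi e = 1"
  shows "e = 0"
proof (rule ccontr)
  assume e: "e \<noteq> 0"
  have "c ^ nat \<bar>e\<bar> = 1"
  proof (cases "e \<ge> 0")
    case True then show ?thesis using assms(4) by (simp add: power_int_def)
  next
    case False
    then have "inverse c ^ nat (- e) = 1" using assms(4) by (simp add: power_int_def)
    then have "inverse (c ^ nat (- e)) = 1" by (simp only: power_inverse)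
    then show ?thesis using False by simp
  qed
  then show False using assms(2)[of "nat \<bar>e\<bar>"] assms(3) e by simp
qed

lemma is_polynomial_mapI:
  assumes "fst F = to_fract u" "\<And>j. \<exists>v. coeff (snd F) j = to_fract v"
  shows "is_polynomial_map F"
proof -
  define q where "q = map_poly (\<lambda>b. fst (quot_of_fract b)) (snd F)"
  have "snd F = map_poly to_fract q"
  proof (rule poly_eqI)
    fix j
    obtain v where v: "coeff (snd F) j = to_fract v" using assms(2) by blast
    then show "coeff (snd F) j = coeff (map_poly to_fract q) j" by (simp add: q_def coeff_map_poly)
  qed
  then have "F = rat_skew_of u q" using assms(1) by (simp add: rat_skew_of_def prod_eq_iff)
  then show ?thesis unfolding is_polynomial_map_def by blast
qed

lemma has_value_monomial: "x \<noteq> 0 \<Longrightarrow> has_value (rconst C * Z powi m) x (C * x powi m)"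
  by (intro has_value_mult has_value_rconst has_value_powi has_value_Z)

text \<open>
  The relation between the coefficients \<open>S\<^sub>j\<close> over \<open>x\<close> and \<open>c x\<close>, and again over their images under
  \<open>x \<mapsto> x\<^sup>\<delta>\<close>, with the same \<open>\<alpha>\<close> in both relations. The polynomial \<open>B\<close> stands for the coefficient \<open>S\<^sub>d\<close>.
\<close>

definition rotation_pair ::
    "ratfun poly \<Rightarrow> complex poly \<Rightarrow> nat \<Rightarrow> complex \<Rightarrow> complex \<Rightarrow> complex \<Rightarrow> bool" where
  "rotation_pair S B \<delta> c c3 x \<longleftrightarrow> x \<noteq> 0 \<and>
     (\<forall>y\<in>{x, c * x, x ^ \<delta>, (c * x) ^ \<delta>}. poly B y \<noteq> 0 \<and> (\<forall>j. regular_at (coeff S j) y)) \<and>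
     (\<exists>\<alpha> \<alpha>'. \<forall>j. ratfun_eval (coeff S j) (c * x) * c3 ^ j = \<alpha> * ratfun_eval (coeff S j) x \<and>
        ratfun_eval (coeff S j) ((c * x) ^ \<delta>) * \<alpha> ^ j = \<alpha>' * ratfun_eval (coeff S j) (x ^ \<delta>))"

text \<open>
  The order of the rotations must be unbounded: the exponents that they have to separate are known only
  after a first rotation has shown that the coefficients are monomials.
\<close>

locale rotation_family =
  fixes S :: "ratfun poly" and B :: "complex poly" and \<delta> d l :: nat
  assumes d: "d \<ge> 2" and S: "degree S = d" "coeff S d = to_fract B"
    and B: "lead_coeff B = 1" "degree B = l"
    and nonmonomial: "S \<noteq> monom (coeff S d) d"
    and family: "\<And>N. \<exists>c c3 A. c \<noteq> 0 \<and> c3 \<noteq> 0 \<and> (\<forall>k. 1 \<le> k \<longrightarrow> k \<le> N \<longrightarrow> c ^ k \<noteq> 1) \<and> infinite A \<and>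
      (\<forall>x\<in>A. rotation_pair S B \<delta> c c3 x)"
begin

definition \<rho> :: "nat \<Rightarrow> ratfun" where "\<rho> j = coeff S j / coeff S d"

lemma B0: "B \<noteq> 0" using B(1) by auto

lemma Sd: "coeff S d \<noteq> 0" using B0 S by simp

lemma S_\<rho>: "coeff S j = \<rho> j * to_fract B"
  using Sd S(2) by (simp add: \<rho>_def)

lemma eval_d: "ratfun_eval (coeff S d) x = poly B x"
  using has_value_to_fract[of B x] by (simp add: has_value_iff S(2))

lemma value_\<rho>:
  assumes "regular_at (coeff S j) x" "poly B x \<noteq> 0"
  shows "has_value (\<rho> j) x (ratfun_eval (coeff S j) x / poly B x)"
  unfolding \<rho>_def S(2) using assms by (intro has_value_divide has_value_regular has_value_to_fract)

text \<open>
  The coefficient relations for \<open>j = d\<close> give \<open>\<alpha> = c3\<^sup>d B(c x) / B(x)\<close> and the analogous value of \<open>\<alpha>'\<close>; this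
  eliminates both from the relations for the quotients \<open>\<rho>\<^sub>j = S\<^sub>j / S\<^sub>d\<close>.
\<close>

lemma rotations:
  obtains c c3 A where "c \<noteq> 0" "c3 \<noteq> 0" "\<And>k. 1 \<le> k \<Longrightarrow> k \<le> N \<Longrightarrow> c ^ k \<noteq> 1" "infinite A"
    "\<And>x. x \<in> A \<Longrightarrow> x \<noteq> 0"
    "\<And>x y j. x \<in> A \<Longrightarrow> y \<in> {x, c * x, x ^ \<delta>, (c * x) ^ \<delta>} \<Longrightarrow> has_value (\<rho> j) y (ratfun_eval (\<rho> j) y)"
    "\<And>x j. x \<in> A \<Longrightarrow> j \<le> d \<Longrightarrow> ratfun_eval (\<rho> j) (c * x) = c3 ^ (d - j) * ratfun_eval (\<rho> j) x"
    "\<And>x j. x \<in> A \<Longrightarrow> j \<le> d \<Longrightarrow> ratfun_eval (\<rho> j) ((c * x) ^ \<delta>) * poly B x ^ (d - j)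
        = (c3 ^ d * poly B (c * x)) ^ (d - j) * ratfun_eval (\<rho> j) (x ^ \<delta>)"
    "\<And>x. x \<in> A \<Longrightarrow> poly B x \<noteq> 0"
proof -
  obtain c c3 A where c: "c \<noteq> 0" "c3 \<noteq> 0" "\<And>k. 1 \<le> k \<Longrightarrow> k \<le> N \<Longrightarrow> c ^ k \<noteq> 1" "infinite A"
    and A': "\<forall>x\<in>A. rotation_pair S B \<delta> c c3 x"
    using family[of N] by blast
  note A = A'[unfolded rotation_pair_def]
  have val: "has_value (\<rho> j) y (ratfun_eval (coeff S j) y / poly B y)" "poly B y \<noteq> 0"
    if "x \<in> A" "y \<in> {x, c * x, x ^ \<delta>, (c * x) ^ \<delta>}" for x y j
    using A that by (blast intro: value_\<rho>)+
  then have ev: "ratfun_eval (\<rho> j) y = ratfun_eval (coeff S j) y / poly B y"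
    if "x \<in> A" "y \<in> {x, c * x, x ^ \<delta>, (c * x) ^ \<delta>}" for x y j
    using that by (metis has_value_iff)
  show thesis
  proof (rule that[OF c])
    show "x \<noteq> 0" if "x \<in> A" for x using A that by blast
    show "poly B x \<noteq> 0" if "x \<in> A" for x using A that by blast
    show "has_value (\<rho> j) y (ratfun_eval (\<rho> j) y)" if "x \<in> A" "y \<in> {x, c * x, x ^ \<delta>, (c * x) ^ \<delta>}" for x y j
      using val(1)[OF that] ev[OF that] by simp
  next
    fix x j assume x: "x \<in> A" and j: "j \<le> d"
    obtain \<alpha> \<alpha>' where \<alpha>: "\<And>j. ratfun_eval (coeff S j) (c * x) * c3 ^ j = \<alpha> * ratfun_eval (coeff S j) x"
      "\<And>j. ratfun_eval (coeff S j) ((c * x) ^ \<delta>) * \<alpha> ^ j = \<alpha>' * ratfun_eval (coeff S j) (x ^ \<delta>)"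
      using A x by blast
    have nz: "poly B x \<noteq> 0" "poly B (c * x) \<noteq> 0" "poly B (x ^ \<delta>) \<noteq> 0" "poly B ((c * x) ^ \<delta>) \<noteq> 0"
      using A x by blast+
    have 1: "poly B (c * x) * c3 ^ d = \<alpha> * poly B x" using \<alpha>(1)[of d] by (simp add: eval_d)
    then have \<alpha>0: "\<alpha> \<noteq> 0" using nz c(2) by auto
    have 2: "poly B ((c * x) ^ \<delta>) * \<alpha> ^ d = \<alpha>' * poly B (x ^ \<delta>)" using \<alpha>(2)[of d] by (simp add: eval_d)
    have split: "t ^ d = t ^ (d - j) * t ^ j" for t :: complex
      using j by (simp flip: power_add)
    have "ratfun_eval (coeff S j) (c * x) / poly B (c * x) = c3 ^ (d - j) * (ratfun_eval (coeff S j) x / poly B x)"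
    proof -
      have "ratfun_eval (coeff S j) (c * x) * poly B x * (c3 ^ j * \<alpha>)
          = (ratfun_eval (coeff S j) (c * x) * c3 ^ j) * (\<alpha> * poly B x)" by (simp only: mult_ac)
      also have "\<dots> = (\<alpha> * ratfun_eval (coeff S j) x) * (poly B (c * x) * c3 ^ d)" by (simp only: \<alpha>(1) 1)
      also have "\<dots> = c3 ^ (d - j) * ratfun_eval (coeff S j) x * poly B (c * x) * (c3 ^ j * \<alpha>)"
        by (simp only: split[of c3] mult_ac)
      finally have "ratfun_eval (coeff S j) (c * x) * poly B x = c3 ^ (d - j) * ratfun_eval (coeff S j) x * poly B (c * x)"
        using c(2) \<alpha>0 by simp
      then show ?thesis using nz by (simp add: field_simps)
    qed
    then show "ratfun_eval (\<rho> j) (c * x) = c3 ^ (d - j) * ratfun_eval (\<rho> j) x"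
      by (simp add: ev[OF x])
    have "ratfun_eval (coeff S j) ((c * x) ^ \<delta>) / poly B ((c * x) ^ \<delta>) = \<alpha> ^ (d - j) * (ratfun_eval (coeff S j) (x ^ \<delta>) / poly B (x ^ \<delta>))"
    proof -
      have \<alpha>'0: "\<alpha>' \<noteq> 0" using 2 nz \<alpha>0 by auto
      have "ratfun_eval (coeff S j) ((c * x) ^ \<delta>) * poly B (x ^ \<delta>) * (\<alpha> ^ j * \<alpha>')
          = (ratfun_eval (coeff S j) ((c * x) ^ \<delta>) * \<alpha> ^ j) * (\<alpha>' * poly B (x ^ \<delta>))" by (simp only: mult_ac)
      also have "\<dots> = (\<alpha>' * ratfun_eval (coeff S j) (x ^ \<delta>)) * (poly B ((c * x) ^ \<delta>) * \<alpha> ^ d)" by (simp only: \<alpha>(2) 2)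
      also have "\<dots> = \<alpha> ^ (d - j) * ratfun_eval (coeff S j) (x ^ \<delta>) * poly B ((c * x) ^ \<delta>) * (\<alpha> ^ j * \<alpha>')"
        by (simp only: split[of \<alpha>] mult_ac)
      finally have "ratfun_eval (coeff S j) ((c * x) ^ \<delta>) * poly B (x ^ \<delta>) = \<alpha> ^ (d - j) * ratfun_eval (coeff S j) (x ^ \<delta>) * poly B ((c * x) ^ \<delta>)"
        using \<alpha>0 \<alpha>'0 by simp
      then show ?thesis using nz by (simp add: field_simps)
    qed
    moreover have "\<alpha> ^ (d - j) * poly B x ^ (d - j) = (c3 ^ d * poly B (c * x)) ^ (d - j)"
      using 1 by (simp add: mult.commute flip: power_mult_distrib)
    ultimately show "ratfun_eval (\<rho> j) ((c * x) ^ \<delta>) * poly B x ^ (d - j)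
        = (c3 ^ d * poly B (c * x)) ^ (d - j) * ratfun_eval (\<rho> j) (x ^ \<delta>)"
      by (simp add: ev[OF x] mult.assoc mult.left_commute mult.commute)
  qed
qed

lemma \<rho>_monomial:
  assumes "j \<le> d"
  shows "\<exists>C m. \<rho> j = rconst C * Z powi m"
proof -
  \<comment> \<open>bounds both degrees that \<open>rotation_semiinvariant_monomial\<close> has to separate\<close>
  define N where "N = degree (fst (quot_of_fract (\<rho> j))) + degree (snd (quot_of_fract (\<rho> j)))"
  obtain c c3 A where c: "c \<noteq> 0" "c3 \<noteq> 0" "\<And>k. 1 \<le> k \<Longrightarrow> k \<le> N \<Longrightarrow> c ^ k \<noteq> 1" "infinite A"
    "\<And>x y j. x \<in> A \<Longrightarrow> y \<in> {x, c * x, x ^ \<delta>, (c * x) ^ \<delta>} \<Longrightarrow> has_value (\<rho> j) y (ratfun_eval (\<rho> j) y)"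
    "\<And>x j. x \<in> A \<Longrightarrow> j \<le> d \<Longrightarrow> ratfun_eval (\<rho> j) (c * x) = c3 ^ (d - j) * ratfun_eval (\<rho> j) x"
    by (rule rotations[of N]) blast
  show ?thesis
  proof (rule rotation_semiinvariant_monomial[OF c(1,3) _ _ c(4), where R = "\<rho> j" and \<kappa> = "c3 ^ (d - j)"])
    show "regular_at (\<rho> j) x \<and> regular_at (\<rho> j) (c * x) \<and> ratfun_eval (\<rho> j) (c * x) = c3 ^ (d - j) * ratfun_eval (\<rho> j) x"
      if "x \<in> A" for x
      using c(5)[OF that, of x j] c(5)[OF that, of "c * x" j] c(6)[OF that assms] by (simp add: has_value_iff)
  next
    fix C m assume "\<rho> j = rconst C * Z powi m"
    then show ?thesis by blast
  qed (auto simp: N_def)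
qed

definition C :: "nat \<Rightarrow> complex" where "C j = (SOME C. \<exists>m. \<rho> j = rconst C * Z powi m)"
definition \<mu> :: "nat \<Rightarrow> int" where "\<mu> j = (SOME m. \<rho> j = rconst (C j) * Z powi m)"

lemma \<rho>_eq: "j \<le> d \<Longrightarrow> \<rho> j = rconst (C j) * Z powi (\<mu> j)"
  unfolding \<mu>_def C_def using someI_ex[OF \<rho>_monomial] by (metis (mono_tags, lifting) someI_ex)

lemma eval_\<rho>: "j \<le> d \<Longrightarrow> y \<noteq> 0 \<Longrightarrow> ratfun_eval (\<rho> j) y = C j * y powi (\<mu> j)"
  using has_value_monomial[of y "C j" "\<mu> j"] by (simp add: \<rho>_eq has_value_iff)

lemma nonzero_coefficient: "\<exists>j<d. C j \<noteq> 0"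
proof (rule ccontr)
  assume "\<not> (\<exists>j<d. C j \<noteq> 0)"
  then have z: "coeff S j = 0" if "j < d" for j
    using that \<rho>_eq[of j] by (simp add: S_\<rho>)
  have "S = monom (coeff S d) d"
  proof (rule poly_eqI)
    fix j show "coeff S j = coeff (monom (coeff S d) d) j"
      using z[of j] S(1) coeff_eq_0[of S j] by (cases j d rule: linorder_cases) auto
  qed
  then show False using nonmonomial by blast
qed

lemma C_powers:
  assumes j: "j < d" "C j \<noteq> 0" and c: "c \<noteq> 0" and x: "x \<noteq> 0"
    and 1: "ratfun_eval (\<rho> j) (c * x) = c3 ^ (d - j) * ratfun_eval (\<rho> j) x"
  shows "c powi \<mu> j = c3 ^ (d - j)"
  using 1 eval_\<rho>[of j x] eval_\<rho>[of j "c * x"] j c x by (simp add: power_int_mult_distrib)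

text \<open>
  For a nonzero \<open>\<rho>\<^sub>j\<close>, which is a monomial, the relation over \<open>x\<^sup>\<delta>\<close> says that \<open>(c3\<^sup>d B(c x))\<^bsup>d-j\<^esup>\<close> is a
  constant multiple of \<open>B(x)\<^bsup>d-j\<^esup>\<close>. Hence the roots of \<open>B\<close> are invariant under \<open>c\<close>.
\<close>

lemma B_eq: "B = monom 1 l"
proof -
  obtain j where j: "j < d" "C j \<noteq> 0" using nonzero_coefficient by blast
  obtain c c3 A where c: "c \<noteq> 0" "c3 \<noteq> 0" "\<And>k. 1 \<le> k \<Longrightarrow> k \<le> l \<Longrightarrow> c ^ k \<noteq> 1" "infinite A"
    "\<And>x. x \<in> A \<Longrightarrow> x \<noteq> 0"
    "\<And>x j. x \<in> A \<Longrightarrow> j \<le> d \<Longrightarrow> ratfun_eval (\<rho> j) ((c * x) ^ \<delta>) * poly B x ^ (d - j)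
        = (c3 ^ d * poly B (c * x)) ^ (d - j) * ratfun_eval (\<rho> j) (x ^ \<delta>)"
    by (rule rotations[of l]) blast
  define D where "D = smult ((c ^ \<delta>) powi \<mu> j) (B ^ (d - j)) - smult (c3 ^ d) (pcompose B [:0, c:]) ^ (d - j)"
  have "poly D x = 0" if x: "x \<in> A" for x
  proof -
    have x0: "x \<noteq> 0" using c(5)[OF x] .
    have "(C j * ((c * x) ^ \<delta>) powi \<mu> j) * poly B x ^ (d - j) = (c3 ^ d * poly B (c * x)) ^ (d - j) * (C j * (x ^ \<delta>) powi \<mu> j)"
      using c(6)[OF x, of j] j c(1) x0 by (simp add: eval_\<rho>)
    then have "(x ^ \<delta>) powi \<mu> j * ((c ^ \<delta>) powi \<mu> j * poly B x ^ (d - j)) = (x ^ \<delta>) powi \<mu> j * (c3 ^ d * poly B (c * x)) ^ (d - j)"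
      using j(2) by (simp add: power_mult_distrib power_int_mult_distrib mult_ac)
    then have "(c ^ \<delta>) powi \<mu> j * poly B x ^ (d - j) = (c3 ^ d * poly B (c * x)) ^ (d - j)"
      using x0 by simp
    then show ?thesis by (simp add: D_def poly_pcompose mult.commute)
  qed
  then have "A \<subseteq> {x. poly D x = 0}" by blast
  then have "D = 0" using c(4) poly_roots_finite finite_subset by blast
  then have D0: "poly D x = 0" for x by simp
  have "B = monom (lead_coeff B) (degree B)"
  proof (rule rotation_invariant_roots[OF B0 c(1)])
    show "poly B (c * x) = 0" if "poly B x = 0" for x
    proof -
      have z: "(0::complex) ^ (d - j) = 0" using j(1) by (intro zero_power) simp
      have "(c3 ^ d * poly B (c * x)) ^ (d - j) = 0"
        using D0[of x] c(2) unfolding D_def by (simp add: poly_pcompose that z mult.commute)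
      then show ?thesis using c(2) by simp
    qed
  qed (use c(3) B in auto)
  then show ?thesis using B by simp
qed

lemma S_coeff: "j \<le> d \<Longrightarrow> coeff S j = rconst (C j) * Z powi (\<mu> j + int l)"
  using \<rho>_eq[of j] by (simp add: S_\<rho> B_eq to_fract_monom power_int_add)

lemma C_d: "C d = 1" "\<mu> d = 0"
proof -
  have "\<rho> d = 1" using Sd by (simp add: \<rho>_def)
  then have e: "C d * x powi \<mu> d = 1" if "x \<noteq> 0" for x
    using eval_\<rho>[of d x] that has_value_rconst[of 1 x] by (simp add: has_value_iff)
  show C: "C d = 1" using e[of 1] by simp
  have "2 powi \<mu> d = (1 :: complex)" using e[of 2] C by simp
  then show "\<mu> d = 0"
  proof (rule powi_eq_one_imp_zero[rotated -1])
    show "(2::complex) ^ k \<noteq> 1" if "1 \<le> k" for k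
    proof
      assume "(2::complex) ^ k = 1"
      then have "cmod (2 ^ k) = 1" by simp
      then have "(2::real) ^ k = 1" by (simp only: norm_power norm_numeral)
      moreover have "1 < (2::real) ^ k" using that by (intro one_less_power) auto
      ultimately show False by simp
    qed
  qed auto
qed

text \<open>
  Over \<open>x\<close> one gets \<open>c\<^sup>\<mu> = c3\<^bsup>d-j\<^esup>\<close> with \<open>\<mu> = \<mu>\<^sub>j\<close>, over \<open>x\<^sup>\<delta>\<close> the same with \<open>c\<^sup>\<delta>\<close> for \<open>c\<close> and
  \<open>\<alpha> = c3\<^sup>d c\<^sup>l\<close> for \<open>c3\<close>. Eliminating \<open>c3\<close> leaves powers of \<open>c\<close>, whose
  exponents agree when the order of \<open>c\<close> is large.
\<close>

lemma exponents:
  assumes "i < d" "j < d" "C i \<noteq> 0" "C j \<noteq> 0"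
  shows "\<mu> j * int (d - i) = \<mu> i * int (d - j)" and "\<mu> j * (int \<delta> - int d) = int l * int (d - j)"
proof -
  \<comment> \<open>the differences of exponents that a rotation of order larger than \<open>\<bar>e1\<bar> + \<bar>e2\<bar>\<close> shows to be 0\<close>
  define e1 e2 where "e1 = \<mu> j * int (d - i) - \<mu> i * int (d - j)"
    and "e2 = \<mu> j * int \<delta> - (\<mu> j * int d + int l * int (d - j))"
  obtain c c3 A where c: "c \<noteq> 0" "c3 \<noteq> 0" "\<And>k. 1 \<le> k \<Longrightarrow> k \<le> nat \<bar>e1\<bar> + nat \<bar>e2\<bar> \<Longrightarrow> c ^ k \<noteq> 1" "infinite A"
    "\<And>x. x \<in> A \<Longrightarrow> x \<noteq> 0"
    "\<And>x j. x \<in> A \<Longrightarrow> j \<le> d \<Longrightarrow> ratfun_eval (\<rho> j) (c * x) = c3 ^ (d - j) * ratfun_eval (\<rho> j) x"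
    "\<And>x j. x \<in> A \<Longrightarrow> j \<le> d \<Longrightarrow> ratfun_eval (\<rho> j) ((c * x) ^ \<delta>) * poly B x ^ (d - j)
        = (c3 ^ d * poly B (c * x)) ^ (d - j) * ratfun_eval (\<rho> j) (x ^ \<delta>)"
    by (rule rotations[of "nat \<bar>e1\<bar> + nat \<bar>e2\<bar>"]) blast
  obtain x where x: "x \<in> A" using c(4) infinite_imp_nonempty by blast
  have x0: "x \<noteq> 0" using c(5)[OF x] .
  have pj: "c powi \<mu> j = c3 ^ (d - j)" and p_i: "c powi \<mu> i = c3 ^ (d - i)"
    using C_powers[OF _ _ c(1) x0 c(6)[OF x]] assms by auto
  have "c powi (\<mu> j * int (d - i)) = c powi (\<mu> i * int (d - j))"
    unfolding power_int_mult pj p_i by (simp add: mult.commute flip: power_mult)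
  then have "c powi e1 = 1" using c(1) by (simp add: e1_def power_int_diff)
  then have "e1 = 0" by (rule powi_eq_one_imp_zero[OF c(1,3), rotated -1]) auto
  then show "\<mu> j * int (d - i) = \<mu> i * int (d - j)" by (simp add: e1_def)
  have "(C j * ((c * x) ^ \<delta>) powi \<mu> j) * poly B x ^ (d - j) = (c3 ^ d * poly B (c * x)) ^ (d - j) * (C j * (x ^ \<delta>) powi \<mu> j)"
    using c(7)[OF x, of j] assms c(1) x0 by (simp add: eval_\<rho>)
  then have "(x ^ \<delta>) powi \<mu> j * (x ^ l) ^ (d - j) * (c ^ \<delta>) powi \<mu> j = (x ^ \<delta>) powi \<mu> j * (x ^ l) ^ (d - j) * (c3 ^ d * c ^ l) ^ (d - j)"
    using assms(4) by (simp add: B_eq poly_monom power_mult_distrib power_int_mult_distrib mult_ac)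
  then have "(c ^ \<delta>) powi \<mu> j = (c3 ^ d * c ^ l) ^ (d - j)" using x0 by simp
  also have "\<dots> = (c3 ^ (d - j)) ^ d * c ^ (l * (d - j))"
    by (simp add: power_mult_distrib mult.commute flip: power_mult)
  also have "\<dots> = c powi (\<mu> j * int d) * c powi (int l * int (d - j))"
    unfolding power_int_mult by (simp add: pj flip: power_mult)
  also have "\<dots> = c powi (\<mu> j * int d + int l * int (d - j))"
    using c(1) by (simp add: power_int_add)
  also have "(c ^ \<delta>) powi \<mu> j = c powi (\<mu> j * int \<delta>)"
    by (simp add: mult.commute power_int_mult)
  finally have "c powi e2 = 1" using c(1) by (simp add: e2_def power_int_diff)
  then have "e2 = 0" by (rule powi_eq_one_imp_zero[OF c(1,3), rotated -1]) auto
  then show "\<mu> j * (int \<delta> - int d) = int l * int (d - j)" by (simp add: e2_def algebra_simps)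
qed

lemma coeff_regular_at_1: "has_value (coeff S j) 1 (if j \<le> d then C j else 0)"
  using has_value_monomial[of 1 "C j" "\<mu> j + int l"] S_coeff[of j] S(1) coeff_eq_0[of S j] has_value_0
  by (cases "j \<le> d") auto

lemma coeff_polynomial:
  assumes "j \<le> d" "\<mu> j + int l \<ge> 0 \<or> C j = 0"
  shows "\<exists>u. coeff S j = to_fract u"
proof (cases "C j = 0")
  case True then show ?thesis using S_coeff[OF assms(1)] by (intro exI[of _ 0]) simp
next
  case False
  then show ?thesis using S_coeff[OF assms(1)] assms(2)
    by (intro exI[of _ "monom (C j) (nat (\<mu> j + int l))"]) (simp add: to_fract_monom power_int_def)
qed

lemma polynomial_coeff_exponent:
  assumes "j \<le> d" "C j \<noteq> 0" "coeff S j = to_fract u"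
  shows "\<mu> j + int l \<ge> 0"
proof (rule ccontr)
  assume neg: "\<not> ?thesis"
  define n where "n = nat (- (\<mu> j + int l))"
  have "Z powi (\<mu> j + int l) = inverse (Z ^ n)" using neg by (simp add: power_int_def n_def power_inverse)
  then have "to_fract u * Z ^ n = rconst (C j)" using S_coeff[OF assms(1)] assms(3) by simp
  then have "to_fract (u * monom 1 n) = rconst (C j)" by (simp add: to_fract_monom)
  then have "to_fract (u * monom 1 n) = to_fract [:C j:]" by (simp only: rconst_def)
  then have "u * monom 1 n = [:C j:]" by (simp only: to_fract_eq_iff)
  moreover from this have "u \<noteq> 0" using assms(2) by auto
  ultimately have "degree u + n = 0" by (metis degree_monom_eq degree_mult_eq degree_pCons_0 monom_eq_0_iff one_neq_zero)
  then show False using neg by (simp add: n_def)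
qed

lemma semiconjugate:
  assumes r: "s * (int \<delta> - int d) = int l * r" "\<And>j. j < d \<Longrightarrow> C j \<noteq> 0 \<Longrightarrow> r * \<mu> j = s * int (d - j)"
  shows "semiconjugate_by (Z ^ \<delta>, S)
       (Z ^ \<delta>, map_poly rconst (map_poly (\<lambda>b. ratfun_eval b 1) S)) (monomial_map r s)"
proof -
  define Q0 where "Q0 = map_poly rconst (map_poly (\<lambda>b. ratfun_eval b 1) S)"
  have ev0: "ratfun_eval 0 1 = 0" by (simp add: ratfun_eval_def)
  have Q0: "coeff Q0 j = (if j \<le> d then rconst (C j) else 0)" for j
    using coeff_regular_at_1[of j] by (auto simp: Q0_def coeff_map_poly ev0 has_value_iff split: if_splits)
  have comp: "ratfun_compose (Z powi m) g = g powi m" for m g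
    using ratfun_compose_monomial[of 1 m g] by simp
  have compn: "ratfun_compose (Z ^ n) g = g ^ n" for n g
    using comp[of "int n" g] by simp
  have exps: "int \<delta> * s = r * (\<mu> j + int l) + s * int j" if "j \<le> d" "C j \<noteq> 0" for j
  proof (cases "j = d")
    case True
    then show ?thesis using r(1) C_d by (simp add: algebra_simps)
  next
    case False
    then have "r * \<mu> j = s * (int d - int j)" using r(2)[of j] that by (simp add: of_nat_diff)
    then show ?thesis using r(1) by (simp add: algebra_simps)
  qed
  have "monomial_map r s \<circ>\<^sub>r (Z ^ \<delta>, Q0) = ((Z ^ \<delta>) powi r, smult ((Z ^ \<delta>) powi s) Q0)"
    by (simp add: rat_skew_compose_def monomial_map_def comp map_poly_pCons pcompose_pCons)
  also have "\<dots> = (Z ^ \<delta>, S) \<circ>\<^sub>r monomial_map r s"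
  proof -
    have 1: "ratfun_compose (Z ^ \<delta>) (Z powi r) = (Z ^ \<delta>) powi r"
    proof -
      have "ratfun_compose (Z ^ \<delta>) (Z powi r) = Z powi (r * int \<delta>)" by (simp add: compn power_int_mult)
      also have "\<dots> = (Z ^ \<delta>) powi r" by (subst mult.commute) (simp add: power_int_mult)
      finally show ?thesis .
    qed
    have "smult ((Z ^ \<delta>) powi s) Q0 = pcompose (map_poly (\<lambda>b. ratfun_compose b (Z powi r)) S) [:0, Z powi s:]"
    proof (rule poly_eqI)
      fix j
      have "coeff (pcompose (map_poly (\<lambda>b. ratfun_compose b (Z powi r)) S) [:0, Z powi s:]) j
          = (Z powi s) ^ j * ratfun_compose (coeff S j) (Z powi r)"
        by (simp add: coeff_pcompose_linear coeff_map_poly)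
      also have "\<dots> = coeff (smult ((Z ^ \<delta>) powi s) Q0) j"
      proof (cases "j \<le> d \<and> C j \<noteq> 0")
        case True
        have "(Z powi s) ^ j * (Z powi r) powi (\<mu> j + int l) = (Z ^ \<delta>) powi s"
        proof -
          have "(Z powi s) ^ j = Z powi (s * int j)" by (simp add: power_int_mult)
          moreover have "(Z powi r) powi (\<mu> j + int l) = Z powi (r * (\<mu> j + int l))" by (simp only: power_int_mult)
          moreover have "(Z ^ \<delta>) powi s = Z powi (int \<delta> * s)" by (simp add: power_int_mult)
          ultimately show ?thesis using exps[of j] True by (simp add: add.commute flip: power_int_add)
        qed
        then show ?thesis using True by (simp add: Q0 S_coeff ratfun_compose_monomial mult_ac)
      next
        case False
        then have "coeff S j = 0" using S_coeff[of j] S(1) coeff_eq_0[of S j] by (cases "j \<le> d") auto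
        then show ?thesis using False by (auto simp: Q0)
      qed
      finally show "coeff (smult ((Z ^ \<delta>) powi s) Q0) j = coeff (pcompose (map_poly (\<lambda>b. ratfun_compose b (Z powi r)) S) [:0, Z powi s:]) j"
        by simp
    qed
    then show ?thesis by (simp add: rat_skew_compose_def monomial_map_def 1)
  qed
  finally show ?thesis by (simp add: semiconjugate_by_def Q0_def)
qed

text \<open>
  The relations between exponents make \<open>\<mu>\<^sub>j / (d - j)\<close> the same for all \<open>j < d\<close> with \<open>C\<^sub>j \<noteq> 0\<close>. Its value is 0 in
  case (ii); otherwise it is \<open>s / r\<close> in lowest terms, and \<open>\<mu>\<^sub>j (\<delta> - d) = l (d - j)\<close> distinguishes \<open>l = 0\<close>
  from \<open>l \<noteq> 0\<close>. For \<open>l = 0\<close> the sign of \<open>s / r\<close> comes from the coefficients being polynomials.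
\<close>

theorem monomial_classification:
  assumes poly: "l = 0 \<Longrightarrow> (\<And>j. \<exists>u. coeff S j = to_fract u)"
  shows "(case_ii \<delta> d (Z ^ \<delta>, S) \<and> is_polynomial_map (Z ^ \<delta>, S)) \<or>
    (\<exists>r s. case_iv \<delta> d l (Z ^ \<delta>, S) r s \<and> (real_of_int s / real_of_int r > 0 \<longrightarrow> is_polynomial_map (Z ^ \<delta>, S)))"
proof -
  obtain j0 where j0: "j0 < d" "C j0 \<noteq> 0" using nonzero_coefficient by blast
  have fstF: "fst (Z ^ \<delta>, S) = to_fract (monom 1 \<delta>)" by (simp add: to_fract_monom)
  have out: "coeff S j = 0" if "j > d" for j using that S(1) coeff_eq_0 by blast
  show ?thesis
  proof (cases "\<mu> j0 = 0")
    case True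
    have \<mu>0: "\<mu> j = 0" if "j < d" "C j \<noteq> 0" for j
      using exponents(1)[OF j0(1) that(1) j0(2) that(2)] True j0(1) by simp
    have l0: "l = 0" using exponents(2)[OF j0(1) j0(1) j0(2) j0(2)] True j0(1) by simp
    have co: "coeff S j = rconst (if j \<le> d then C j else 0)" for j
      using S_coeff[of j] \<mu>0[of j] C_d l0 out[of j] by (cases j d rule: linorder_cases) (cases "C j = 0"; auto)+
    have polyF: "is_polynomial_map (Z ^ \<delta>, S)"
      by (rule is_polynomial_mapI[OF fstF]) (use co in \<open>auto simp: rconst_def\<close>)
    define q0 where "q0 = map_poly (\<lambda>b. ratfun_eval b 1) S"
    have ev0: "ratfun_eval 0 1 = 0" by (simp add: ratfun_eval_def)
    have "S = map_poly rconst q0"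
      by (rule poly_eqI)
        (use co coeff_regular_at_1 in \<open>simp add: q0_def coeff_map_poly ev0 has_value_iff\<close>)
    moreover have "q0 \<noteq> monom 1 d"
    proof
      assume "q0 = monom 1 d"
      then have "S = monom 1 d" using \<open>S = map_poly rconst q0\<close> by (simp add: map_poly_monom)
      then show False using nonmonomial by simp
    qed
    ultimately have "case_ii \<delta> d (Z ^ \<delta>, S)" unfolding case_ii_def by blast
    then show ?thesis using polyF by blast
  next
    case False
    define g where "g = gcd (\<mu> j0) (int (d - j0))"
    have g: "g > 0" using j0 by (simp add: g_def)
    obtain s r where sr: "\<mu> j0 = s * g" "int (d - j0) = r * g" "coprime s r"
      unfolding g_def by (rule gcd_coprime_exists[of "\<mu> j0" "int (d - j0)", THEN exE]) (use g g_def in auto)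
    have r: "r > 0" using sr(2) j0(1) g by (metis of_nat_0_less_iff zero_less_diff zero_less_mult_pos2)
    have s: "s \<noteq> 0" using sr False by auto
    have e1: "s * (int \<delta> - int d) = int l * r"
    proof -
      have "(s * (int \<delta> - int d)) * g = (int l * r) * g"
        using exponents(2)[OF j0(1) j0(1) j0(2) j0(2)] unfolding sr by (simp only: mult_ac)
      then show ?thesis using g by simp
    qed
    have e2: "r * \<mu> j = s * int (d - j)" if "j < d" "C j \<noteq> 0" for j
    proof -
      have "(r * \<mu> j) * g = (s * int (d - j)) * g"
        using exponents(1)[OF j0(1) that(1) j0(2) that(2)] unfolding sr by (simp only: mult_ac)
      then show ?thesis using g by simp
    qed
    have sign: "real_of_int s / real_of_int r > 0 \<longleftrightarrow> s > 0"
      using r by (simp add: zero_less_divide_iff)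
    have polyF: "is_polynomial_map (Z ^ \<delta>, S)" if "s > 0"
    proof (rule is_polynomial_mapI[OF fstF])
      fix j
      have "\<mu> j \<ge> 0" if "j < d" "C j \<noteq> 0"
      proof -
        have "0 \<le> r * \<mu> j" using e2[OF that] \<open>s > 0\<close> by simp
        then show ?thesis using r by (simp add: zero_le_mult_iff)
      qed
      then have "\<mu> j + int l \<ge> 0 \<or> C j = 0" if "j \<le> d"
        using that C_d by (cases "j = d") auto
      then show "\<exists>v. coeff (snd (Z ^ \<delta>, S)) j = to_fract v"
        using coeff_polynomial[of j] out[of j] by (cases "j \<le> d") (auto intro: exI[of _ 0])
    qed
    have "case_iv \<delta> d l (Z ^ \<delta>, S) r s"
      unfolding case_iv_def
    proof (intro conjI)
      show "semiconjugate_by (Z ^ \<delta>, S) (Z ^ \<delta>, map_poly rconst (map_poly (\<lambda>b. ratfun_eval b 1) (snd (Z ^ \<delta>, S)))) (monomial_map r s)"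
        using semiconjugate[OF e1 e2] by simp
      show "\<forall>j. regular_at (coeff (snd (Z ^ \<delta>, S)) j) 1"
        using coeff_regular_at_1 by (auto simp: has_value_iff)
      show "l = 0 \<longrightarrow> \<delta> = d \<and> real_of_int s / real_of_int r > 0"
      proof
        assume l: "l = 0"
        then have "\<delta> = d" using e1 s by simp
        moreover have "\<mu> j0 \<ge> 0"
        proof -
          obtain u where "coeff S j0 = to_fract u" using poly[OF l] by blast
          then show ?thesis using polynomial_coeff_exponent[of j0 u] j0 l by simp
        qed
        then have "s > 0" using sr(1) g False by (metis zero_le_mult_iff order_less_le linorder_not_less mult_eq_0_iff not_less)
        ultimately show "\<delta> = d \<and> real_of_int s / real_of_int r > 0" using sign by simp
      qed
      show "l \<noteq> 0 \<longrightarrow> \<delta> \<noteq> d \<and> real_of_int s / real_of_int r = real l / (real \<delta> - real d)"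
      proof
        assume l: "l \<noteq> 0"
        then have ne: "\<delta> \<noteq> d" using e1 r by auto
        have "real_of_int (s * (int \<delta> - int d)) = real_of_int (int l * r)" using e1 by simp
        then have "real_of_int s * (real \<delta> - real d) = real l * real_of_int r" by simp
        then show "\<delta> \<noteq> d \<and> real_of_int s / real_of_int r = real l / (real \<delta> - real d)"
          using ne r by (simp add: field_simps)
      qed
    qed (use nonmonomial r s sr(3) in \<open>auto simp: coprime_commute\<close>)
    then show ?thesis using polyF sign by blast
  qed
qed

end

section \<open>The Julia sets of the base and of the fibres\<close>

definition fibre :: "complex poly poly \<Rightarrow> complex \<Rightarrow> complex poly" where
  "fibre q z = map_poly (\<lambda>b. poly b z) q"

definition fibre_julia :: "complex poly \<Rightarrow> complex poly poly \<Rightarrow> complex \<Rightarrow> complex set" where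
  "fibre_julia p q z = frontier (filled_julia_fibre p q z)"

lemma coeff_fibre [simp]: "coeff (fibre q z) j = poly (coeff q j) z"
  by (simp add: fibre_def coeff_map_poly)

lemma degree_fibre:
  assumes "poly (lead_coeff q) z \<noteq> 0"
  shows "degree (fibre q z) = degree q"
proof (rule antisym)
  show "degree (fibre q z) \<le> degree q" by (rule degree_le) (simp add: coeff_eq_0)
  show "degree q \<le> degree (fibre q z)" using assms by (intro le_degree) simp
qed

lemma skew_map_funpow:
  "(skew_map p q ^^ n) (z, w) = ((poly p ^^ n) z, seq_orbit (\<lambda>k. fibre q ((poly p ^^ k) z)) n w)"
  by (induction n) (auto simp: skew_map_def fibre_def)

lemma filled_julia_fibre_eq:
  "filled_julia_fibre p q z = filled_set (degree q) (\<lambda>k. fibre q ((poly p ^^ k) z))"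
  by (simp add: filled_julia_fibre_def green_fibre_def Q_iter_def skew_map_funpow filled_set_def)

lemma filled_julia_fibre_vimage:
  assumes "degree q > 0"
  shows "filled_julia_fibre p q z = poly (fibre q z) -` filled_julia_fibre p q (poly p z)"
  using filled_set_vimage[OF assms, of "\<lambda>k. fibre q ((poly p ^^ k) z)"]
  by (simp add: filled_julia_fibre_eq funpow_Suc_right del: funpow.simps)

lemma fibre_julia_vimage:
  assumes "degree q > 0" "poly (lead_coeff q) z \<noteq> 0"
  shows "fibre_julia p q z = poly (fibre q z) -` fibre_julia p q (poly p z)"
  unfolding fibre_julia_def using assms
  by (subst filled_julia_fibre_vimage) (auto simp: poly_vimage_frontier degree_fibre)

lemma julia_set_iff: "(z, w) \<in> julia_set p q \<longleftrightarrow> z \<in> julia_base p \<and> w \<in> fibre_julia p q z"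
  by (auto simp: julia_set_def fibre_julia_def)

lemma filled_julia_base_closed_bounded:
  assumes "degree p \<ge> 2"
  shows "closed (filled_julia_base p)" "bounded (filled_julia_base p)"
proof -
  obtain R where R: "R \<ge> 1" "\<And>z. cmod z \<ge> R \<Longrightarrow> cmod (poly p z) \<ge> 2 * cmod z"
    using poly_escape_radius[OF assms] by blast
  have orbit: "cmod ((poly p ^^ n) z) \<le> R" if z: "z \<in> filled_julia_base p" for z n
  proof (rule ccontr)
    assume "\<not> ?thesis"
    then have far: "cmod ((poly p ^^ n) z) \<ge> R" by simp
    obtain B where B: "\<And>m. cmod ((poly p ^^ m) z) \<le> B"
      using z by (auto simp: filled_julia_base_def bounded_iff)
    obtain m where m: "2 ^ m > B" using real_arch_pow[of 2 B] by auto
    have "2 ^ m * 1 \<le> 2 ^ m * cmod ((poly p ^^ n) z)" using far R(1) by (intro mult_left_mono) auto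
    also have "\<dots> \<le> cmod ((poly p ^^ m) ((poly p ^^ n) z))" by (rule escape_growth[OF R far])
    also have "\<dots> \<le> B" using B[of "m + n"] by (simp add: funpow_add)
    finally show False using m by simp
  qed
  have eq: "filled_julia_base p = (\<Inter>n. {z. cmod ((poly p ^^ n) z) \<le> R})"
  proof
    show "filled_julia_base p \<subseteq> (\<Inter>n. {z. cmod ((poly p ^^ n) z) \<le> R})" using orbit by blast
    show "(\<Inter>n. {z. cmod ((poly p ^^ n) z) \<le> R}) \<subseteq> filled_julia_base p"
      by (auto simp: filled_julia_base_def bounded_iff intro!: exI[of _ R])
  qed
  have "continuous_on UNIV (poly p ^^ n)" for n
    by (induction n) (auto intro!: continuous_intros simp: o_def)
  then show "closed (filled_julia_base p)"
    unfolding eq by (intro closed_INT ballI closed_Collect_le continuous_on_norm continuous_on_const)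
  show "bounded (filled_julia_base p)" using orbit[of _ 0] by (auto simp: bounded_iff)
qed

lemma filled_julia_base_vimage: "filled_julia_base p = poly p -` filled_julia_base p"
proof -
  have "bounded (range (\<lambda>n. (poly p ^^ n) z)) \<longleftrightarrow> bounded (range (\<lambda>n. (poly p ^^ n) (poly p z)))" for z
  proof -
    have "(\<lambda>n. (poly p ^^ n) (poly p z)) = (\<lambda>n. (poly p ^^ Suc n) z)"
      by (simp add: funpow_Suc_right del: funpow.simps)
    moreover have "range (\<lambda>n. (poly p ^^ n) z) = insert z (range (\<lambda>n. (poly p ^^ Suc n) z))"
    proof -
      have "range (\<lambda>n. (poly p ^^ n) z) = (\<lambda>n. (poly p ^^ n) z) ` insert 0 (range Suc)"
        by (simp only: UNIV_nat_eq[symmetric])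
      then show ?thesis by (simp add: image_image del: funpow.simps)
    qed
    ultimately show ?thesis by (simp only: bounded_insert)
  qed
  then show ?thesis by (auto simp: filled_julia_base_def)
qed

lemma julia_base_vimage: "degree p > 0 \<Longrightarrow> julia_base p = poly p -` julia_base p"
  unfolding julia_base_def by (subst (1) filled_julia_base_vimage) (rule poly_vimage_frontier)

lemma julia_base_subset: "degree p \<ge> 2 \<Longrightarrow> julia_base p \<subseteq> filled_julia_base p"
  unfolding julia_base_def using filled_julia_base_closed_bounded(1) by (rule frontier_subset_closed)

text \<open>
  The points over which the fibres behave as for a single polynomial. They are required to lie in the
  filled Julia set of \<open>p\<close> only, which keeps the coefficients bounded along the orbit and makes the
  notion forward invariant.
\<close>

definition regular_point :: "complex poly \<Rightarrow> complex poly poly \<Rightarrow> complex \<Rightarrow> bool" where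
  "regular_point p q z \<longleftrightarrow> z \<in> filled_julia_base p \<and> log_tame (degree q) p (lead_coeff q) z"

lemma regular_point_lead: "regular_point p q z \<Longrightarrow> poly (lead_coeff q) z \<noteq> 0"
  unfolding regular_point_def log_tame_def by (metis funpow_0)

lemma regular_point_tame:
  assumes "regular_point p q z"
  shows "tame_sequence (degree q) (\<lambda>k. fibre q ((poly p ^^ k) z))"
proof -
  have nz: "poly (lead_coeff q) ((poly p ^^ k) z) \<noteq> 0" for k
    using assms by (simp add: regular_point_def log_tame_def)
  have deg: "degree (fibre q ((poly p ^^ k) z)) = degree q" for k
    by (rule degree_fibre[OF nz])
  obtain B where B: "\<And>m. (poly p ^^ m) z \<in> cball 0 B"
    using assms by (auto simp: regular_point_def filled_julia_base_def bounded_iff)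
  have "\<exists>M. \<forall>x\<in>cball 0 B. cmod (poly b x) \<le> M" for b
  proof -
    have "compact (poly b ` cball 0 B)"
      by (intro compact_continuous_image continuous_intros compact_cball)
    then show ?thesis by (auto dest!: compact_imp_bounded simp: bounded_iff)
  qed
  then obtain M where M: "\<And>b x. x \<in> cball 0 B \<Longrightarrow> cmod (poly b x) \<le> M b" by metis
  have M0: "M b \<ge> 0" for b using M[OF B[of 0], of b] norm_ge_zero order.trans by blast
  have "cmod (coeff (fibre q ((poly p ^^ k) z)) j) \<le> (\<Sum>i\<le>degree q. M (coeff q i))" for k j
  proof (cases "j \<le> degree q")
    case True
    have "cmod (coeff (fibre q ((poly p ^^ k) z)) j) \<le> M (coeff q j)" using M[OF B] by simp
    also have "\<dots> \<le> (\<Sum>i\<le>degree q. M (coeff q i))" using True M0 by (intro member_le_sum) auto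
    finally show ?thesis .
  next
    case False
    then show ?thesis using M0 by (simp add: coeff_eq_0 sum_nonneg)
  qed
  then show ?thesis
    using assms unfolding tame_sequence_def deg by (auto simp: deg regular_point_def log_tame_def)
qed

lemma regular_point_step:
  assumes "regular_point p q z"
  shows "regular_point p q (poly p z)"
proof -
  have shift: "(poly p ^^ k) (poly p z) = (poly p ^^ Suc k) z" for k
    by (simp add: funpow_Suc_right del: funpow.simps)
  have "summable (\<lambda>k. ln (cmod (lead_coeff (fibre q ((poly p ^^ Suc k) z)))) / real (degree q) ^ k)"
    using tame_shift[OF regular_point_tame[OF assms]] unfolding tame_sequence_def by blast
  moreover have "degree (fibre q ((poly p ^^ Suc k) z)) = degree q" for k
    using assms by (intro degree_fibre) (auto simp: regular_point_def log_tame_def simp del: funpow.simps)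
  ultimately have "summable (\<lambda>k. ln (cmod (poly (lead_coeff q) ((poly p ^^ Suc k) z))) / real (degree q) ^ k)"
    by (simp del: funpow.simps)
  then show ?thesis
    using assms filled_julia_base_vimage[of p]
    unfolding regular_point_def log_tame_def shift by (auto simp del: funpow.simps)
qed

lemma regular_point_fibre_julia:
  assumes "regular_point p q z" "degree q \<ge> 2"
  shows "compact (fibre_julia p q z)" "fibre_julia p q z \<noteq> {}" "fibre_julia p q z \<noteq> {a}"
  using regular_point_tame[OF assms(1)] assms(2) unfolding fibre_julia_def filled_julia_fibre_eq
  by (auto intro: frontier_nonempty_compact tame_bounded tame_nonempty
      simp: frontier_nonempty_compact(1)[OF tame_bounded tame_nonempty] tame_frontier_not_singleton)

section \<open>Affine conjugacies of polynomials\<close>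

definition centroid :: "complex poly \<Rightarrow> complex" where
  "centroid g = - coeff g (degree g - 1) / (of_nat (degree g) * lead_coeff g)"

lemma coeff_pcompose_affine:
  fixes g :: "complex poly"
  assumes "degree g = d" "d \<ge> 1"
  shows "coeff (pcompose g [:\<beta>, \<alpha>:]) d = \<alpha> ^ d * coeff g d"
    and "coeff (pcompose g [:\<beta>, \<alpha>:]) (d - 1) = \<alpha> ^ (d - 1) * (coeff g (d - 1) + of_nat d * \<beta> * coeff g d)"
proof -
  have "pcompose g [:\<beta>, \<alpha>:] = (\<Sum>j\<le>d. smult (coeff g j) ([:\<beta>, \<alpha>:] ^ j))"
    unfolding poly_eq_poly_eq_iff[symmetric] using assms(1)
    by (auto simp: poly_pcompose poly_altdef[of g] poly_sum)
  moreover have "coeff ([:\<beta>, \<alpha>:] ^ j) k = of_nat (j choose k) * \<alpha> ^ k * \<beta> ^ (j - k)" for j k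
  proof (cases "k \<le> j")
    case False
    have "degree ([:\<beta>, \<alpha>:] ^ j) \<le> degree [:\<beta>, \<alpha>:] * j" by (rule degree_power_le)
    also have "\<dots> \<le> 1 * j" by (intro mult_right_mono) auto
    finally show ?thesis using False by (simp add: coeff_eq_0 binomial_eq_0)
  qed (rule coeff_linear_poly_power)
  ultimately have co: "coeff (pcompose g [:\<beta>, \<alpha>:]) k = (\<Sum>j\<le>d. coeff g j * (of_nat (j choose k) * \<alpha> ^ k * \<beta> ^ (j - k)))" for k
    by (simp add: coeff_sum)
  have "coeff (pcompose g [:\<beta>, \<alpha>:]) d = (\<Sum>j\<in>{d}. coeff g j * (of_nat (j choose d) * \<alpha> ^ d * \<beta> ^ (j - d)))"
    unfolding co by (intro sum.mono_neutral_right) (auto simp: binomial_eq_0)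
  then show "coeff (pcompose g [:\<beta>, \<alpha>:]) d = \<alpha> ^ d * coeff g d" by simp
  have "coeff (pcompose g [:\<beta>, \<alpha>:]) (d - 1)
      = (\<Sum>j\<in>{d - 1, d}. coeff g j * (of_nat (j choose (d - 1)) * \<alpha> ^ (d - 1) * \<beta> ^ (j - (d - 1))))"
    unfolding co by (intro sum.mono_neutral_right) (auto simp: binomial_eq_0)
  then show "coeff (pcompose g [:\<beta>, \<alpha>:]) (d - 1) = \<alpha> ^ (d - 1) * (coeff g (d - 1) + of_nat d * \<beta> * coeff g d)"
    using assms(2) binomial_symmetric[of "d - 1" d] by (simp add: algebra_simps)
qed

text \<open>
  Compare the coefficients of exponents \<open>d\<close> and \<open>d - 1\<close>; as \<open>d \<ge> 2\<close>, the translation \<open>\<beta>'\<close> does not affect them.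
\<close>

lemma centroid_equivariant:
  fixes g g' :: "complex poly"
  assumes deg: "degree g = d" "degree g' = d" "d \<ge> 2" and \<alpha>: "\<alpha> \<noteq> 0"
    and eq: "pcompose g' [:\<beta>, \<alpha>:] = pcompose [:\<beta>', \<alpha>':] g"
  shows "\<alpha> * centroid g + \<beta> = centroid g'"
proof -
  have nz: "coeff g d \<noteq> 0" "coeff g' d \<noteq> 0"
  proof -
    have "g \<noteq> 0" "g' \<noteq> 0" using deg by auto
    then have "lead_coeff g \<noteq> 0" "lead_coeff g' \<noteq> 0" by simp_all
    then show "coeff g d \<noteq> 0" "coeff g' d \<noteq> 0" unfolding deg by simp_all
  qed
  have rhs: "coeff (pcompose [:\<beta>', \<alpha>':] g) k = \<alpha>' * coeff g k" if "k > 0" for k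
    using that by (simp add: pcompose_pCons coeff_pCons mult.commute split: nat.split)
  have 1: "\<alpha> ^ d * coeff g' d = \<alpha>' * coeff g d"
    using coeff_pcompose_affine(1)[of g' d \<beta> \<alpha>] deg rhs[of d] eq by simp
  have 2: "\<alpha> ^ (d - 1) * (coeff g' (d - 1) + of_nat d * \<beta> * coeff g' d) = \<alpha>' * coeff g (d - 1)"
    using coeff_pcompose_affine(2)[of g' d \<beta> \<alpha>] deg rhs[of "d - 1"] eq by simp
  have "\<alpha> ^ (d - 1) * (coeff g' (d - 1) + of_nat d * \<beta> * coeff g' d) * coeff g d
      = \<alpha> ^ (d - 1) * (\<alpha> * coeff g' d * coeff g (d - 1))"
  proof -
    have "\<alpha> ^ (d - 1) * (coeff g' (d - 1) + of_nat d * \<beta> * coeff g' d) * coeff g d = (\<alpha>' * coeff g d) * coeff g (d - 1)"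
      unfolding 2 by simp
    also have "\<dots> = \<alpha> ^ d * coeff g' d * coeff g (d - 1)" unfolding 1 ..
    also have "\<alpha> ^ d = \<alpha> ^ (d - 1) * \<alpha>" using deg(3) by (metis One_nat_def Suc_pred less_2_cases_iff linorder_not_less neq0_conv power_Suc2)
    finally show ?thesis by (simp add: mult.assoc)
  qed
  then have "(coeff g' (d - 1) + of_nat d * \<beta> * coeff g' d) * coeff g d = \<alpha> * coeff g' d * coeff g (d - 1)"
    using \<alpha> by (simp add: mult.assoc)
  then have "of_nat d * ((coeff g' (d - 1) + of_nat d * \<beta> * coeff g' d) * coeff g d)
      = of_nat d * (\<alpha> * coeff g' d * coeff g (d - 1))" by simp
  then show ?thesis
    using nz deg by (simp add: centroid_def field_simps)
qed

text \<open>
  If \<open>T = \<alpha> w + \<beta>\<close> maps \<open>X\<^sub>z\<close> onto \<open>X\<^bsub>z'\<^esub>\<close>, then \<open>q\<^sub>z\<close> and \<open>q\<^bsub>z'\<^esub> \<circ> T\<close> have the same preimages of \<open>X\<^bsub>p(z)\<^esub>\<close> and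
  \<open>X\<^bsub>p(z')\<^esub>\<close>, so they are affinely related. The second affine map again relates the
  boundary sets, now one step later, which permits iteration.
\<close>

lemma fibre_symmetry_step:
  assumes q: "degree q \<ge> 2" and z: "regular_point p q z" "regular_point p q z'" and \<alpha>: "\<alpha> \<noteq> 0"
    and T: "fibre_julia p q z' = poly [:\<beta>, \<alpha>:] ` fibre_julia p q z"
  obtains \<alpha>' \<beta>' where "\<alpha>' \<noteq> 0" "pcompose (fibre q z') [:\<beta>, \<alpha>:] = pcompose [:\<beta>', \<alpha>':] (fibre q z)"
    "fibre_julia p q (poly p z') = poly [:\<beta>', \<alpha>':] ` fibre_julia p q (poly p z)"
    "\<alpha> * centroid (fibre q z) + \<beta> = centroid (fibre q z')"
proof -
  define g g' where "g = fibre q z" and "g' = fibre q z'"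
  define h where "h = pcompose g' [:\<beta>, \<alpha>:]"
  define X X' where "X = fibre_julia p q (poly p z)" and "X' = fibre_julia p q (poly p z')"
  have deg: "degree g = degree q" "degree g' = degree q"
    unfolding g_def g'_def using regular_point_lead z degree_fibre by blast+
  have degh: "degree h = degree q" using \<alpha> by (simp add: h_def deg degree_pcompose)
  have X: "compact X" "X \<noteq> {}" "X \<noteq> {a}" "compact X'" for a
    unfolding X_def X'_def using regular_point_fibre_julia[OF regular_point_step] z q by auto
  have Xz: "fibre_julia p q z = poly g -` X" "fibre_julia p q z' = poly g' -` X'"
    unfolding g_def g'_def X_def X'_def
    using fibre_julia_vimage regular_point_lead z q by auto
  have inj: "inj (poly [:\<beta>, \<alpha>:])" using \<alpha> by (auto intro!: injI)
  have eq: "poly g -` X = poly h -` X'"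
  proof -
    have "poly h -` X' = poly [:\<beta>, \<alpha>:] -` (poly g' -` X')" by (auto simp: h_def poly_pcompose)
    also have "\<dots> = poly [:\<beta>, \<alpha>:] -` (poly [:\<beta>, \<alpha>:] ` (poly g -` X))" using T Xz by simp
    also have "\<dots> = poly g -` X" using inj by (rule inj_vimage_image_eq)
    finally show ?thesis by simp
  qed
  have "degree g > 0" "degree h = degree g" using deg degh q by auto
  from equal_preimages_affine[OF X this eq] obtain \<alpha>' \<beta>' where a: "\<alpha>' \<noteq> 0" "h = smult \<alpha>' g + [:\<beta>':]" .
  have he: "h = pcompose [:\<beta>', \<alpha>':] g" unfolding a(2) by (simp add: pcompose_pCons)
  have surj: "poly g ` (poly g -` Y) = Y" if "degree g > 0" for g :: "complex poly" and Y
  proof -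
    have "surj (poly g)"
      unfolding surj_def using poly_surj[OF that] by metis
    then show ?thesis by (rule surj_image_vimage_eq)
  qed
  have "X' = poly g' ` (poly g' -` X')" using surj[of g'] deg q by simp
  also have "\<dots> = poly g' ` (poly [:\<beta>, \<alpha>:] ` (poly g -` X))" using T Xz by simp
  also have "\<dots> = poly h ` (poly g -` X)" by (simp add: h_def image_image poly_pcompose)
  also have "\<dots> = poly [:\<beta>', \<alpha>':] ` (poly g ` (poly g -` X))" unfolding he
    by (simp only: image_image) (rule image_cong[OF refl poly_pcompose])
  also have "\<dots> = poly [:\<beta>', \<alpha>':] ` X" using surj[of g] deg q by simp
  finally have X'X: "X' = poly [:\<beta>', \<alpha>':] ` X" .
  have "\<alpha> * centroid g + \<beta> = centroid g'"
    by (rule centroid_equivariant[OF deg q \<alpha>]) (use he in \<open>simp add: h_def\<close>)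
  then show thesis
    using he X'X unfolding h_def g_def g'_def X_def X'_def by (intro that[OF a(1)])
qed

section \<open>The action of a symmetry on the fibres and on the base\<close>

lemma symmetry_fibre:
  assumes \<gamma>: "(\<lambda>(z, w). (c1 * z + c2, c3 * w + poly c4 z)) \<in> julia_symmetries p q"
    and c: "c1 \<noteq> 0" and z: "z \<in> julia_base p" "fibre_julia p q z \<noteq> {}"
  shows "c1 * z + c2 \<in> julia_base p"
    and "fibre_julia p q (c1 * z + c2) = poly [:poly c4 z, c3:] ` fibre_julia p q z"
proof -
  define \<gamma> where "\<gamma> = (\<lambda>(z, w). (c1 * z + c2, c3 * w + poly c4 z))"
  have J: "\<gamma> ` julia_set p q = julia_set p q" using assms(1) by (simp add: julia_symmetries_def \<gamma>_def)
  have fw: "c1 * z + c2 \<in> julia_base p \<and> poly [:poly c4 z, c3:] w \<in> fibre_julia p q (c1 * z + c2)"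
    if "w \<in> fibre_julia p q z" for w
  proof -
    have "(z, w) \<in> julia_set p q" using z that by (simp add: julia_set_iff)
    then have "\<gamma> (z, w) \<in> julia_set p q" using J by blast
    then show ?thesis by (simp add: \<gamma>_def julia_set_iff mult.commute add.commute)
  qed
  then show s: "c1 * z + c2 \<in> julia_base p" using z(2) by blast
  have "w' \<in> poly [:poly c4 z, c3:] ` fibre_julia p q z" if "w' \<in> fibre_julia p q (c1 * z + c2)" for w'
  proof -
    have "(c1 * z + c2, w') \<in> julia_set p q" using s that by (simp add: julia_set_iff)
    then obtain z1 w1 where "(z1, w1) \<in> julia_set p q" "\<gamma> (z1, w1) = (c1 * z + c2, w')" using J by (metis (no_types, lifting) imageE surj_pair)
    then have "z1 = z" "w' = poly [:poly c4 z, c3:] w1" "w1 \<in> fibre_julia p q z1"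
      using c by (auto simp: \<gamma>_def julia_set_iff)
    then show ?thesis by blast
  qed
  then show "fibre_julia p q (c1 * z + c2) = poly [:poly c4 z, c3:] ` fibre_julia p q z" using fw by blast
qed

definition base_projection :: "complex poly \<Rightarrow> complex poly poly \<Rightarrow> complex set" where
  "base_projection p q = {z \<in> julia_base p. fibre_julia p q z \<noteq> {}}"

lemma symmetry_base:
  assumes \<gamma>: "(\<lambda>(z, w). (c1 * z + c2, c3 * w + poly c4 z)) \<in> julia_symmetries p q" and c: "c1 \<noteq> 0"
  shows "poly [:c2, c1:] -` base_projection p q = base_projection p q"
proof -
  define \<gamma> where "\<gamma> = (\<lambda>(z, w). (c1 * z + c2, c3 * w + poly c4 z))"
  have J: "\<gamma> ` julia_set p q = julia_set p q" using assms(1) by (simp add: julia_symmetries_def \<gamma>_def)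
  have "z \<in> base_projection p q" if z: "poly [:c2, c1:] z \<in> base_projection p q" for z
  proof -
    obtain w' where "(c1 * z + c2, w') \<in> julia_set p q" using z by (auto simp: base_projection_def julia_set_iff mult.commute add.commute)
    then obtain z1 w1 where "(z1, w1) \<in> julia_set p q" "\<gamma> (z1, w1) = (c1 * z + c2, w')" using J by (metis (no_types, lifting) imageE surj_pair)
    then show ?thesis using c by (auto simp: \<gamma>_def julia_set_iff base_projection_def)
  qed
  moreover have "poly [:c2, c1:] z \<in> base_projection p q" if z: "z \<in> base_projection p q" for z
    using symmetry_fibre[OF \<gamma> c, of z] z by (auto simp: base_projection_def mult.commute add.commute)
  ultimately show ?thesis by blast
qed

lemma finite_poly_vimage:
  fixes p :: "complex poly"
  assumes "degree p > 0" "finite A"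
  shows "finite (poly p -` A)"
proof -
  have "finite {x. poly p x = y}" for y
  proof -
    have "p - [:y:] \<noteq> 0" using assms(1) by (metis degree_diff_const degree_0 less_irrefl)
    then have "finite {x. poly (p - [:y:]) x = 0}" by (rule poly_roots_finite)
    then show ?thesis by simp
  qed
  then have "finite (\<Union>y\<in>A. {x. poly p x = y})" using assms(2) by blast
  moreover have "poly p -` A = (\<Union>y\<in>A. {x. poly p x = y})" by auto
  ultimately show ?thesis by simp
qed

text \<open>
  Polynomials are open, continuous and finite-to-one.
\<close>

lemma islimpt_poly_vimage:
  fixes p :: "complex poly"
  assumes "degree p > 0"
  shows "poly p z islimpt A \<longleftrightarrow> z islimpt (poly p -` A)"
proof
  assume L: "poly p z islimpt A"
  show "z islimpt (poly p -` A)"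
    unfolding islimpt_eq_acc_point
  proof (intro allI impI)
    fix U assume U: "z \<in> U" "open U"
    then have "infinite (poly p ` U \<inter> A)"
      using L open_poly_image[OF assms U(2)] unfolding islimpt_eq_acc_point by blast
    moreover have "poly p ` U \<inter> A \<subseteq> poly p ` (U \<inter> poly p -` A)" by blast
    ultimately show "infinite (U \<inter> poly p -` A)" using finite_surj by blast
  qed
next
  assume L: "z islimpt (poly p -` A)"
  show "poly p z islimpt A"
    unfolding islimpt_eq_acc_point
  proof (intro allI impI)
    fix U assume U: "poly p z \<in> U" "open U"
    have "open (poly p -` U)" using U(2) by (intro open_vimage) (auto intro: continuous_intros)
    then have inf: "infinite (poly p -` U \<inter> poly p -` A)"
      using L U(1) unfolding islimpt_eq_acc_point by blast
    show "infinite (U \<inter> A)"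
    proof
      assume "finite (U \<inter> A)"
      then have "finite (poly p -` (U \<inter> A))" by (rule finite_poly_vimage[OF assms])
      then show False using inf by (simp add: vimage_Int)
    qed
  qed
qed

lemma infinite_regular_points:
  assumes p: "degree p \<ge> 2" and q: "degree q \<ge> 2" and c: "cmod c = 1"
    and rot: "\<And>k z. poly p (\<zeta> + c ^ (degree p ^ k) * z) - \<zeta> = c ^ (degree p ^ Suc k) * (poly p (\<zeta> + z) - \<zeta>)"
  shows "infinite {z \<in> julia_base p. regular_point p q z \<and> log_tame (degree q) p (lead_coeff q) (\<zeta> + c * (z - \<zeta>))}"
proof -
  have "lead_coeff q \<noteq> 0" using q by auto
  then have "infinite {z \<in> julia_base p. log_tame (degree q) p (lead_coeff q) z \<and> log_tame (degree q) p (lead_coeff q) (\<zeta> + c * (z - \<zeta>))}"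
    by (rule infinite_log_tame[OF p q _ c rot])
  moreover have "{z \<in> julia_base p. log_tame (degree q) p (lead_coeff q) z \<and> log_tame (degree q) p (lead_coeff q) (\<zeta> + c * (z - \<zeta>))}
      \<subseteq> {z \<in> julia_base p. regular_point p q z \<and> log_tame (degree q) p (lead_coeff q) (\<zeta> + c * (z - \<zeta>))}"
    using julia_base_subset[OF p] by (auto simp: regular_point_def)
  ultimately show ?thesis using finite_subset by blast
qed

text \<open>
  The projection of the Julia set is invariant under \<open>p\<^sup>-\<^sup>1\<close> only up to the finitely many \<open>z\<close> over which the
  leading coefficient of \<open>q\<close> vanishes, and it need not be closed. Passing to limit points removes
  both defects.
\<close>

definition base_core :: "complex poly \<Rightarrow> complex poly poly \<Rightarrow> complex set" where
  "base_core p q = {z. z islimpt base_projection p q}"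

lemma base_core:
  assumes p: "degree p \<ge> 2" and q: "degree q \<ge> 2"
  shows "compact (base_core p q)" "base_core p q \<noteq> {}" "base_core p q \<noteq> {a}"
    "poly p -` base_core p q = base_core p q"
proof -
  define J where "J = base_projection p q"
  have JJ: "J \<subseteq> julia_base p" by (auto simp: J_def base_projection_def)
  have bdd: "compact (julia_base p)"
    unfolding julia_base_def using filled_julia_base_closed_bounded[OF p] by blast
  have E: "base_core p q \<subseteq> julia_base p"
  proof
    fix z assume "z \<in> base_core p q"
    then have "z islimpt julia_base p" using JJ islimpt_subset by (auto simp: base_core_def J_def)
    then show "z \<in> julia_base p" using bdd closed_limpt compact_imp_closed by blast
  qed
  have "closed (base_core p q)" unfolding base_core_def by (rule closed_limpts)
  then show "compact (base_core p q)"
    using E bdd by (metis bounded_subset compact_eq_bounded_closed)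
  have "infinite {z \<in> julia_base p. regular_point p q z \<and> log_tame (degree q) p (lead_coeff q) (0 + 1 * (z - 0))}"
    by (rule infinite_regular_points[OF p q]) simp_all
  moreover have "{z \<in> julia_base p. regular_point p q z \<and> log_tame (degree q) p (lead_coeff q) (0 + 1 * (z - 0))} \<subseteq> J"
    using regular_point_fibre_julia(2)[OF _ q] by (auto simp: J_def base_projection_def)
  ultimately have "infinite J" using finite_subset by blast
  then obtain x where "x islimpt J"
    using bdd JJ unfolding compact_eq_Bolzano_Weierstrass by blast
  then show ne: "base_core p q \<noteq> {}" by (auto simp: base_core_def J_def)
  have p0: "degree p > 0" using p by simp
  show inv: "poly p -` base_core p q = base_core p q"
  proof -
    \<comment> \<open>outside \<open>N\<close> the fibre maps are nonconstant and membership in the projection is invariant\<close>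
  define N where "N = {z. poly (lead_coeff q) z = 0}"
    have N: "finite N"
    proof -
      have "lead_coeff q \<noteq> 0" using q by auto
      then show ?thesis unfolding N_def by (rule poly_roots_finite)
    qed
    have "z \<in> J \<longleftrightarrow> poly p z \<in> J" if "z \<notin> N" for z
    proof -
      have lead: "poly (lead_coeff q) z \<noteq> 0" using that by (simp add: N_def)
      have q0: "degree q > 0" using q by simp
      have f: "fibre_julia p q z = poly (fibre q z) -` fibre_julia p q (poly p z)"
        by (rule fibre_julia_vimage[OF q0 lead])
      have "degree (fibre q z) > 0" using degree_fibre[OF lead] q by simp
      then have "fibre_julia p q z \<noteq> {} \<longleftrightarrow> fibre_julia p q (poly p z) \<noteq> {}"
        unfolding f using poly_surj by (metis (no_types, opaque_lifting) all_not_in_conv vimageI vimageE)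
      moreover have "z \<in> julia_base p \<longleftrightarrow> poly p z \<in> julia_base p"
        using julia_base_vimage[OF p0] by blast
      ultimately show ?thesis by (auto simp: J_def base_projection_def)
    qed
    then have "N \<union> J = N \<union> (poly p -` J)" by blast
    then have "z islimpt J \<longleftrightarrow> z islimpt (poly p -` J)" for z
      using islimpt_Un_finite[OF N] by metis
    then show ?thesis using islimpt_poly_vimage[OF p0] by (auto simp: base_core_def J_def)
  qed
  show "base_core p q \<noteq> {a}"
  proof
    assume a: "base_core p q = {a}"
    then have aJ: "a \<in> julia_base p" using E by blast
    have pa: "poly p a = a" using inv a by auto
    have single: "poly p x - a = lead_coeff p * (x - a) ^ degree p" for x
    proof (rule poly_single_fibre[OF p0])
      show "y = a" if "poly p y = a" for y using inv a that by blast
    qed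
    define M where "M = max 1 (cmod (lead_coeff p))"
    have M: "M \<ge> 1" "cmod (lead_coeff p) \<le> M" by (auto simp: M_def)
    have iter: "seq_orbit (\<lambda>_. p) n w = (poly p ^^ n) w" for n w by (induction n) auto
    have near: "cmod ((poly p ^^ n) w - a) \<le> 1 / M" if w: "cmod (w - a) \<le> 1 / M" for w n
      using centred_powers_contract[of _ _ "\<lambda>_. p" "\<lambda>_. a" "\<lambda>_. lead_coeff p", OF p M(1) single M(2) w, of n]
      by (simp only: iter)
    have "cball a (1 / M) \<subseteq> filled_julia_base p"
    proof
      fix w assume "w \<in> cball a (1 / M)"
      then have w: "cmod (w - a) \<le> 1 / M" by (simp add: dist_norm norm_minus_commute)
      have "(poly p ^^ n) w \<in> cball a (1 / M)" for n
        using near[OF w, of n] by (simp add: dist_norm norm_minus_commute)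
      then have "range (\<lambda>n. (poly p ^^ n) w) \<subseteq> cball a (1 / M)" by blast
      then show "w \<in> filled_julia_base p"
        unfolding filled_julia_base_def using bounded_cball bounded_subset by blast
    qed
    then have "a \<in> interior (filled_julia_base p)"
      using M(1) by (intro interiorI[of "ball a (1 / M)"]) auto
    then show False using aJ by (auto simp: julia_base_def frontier_def)
  qed
qed

text \<open>
  As \<open>E = p\<^sup>-\<^sup>1(E) = (p \<circ> T)\<^sup>-\<^sup>1(E)\<close> for the core \<open>E\<close>, the polynomials \<open>p\<close> and \<open>p \<circ> T\<close> are affinely related,
  and the relating map is again a symmetry of \<open>E\<close>.
\<close>

lemma base_symmetry_step:
  assumes p: "degree p \<ge> 2" and q: "degree q \<ge> 2" and \<alpha>: "\<alpha> \<noteq> 0"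
    and T: "poly [:\<beta>, \<alpha>:] -` base_core p q = base_core p q"
  obtains \<alpha>' \<beta>' where "\<alpha>' \<noteq> 0" "pcompose p [:\<beta>, \<alpha>:] = pcompose [:\<beta>', \<alpha>':] p"
    "poly [:\<beta>', \<alpha>':] -` base_core p q = base_core p q" "\<alpha> * centroid p + \<beta> = centroid p"
proof -
  define E where "E = base_core p q"
  define h where "h = pcompose p [:\<beta>, \<alpha>:]"
  have E: "compact E" "E \<noteq> {}" "E \<noteq> {a}" "poly p -` E = E" for a
    unfolding E_def using base_core[OF p q] by auto
  have p0: "degree p > 0" "degree h = degree p" using p \<alpha> by (simp_all add: h_def degree_pcompose)
  have hE: "poly h -` E = E"
  proof -
    have "poly h -` E = poly [:\<beta>, \<alpha>:] -` (poly p -` E)" by (auto simp: h_def poly_pcompose)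
    then show ?thesis using E(4) T by (simp add: E_def)
  qed
  then have eq: "poly p -` E = poly h -` E" using E(4) by simp
  from equal_preimages_affine[OF E(1-3) E(1) p0 eq] obtain \<alpha>' \<beta>' where a: "\<alpha>' \<noteq> 0" "h = smult \<alpha>' p + [:\<beta>':]" .
  have he: "h = pcompose [:\<beta>', \<alpha>':] p" unfolding a(2) by (simp add: pcompose_pCons)
  have "poly [:\<beta>', \<alpha>':] -` E = E"
  proof -
    have "poly [:\<beta>', \<alpha>':] x \<in> E \<longleftrightarrow> x \<in> E" for x
    proof -
      obtain y where y: "poly p y = x" using poly_surj[OF p0(1)] by blast
      have "poly [:\<beta>', \<alpha>':] x = poly h y" unfolding he by (simp add: poly_pcompose y)
      then have "poly [:\<beta>', \<alpha>':] x \<in> E \<longleftrightarrow> y \<in> poly h -` E" by (simp only: vimage_eq)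
      also have "\<dots> \<longleftrightarrow> y \<in> poly p -` E" using eq by simp
      also have "\<dots> \<longleftrightarrow> x \<in> E" by (simp only: vimage_eq y)
      finally show ?thesis .
    qed
    then show ?thesis by (simp only: set_eq_iff vimage_eq) simp
  qed
  moreover have "\<alpha> * centroid p + \<beta> = centroid p"
    by (rule centroid_equivariant[OF refl refl p \<alpha>]) (use he in \<open>simp add: h_def\<close>)
  ultimately show thesis
    using he unfolding E_def h_def by (intro that[OF a(1)])
qed

lemma symmetry_base_core:
  assumes \<gamma>: "(\<lambda>(z, w). (c1 * z + c2, c3 * w + poly c4 z)) \<in> julia_symmetries p q" and c: "c1 \<noteq> 0"
  shows "poly [:c2, c1:] -` base_core p q = base_core p q"
proof -
  have "degree [:c2, c1:] > 0" using c by simp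
  from islimpt_poly_vimage[OF this, of _ "base_projection p q"]
  show ?thesis unfolding symmetry_base[OF \<gamma> c] by (auto simp: base_core_def)
qed

text \<open>
  Both \<open>T\<close> and the affine map \<open>T'\<close> with \<open>p \<circ> T = T' \<circ> p\<close> fix the centroid. In the coordinate centred
  there, \<open>P(c x) = c' P(x)\<close>, so for \<open>c\<close> of large order only the leading coefficient of \<open>P\<close> survives.
\<close>

lemma base_power_map:
  assumes p: "degree p \<ge> 2" and q: "degree q \<ge> 2" and c: "c \<noteq> 0" "\<And>k. 1 \<le> k \<Longrightarrow> k \<le> degree p \<Longrightarrow> c ^ k \<noteq> 1"
    and T: "poly [:\<beta>, c:] -` base_core p q = base_core p q"
  shows "poly p (centroid p + x) = centroid p + lead_coeff p * x ^ degree p"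
proof -
  define \<zeta> where "\<zeta> = centroid p"
  obtain c' \<beta>' where 1: "c' \<noteq> 0" "pcompose p [:\<beta>, c:] = pcompose [:\<beta>', c':] p"
    "poly [:\<beta>', c':] -` base_core p q = base_core p q" "c * \<zeta> + \<beta> = \<zeta>"
    using base_symmetry_step[OF p q c(1) T] unfolding \<zeta>_def by metis
  have 2: "c' * \<zeta> + \<beta>' = \<zeta>"
    using base_symmetry_step[OF p q 1(1) 1(3)] unfolding \<zeta>_def by metis
  define P where "P = pcompose p [:\<zeta>, 1:] - [:\<zeta>:]"
  have degP: "degree P = degree p" unfolding P_def degree_diff_const by (simp add: degree_pcompose)
  have leadP: "coeff P (degree p) = lead_coeff p"
  proof -
    have "coeff P (degree p) = coeff (pcompose p [:\<zeta>, 1:]) (degree p)"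
      using p by (simp add: P_def coeff_pCons split: nat.split)
    then show ?thesis using coeff_pcompose_affine(1)[of p "degree p" \<zeta> 1] p by simp
  qed
  have "pcompose P [:0, c:] = smult c' P"
    unfolding poly_eq_poly_eq_iff[symmetric]
  proof
    fix x
    have b: "\<beta> = \<zeta> - c * \<zeta>" "\<beta>' = \<zeta> - c' * \<zeta>" using 1(4) 2 by (simp_all add: algebra_simps)
    have "poly (pcompose p [:\<beta>, c:]) (\<zeta> + x) = poly (pcompose [:\<beta>', c':] p) (\<zeta> + x)" using 1(2) by simp
    then have "poly p (\<zeta> + c * x) = \<zeta> + c' * (poly p (\<zeta> + x) - \<zeta>)"
      by (simp add: poly_pcompose b algebra_simps)
    then show "poly (pcompose P [:0, c:]) x = poly (smult c' P) x"
      by (simp add: P_def poly_pcompose mult.commute)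
  qed
  then have co: "c ^ j * coeff P j = c' * coeff P j" for j
    by (metis coeff_pcompose_linear coeff_smult)
  have c': "c' = c ^ degree p" using co[of "degree p"] leadP p by auto
  have z: "coeff P j = 0" if j: "j < degree p" for j
  proof (rule ccontr)
    assume "coeff P j \<noteq> 0"
    then have "c ^ j = c'" using co[of j] by simp
    also have "c' = c ^ (j + (degree p - j))" using j by (simp add: c')
    finally have "c ^ j * 1 = c ^ j * c ^ (degree p - j)" by (simp only: power_add mult_1_right)
    then have "c ^ (degree p - j) = 1" using c(1) by simp
    then show False using c(2)[of "degree p - j"] j by simp
  qed
  have "P = monom (lead_coeff p) (degree p)"
  proof (rule poly_eqI)
    fix j show "coeff P j = coeff (monom (lead_coeff p) (degree p)) j"
      using z[of j] leadP degP coeff_eq_0[of P j] by (cases j "degree p" rule: linorder_cases) auto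
  qed
  then have "poly P x = lead_coeff p * x ^ degree p" by (simp add: poly_monom)
  then show ?thesis by (simp add: P_def poly_pcompose \<zeta>_def algebra_simps)
qed

section \<open>The normalized map in coordinates\<close>

lemma has_values_map_compose:
  assumes "has_values N y n" "has_value g z y"
  shows "has_values (map_poly (\<lambda>b. ratfun_compose b g) N) z n"
  unfolding has_values_def
proof
  fix j
  have "regular_at (coeff N j) y" "coeff n j = ratfun_eval (coeff N j) y"
    using assms(1) by (auto simp: has_values_def has_value_iff)
  then show "has_value (coeff (map_poly (\<lambda>b. ratfun_compose b g) N) j) z (coeff n j)"
    using has_value_compose[OF assms(2)] by (simp add: coeff_map_poly)
qed

lemma has_value_of_nat: "has_value (of_nat n) z (of_nat n)"
proof (induction n)
  case (Suc n)
  then show ?case using has_value_add[OF has_value_rconst[of 1 z] Suc] by simp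
qed (simp add: has_value_0)

lemma has_values_fibre: "has_values (map_poly to_fract q) z (fibre q z)"
  by (simp add: has_values_def coeff_map_poly has_value_to_fract)

lemma has_value_centroid_fibre:
  assumes "poly (lead_coeff q) z \<noteq> 0" "degree q > 0"
  shows "has_value (centroid_fibre q) z (centroid (fibre q z))"
proof -
  have "has_value (- to_fract (coeff q (degree q - 1)) / (of_nat (degree q) * to_fract (lead_coeff q))) z
      (- poly (coeff q (degree q - 1)) z / (of_nat (degree q) * poly (lead_coeff q) z))"
    using assms by (intro has_value_divide has_value_uminus has_value_mult has_value_of_nat has_value_to_fract) auto
  then show ?thesis using degree_fibre[OF assms(1)] by (simp add: centroid_fibre_def centroid_def)
qed

text \<open>
  The conjugacy equation for \<open>h\<close> is evaluated over single points \<open>z\<close>. In this locale \<open>\<kappa>\<close> is the base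
  coordinate of \<open>h\<close>, and \<open>s (\<kappa> z)\<close> is the normalized fibre map over the point with coordinate \<open>\<kappa> z\<close>.
\<close>

locale normalized =
  fixes p :: "complex poly" and q :: "complex poly poly" and F :: rat_skew and a1 a2 :: complex
  assumes p: "degree p \<ge> 2" and q: "degree q \<ge> 2"
    and a1: "a1 ^ (degree p - 1) = lead_coeff p"
    and a2: "a1 ^ degree (lead_coeff q) * a2 ^ (degree q - 1) = lead_coeff (lead_coeff q)"
    and conjugacy: "normalizing_map p q a1 a2 \<circ>\<^sub>r rat_skew_of p q = F \<circ>\<^sub>r normalizing_map p q a1 a2"
begin

definition \<zeta> :: complex where "\<zeta> = centroid p"
definition \<kappa> :: "complex \<Rightarrow> complex" where "\<kappa> z = a1 * (z - \<zeta>)"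
definition S :: "ratfun poly" where "S = snd F"
definition s :: "complex \<Rightarrow> complex poly" where "s x = map_poly (\<lambda>b. ratfun_eval b x) S"
abbreviation "cen z \<equiv> centroid (fibre q z)"
abbreviation "b \<equiv> lead_coeff q"

text \<open>
  All rational functions in the conjugacy equation for \<open>h\<close> are regular over a generic point.
\<close>

definition generic :: "complex \<Rightarrow> bool" where
  "generic z \<longleftrightarrow> poly b z \<noteq> 0 \<and> poly b (poly p z) \<noteq> 0 \<and> (\<forall>j. regular_at (coeff S j) (\<kappa> z))"

lemma nonzero: "a1 \<noteq> 0" "a2 \<noteq> 0" "b \<noteq> 0"
proof -
  have "p \<noteq> 0" using p by auto
  then show "a1 \<noteq> 0" using a1 p by (auto simp: power_0_left split: if_splits)
  show "b \<noteq> 0" using q by auto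
  then have "lead_coeff b \<noteq> 0" by simp
  then show "a2 \<noteq> 0" using a2 q by (auto simp: power_0_left split: if_splits)
qed

lemma \<kappa>_inverse: "\<kappa> (\<zeta> + x / a1) = x" "\<zeta> + \<kappa> z / a1 = z"
  using nonzero by (auto simp: \<kappa>_def)

lemma inj_\<kappa>: "inj \<kappa>"
  using nonzero by (auto simp: \<kappa>_def intro!: injI)

lemma coeff_s [simp]: "coeff (s x) j = ratfun_eval (coeff S j) x"
  by (simp add: s_def coeff_map_poly ratfun_eval_def)

lemma has_value_\<kappa>: "has_value (rconst a1 * (Z - rconst (centroid_base p))) z (\<kappa> z)"
  unfolding \<kappa>_def \<zeta>_def centroid_def
  by (intro has_value_mult has_value_diff has_value_Z has_value_rconst) (simp add: centroid_base_def has_value_rconst)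

lemma finite_not_generic: "finite {z. \<not> generic z}"
proof -
  have "finite {z. poly b z = 0}" using nonzero by (intro poly_roots_finite)
  moreover have "finite {z. poly b (poly p z) = 0}"
  proof -
    have "pcompose b p \<noteq> 0" using nonzero(3) p by (subst pcompose_eq_0_iff) auto
    then show ?thesis using poly_roots_finite[of "pcompose b p"] by (simp add: poly_pcompose)
  qed
  moreover have "finite (\<kappa> -` {x. \<exists>j. \<not> regular_at (coeff S j) x})"
    by (intro finite_vimageI finite_not_regular_coeff inj_\<kappa>)
  ultimately have "finite ({z. poly b z = 0} \<union> {z. poly b (poly p z) = 0} \<union> \<kappa> -` {x. \<exists>j. \<not> regular_at (coeff S j) x})"
    by blast
  moreover have "{z. \<not> generic z} \<subseteq> {z. poly b z = 0} \<union> {z. poly b (poly p z) = 0} \<union> \<kappa> -` {x. \<exists>j. \<not> regular_at (coeff S j) x}"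
    by (auto simp: generic_def)
  ultimately show ?thesis by (rule finite_subset[rotated])
qed

lemma infinite_generic: "infinite {z. generic z}"
proof
  assume "finite {z. generic z}"
  then have "finite ({z. generic z} \<union> {z. \<not> generic z})" using finite_not_generic by blast
  moreover have "{z. generic z} \<union> {z. \<not> generic z} = UNIV" by blast
  ultimately have "finite (UNIV :: complex set)" by simp
  then show False using infinite_UNIV_char_0 by blast
qed

lemma ratfun_eq_generic:
  assumes "\<And>z. generic z \<Longrightarrow> \<exists>x. has_value R (\<kappa> z) x \<and> has_value R' (\<kappa> z) x"
  shows "R = R'"
proof (rule ratfun_eqI)
  show "infinite (\<kappa> ` {z. generic z})"
    using infinite_generic finite_imageD inj_on_subset[OF inj_\<kappa>] by blast
qed (use assms in auto)

lemma fst_F: "fst F = to_fract (smult a1 (pcompose p [:\<zeta>, 1 / a1:] - [:\<zeta>:]))"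
proof (rule ratfun_eqI)
  have "infinite (UNIV - {x. \<not> regular_at (fst F) x})"
    using finite_not_regular infinite_UNIV_char_0 by (metis Diff_infinite_finite)
  then show "infinite {x. regular_at (fst F) x}" by (simp add: Diff_eq Compl_eq)
next
  fix x assume "x \<in> {x. regular_at (fst F) x}"
  define z where "z = \<zeta> + x / a1"
  have x: "\<kappa> z = x" by (simp add: z_def \<kappa>_inverse)
  define N where "N = rconst a1 * (Z - rconst (centroid_base p))"
  have "ratfun_compose N (to_fract p) = ratfun_compose (fst F) N"
    using arg_cong[OF conjugacy, of fst]
    by (simp add: rat_skew_compose_def normalizing_map_def rat_skew_of_def N_def)
  moreover have "has_value (ratfun_compose (fst F) N) z (ratfun_eval (fst F) (\<kappa> z))"
    using \<open>x \<in> _\<close> unfolding N_def by (intro has_value_compose has_value_\<kappa>) (simp add: x)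
  moreover have "has_value (ratfun_compose N (to_fract p)) z (\<kappa> (poly p z))"
    using has_value_compose[OF has_value_to_fract[of p z], of N] has_value_\<kappa>[of "poly p z"]
    by (simp add: N_def has_value_iff)
  ultimately have "ratfun_eval (fst F) x = \<kappa> (poly p z)" using has_value_unique x by metis
  then have "has_value (fst F) x (\<kappa> (poly p z))" using \<open>x \<in> _\<close> by (simp add: has_value_iff)
  moreover have "poly (smult a1 (pcompose p [:\<zeta>, 1 / a1:] - [:\<zeta>:])) x = \<kappa> (poly p z)"
    by (simp add: poly_pcompose z_def \<kappa>_def)
  ultimately show "\<exists>y. has_value (fst F) x y \<and> has_value (to_fract (smult a1 (pcompose p [:\<zeta>, 1 / a1:] - [:\<zeta>:]))) x y"
    using has_value_to_fract by metis
qed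

lemma fibre_conjugacy:
  assumes "generic z"
  shows "pcompose (s (\<kappa> z)) [:- (a2 * cen z), a2:] = smult a2 (fibre q z - [:cen (poly p z):])"
proof -
  define cf where "cf = centroid_fibre q"
  have q0: "degree q > 0" using q by simp
  have z: "poly b z \<noteq> 0" "poly b (poly p z) \<noteq> 0" "\<And>j. regular_at (coeff S j) (\<kappa> z)"
    using assms by (auto simp: generic_def)
  have L: "has_values (smult (rconst a2) [:- cf, 1:]) y [:- (a2 * cen y), a2:]" if "poly b y \<noteq> 0" for y
  proof -
    have "has_value (rconst a2 * - cf) y (a2 * - cen y)"
      unfolding cf_def using that q0 by (intro has_value_mult has_value_rconst has_value_uminus has_value_centroid_fibre)
    then have "has_values [:rconst a2 * - cf, rconst a2:] y [:a2 * - cen y, a2:]"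
      by (intro has_values_pCons has_values_0 has_value_rconst)
    then show ?thesis by simp
  qed
  have "pcompose (map_poly (\<lambda>b. ratfun_compose b (to_fract p)) (smult (rconst a2) [:- cf, 1:])) (map_poly to_fract q)
     = pcompose (map_poly (\<lambda>b. ratfun_compose b (rconst a1 * (Z - rconst (centroid_base p)))) S) (smult (rconst a2) [:- cf, 1:])"
    (is "?l = ?r")
    using arg_cong[OF conjugacy, of snd]
    by (simp only: rat_skew_compose_def normalizing_map_def rat_skew_of_def fst_conv snd_conv S_def cf_def)
  moreover have "has_values ?l z (pcompose [:- (a2 * cen (poly p z)), a2:] (fibre q z))"
    by (intro has_values_pcompose has_values_fibre has_values_map_compose[OF L] has_value_to_fract z)
  moreover have "has_values ?r z (pcompose (s (\<kappa> z)) [:- (a2 * cen z), a2:])"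
    unfolding s_def
    by (intro has_values_pcompose L z(1) has_values_map_compose[OF _ has_value_\<kappa>] has_values_regular z(3))
  ultimately have "pcompose (s (\<kappa> z)) [:- (a2 * cen z), a2:] = pcompose [:- (a2 * cen (poly p z)), a2:] (fibre q z)"
    using has_values_unique by metis
  also have "\<dots> = smult a2 (fibre q z - [:cen (poly p z):])"
    by (simp add: pcompose_pCons smult_diff_right)
  finally show ?thesis .
qed

text \<open>
  The leading coefficient of the normalized map, as \<open>coeff_S_degree\<close> shows.
\<close>

definition B :: "complex poly" where
  "B = smult (a2 / a2 ^ degree q) (pcompose b [:\<zeta>, 1 / a1:])"

lemma poly_B: "poly B (\<kappa> z) = a2 / a2 ^ degree q * poly b z"
  by (simp add: B_def poly_pcompose \<kappa>_inverse)

lemma poly_B_nonzero: "poly b z \<noteq> 0 \<Longrightarrow> poly B (\<kappa> z) \<noteq> 0"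
  using nonzero by (simp add: poly_B)

lemma B_monic: "lead_coeff B = 1" "degree B = degree b"
proof -
  show deg: "degree B = degree b" using nonzero by (simp add: B_def degree_pcompose)
  have "lead_coeff B = a2 / a2 ^ degree q * (lead_coeff b * (1 / a1) ^ degree b)"
    unfolding B_def lead_coeff_smult using nonzero by (subst lead_coeff_comp) auto
  also have "lead_coeff b = a1 ^ degree b * a2 ^ (degree q - 1)" using a2 by simp
  also have "a2 / a2 ^ degree q * (a1 ^ degree b * a2 ^ (degree q - 1) * (1 / a1) ^ degree b)
      = (a2 * a2 ^ (degree q - 1)) / a2 ^ degree q * (a1 * (1 / a1)) ^ degree b"
    by (simp only: power_mult_distrib) simp
  also have "a2 * a2 ^ (degree q - 1) = a2 ^ degree q" using q by (metis Suc_diff_1 less_le_trans pos2 power_Suc)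
  finally show "lead_coeff B = 1" using nonzero by simp
qed

lemma degree_s: "generic z \<Longrightarrow> degree (s (\<kappa> z)) = degree q"
proof -
  assume z: "generic z"
  have "degree (pcompose (s (\<kappa> z)) [:- (a2 * cen z), a2:]) = degree (s (\<kappa> z))"
    using nonzero by (simp add: degree_pcompose)
  moreover have "degree (smult a2 (fibre q z - [:cen (poly p z):])) = degree q"
    using nonzero z by (simp add: degree_diff_const degree_fibre generic_def)
  ultimately show ?thesis using fibre_conjugacy[OF z] by simp
qed

lemma coeff_S_degree: "coeff S (degree q) = to_fract B"
proof (rule ratfun_eq_generic)
  fix z assume z: "generic z"
  have "coeff (smult a2 (fibre q z - [:cen (poly p z):])) (degree q) = a2 * poly b z"
    using q by (simp add: coeff_pCons split: nat.split)
  moreover have "coeff (pcompose (s (\<kappa> z)) [:- (a2 * cen z), a2:]) (degree q) = a2 ^ degree q * ratfun_eval (coeff S (degree q)) (\<kappa> z)"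
    using coeff_pcompose_affine(1)[OF degree_s[OF z], of "- (a2 * cen z)" a2] q by simp
  ultimately have "a2 ^ degree q * ratfun_eval (coeff S (degree q)) (\<kappa> z) = a2 * poly b z"
    unfolding fibre_conjugacy[OF z] by metis
  then have "ratfun_eval (coeff S (degree q)) (\<kappa> z) = poly B (\<kappa> z)"
    using nonzero by (simp add: poly_B field_simps)
  then show "\<exists>x. has_value (coeff S (degree q)) (\<kappa> z) x \<and> has_value (to_fract B) (\<kappa> z) x"
    using z has_value_to_fract by (auto simp: has_value_iff generic_def)
qed

lemma degree_S: "degree S = degree q"
proof (rule antisym)
  show "degree S \<le> degree q"
  proof (rule degree_le, intro allI impI, rule ratfun_eq_generic)
    fix j z assume j: "degree q < j" and z: "generic z"
    have "ratfun_eval (coeff S j) (\<kappa> z) = 0"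
      using coeff_eq_0[of "s (\<kappa> z)" j] degree_s[OF z] j by simp
    then show "\<exists>x. has_value (coeff S j) (\<kappa> z) x \<and> has_value 0 (\<kappa> z) x"
      using z has_value_0 by (auto simp: has_value_iff generic_def)
  qed
  have "B \<noteq> 0" using B_monic(1) by auto
  then show "degree q \<le> degree S" using coeff_S_degree by (intro le_degree) simp
qed

text \<open>
  Both affine maps respect the centroids, so in the normalized fibre coordinates they are
  multiplications by \<open>\<alpha>\<close> and \<open>\<alpha>'\<close>, and the commutation relation can be read off coefficient by coefficient.
\<close>

lemma transfer:
  assumes z: "generic z" "generic z'"
    and eq: "pcompose (fibre q z') [:\<beta>, \<alpha>:] = pcompose [:\<beta>', \<alpha>':] (fibre q z)"
    and cen: "\<alpha> * cen z + \<beta> = cen z'" "\<alpha>' * cen (poly p z) + \<beta>' = cen (poly p z')"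
  shows "ratfun_eval (coeff S j) (\<kappa> z') * \<alpha> ^ j = \<alpha>' * ratfun_eval (coeff S j) (\<kappa> z)"
proof -
  have "pcompose (s (\<kappa> z')) [:0, \<alpha>:] = smult \<alpha>' (s (\<kappa> z))"
    unfolding poly_eq_poly_eq_iff[symmetric]
  proof
    fix x
    define w where "w = cen z + x / a2"
    have x: "x = a2 * (w - cen z)" using nonzero by (simp add: w_def)
    have fc: "poly (s (\<kappa> y)) (a2 * (v - cen y)) = a2 * (poly (fibre q y) v - cen (poly p y))"
      if "generic y" for y v
    proof -
      have "poly (pcompose (s (\<kappa> y)) [:- (a2 * cen y), a2:]) v = poly (smult a2 (fibre q y - [:cen (poly p y):])) v"
        using fibre_conjugacy[OF that] by simp
      then show ?thesis by (simp add: poly_pcompose algebra_simps)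
    qed
    have "\<alpha> * x = a2 * ((\<alpha> * w + \<beta>) - cen z')" unfolding x cen(1)[symmetric] by (simp add: algebra_simps)
    then have "poly (s (\<kappa> z')) (\<alpha> * x) = a2 * (poly (fibre q z') (\<alpha> * w + \<beta>) - cen (poly p z'))"
      using fc[OF z(2)] by simp
    also have "poly (fibre q z') (\<alpha> * w + \<beta>) = \<alpha>' * poly (fibre q z) w + \<beta>'"
    proof -
      have "poly (pcompose (fibre q z') [:\<beta>, \<alpha>:]) w = poly (pcompose [:\<beta>', \<alpha>':] (fibre q z)) w" using eq by simp
      then show ?thesis by (simp add: poly_pcompose algebra_simps)
    qed
    also have "a2 * (\<alpha>' * poly (fibre q z) w + \<beta>' - cen (poly p z')) = \<alpha>' * (a2 * (poly (fibre q z) w - cen (poly p z)))"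
      unfolding cen(2)[symmetric] by (simp add: algebra_simps)
    also have "\<dots> = \<alpha>' * poly (s (\<kappa> z)) x" using fc[OF z(1)] by (simp add: x)
    finally show "poly (pcompose (s (\<kappa> z')) [:0, \<alpha>:]) x = poly (smult \<alpha>' (s (\<kappa> z))) x"
      by (simp add: poly_pcompose mult.commute)
  qed
  from arg_cong[OF this, of "\<lambda>r. coeff r j"] show ?thesis
    by (simp add: coeff_pcompose_linear mult.commute)
qed

text \<open>
  If the leading coefficient of \<open>q\<close> is constant, the fibre centroids are a polynomial in \<open>z\<close>, and \<open>h\<close> and its
  inverse are polynomial maps. The polynomial \<open>V\<close> is \<open>hfh\<^sup>-\<^sup>1\<close> with the original base coordinate.
\<close>

lemma coeff_S_polynomial:
  assumes l: "degree b = 0"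
  shows "\<exists>u. coeff S j = to_fract u"
proof -
  obtain b0 where b0: "b = [:b0:]" "b0 \<noteq> 0" using l nonzero(3) by (metis degree_eq_zeroE pCons_0_0)
  define c where "c = smult (- 1 / (of_nat (degree q) * b0)) (coeff q (degree q - 1))"
  have cen: "cen z = poly c z" for z
    using degree_fibre[of q z] b0 by (simp add: c_def centroid_def)
  define V where "V = pcompose (smult (to_fract [:a2:]) (map_poly to_fract q - [:to_fract (pcompose c p):])) [:to_fract c, to_fract [:1 / a2:]:]"
  have closed: "coeff V i \<in> range to_fract" for i
    unfolding V_def
  proof (rule coeff_pcompose_semiring_closed)
    show "coeff (smult (to_fract [:a2:]) (map_poly to_fract q - [:to_fract (pcompose c p):])) i \<in> range to_fract" for i
    proof -
      have "coeff (smult (to_fract [:a2:]) (map_poly to_fract q - [:to_fract (pcompose c p):])) i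
          = to_fract ([:a2:] * (coeff q i - (if i = 0 then pcompose c p else 0)))"
        by (cases i) (simp_all add: coeff_map_poly del: mult_pCons_left mult_pCons_right)
      then show ?thesis by blast
    qed
    show "coeff [:to_fract c, to_fract [:1 / a2:]:] i \<in> range to_fract" for i
      by (auto simp: coeff_pCons split: nat.split intro: range_eqI[of _ _ 0])
  qed (auto intro: range_eqI[of _ _ 0] simp: image_iff simp flip: to_fract_add to_fract_mult)
  have V: "has_values V z (s (\<kappa> z))" if z: "generic z" for z
  proof -
    have 1: "has_values (map_poly to_fract q - [:to_fract (pcompose c p):]) z (fibre q z - [:cen (poly p z):])"
      using has_value_to_fract[of "pcompose c p" z]
      unfolding has_values_def by (auto simp: coeff_map_poly cen poly_pcompose coeff_pCons intro!: has_value_diff has_value_to_fract has_value_0 split: nat.split)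
    have 2: "has_values (smult (to_fract [:a2:]) (map_poly to_fract q - [:to_fract (pcompose c p):])) z (smult a2 (fibre q z - [:cen (poly p z):]))"
      using 1 has_value_to_fract[of "[:a2:]" z] unfolding has_values_def coeff_smult by (auto intro!: has_value_mult)
    have 3: "has_values [:to_fract c, to_fract [:1 / a2:]:] z [:cen z, 1 / a2:]"
      using has_value_to_fract[of "[:1 / a2:]" z] has_value_to_fract[of c z] cen
      by (auto intro!: has_values_pCons has_values_0)
    have "has_values V z (pcompose (smult a2 (fibre q z - [:cen (poly p z):])) [:cen z, 1 / a2:])"
      unfolding V_def by (intro has_values_pcompose 2 3)
    also have "pcompose (smult a2 (fibre q z - [:cen (poly p z):])) [:cen z, 1 / a2:]
        = pcompose (s (\<kappa> z)) (pcompose [:- (a2 * cen z), a2:] [:cen z, 1 / a2:])"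
      unfolding fibre_conjugacy[OF z, symmetric] by (simp add: pcompose_assoc)
    also have "pcompose [:- (a2 * cen z), a2:] [:cen z, 1 / a2:] = [:0, 1:]"
      using nonzero by (simp add: pcompose_pCons)
    finally show ?thesis by simp
  qed
  obtain v where v: "coeff V j = to_fract v" using closed by blast
  have "coeff S j = to_fract (pcompose v [:\<zeta>, 1 / a1:])"
  proof (rule ratfun_eq_generic)
    fix z assume z: "generic z"
    have "has_value (to_fract v) z (ratfun_eval (coeff S j) (\<kappa> z))"
      using V[OF z] v unfolding has_values_def by (metis coeff_s)
    then have "ratfun_eval (coeff S j) (\<kappa> z) = poly v z" using has_value_to_fract has_value_unique by blast
    then have "has_value (coeff S j) (\<kappa> z) (poly (pcompose v [:\<zeta>, 1 / a1:]) (\<kappa> z))"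
      using z by (simp add: poly_pcompose \<kappa>_inverse has_value_iff generic_def)
    then show "\<exists>x. has_value (coeff S j) (\<kappa> z) x \<and> has_value (to_fract (pcompose v [:\<zeta>, 1 / a1:])) (\<kappa> z) x"
      using has_value_to_fract by blast
  qed
  then show ?thesis by blast
qed

end

section \<open>Infinitely many symmetries\<close>

lemma exists_high_order:
  fixes C :: "complex set"
  assumes "infinite C"
  shows "\<exists>c\<in>C. \<forall>k. 1 \<le> k \<longrightarrow> k \<le> N \<longrightarrow> c ^ k \<noteq> 1"
proof (rule ccontr)
  assume "\<not> ?thesis"
  then have "C \<subseteq> (\<Union>k\<in>{1..N}. {c. c ^ k = 1})" by fastforce
  moreover have "finite (\<Union>k\<in>{1..N}. {c::complex. c ^ k = 1})"
    by (intro finite_UN_I finite_roots_unity) auto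
  ultimately show False using assms finite_subset by blast
qed

definition symmetry_parameters ::
    "complex poly \<Rightarrow> complex poly poly \<Rightarrow> ((complex \<times> complex) \<times> (complex \<times> complex poly)) set" where
  "symmetry_parameters p q = {((c1, c2), (c3, c4)). cmod c1 = 1 \<and> cmod c3 = 1 \<and>
     (\<lambda>(z, w). (c1 * z + c2, c3 * w + poly c4 z)) \<in> julia_symmetries p q}"

lemma infinite_symmetry_parameters:
  assumes "infinite (julia_symmetries p q)"
  shows "infinite (symmetry_parameters p q)"
proof
  define f :: "(complex \<times> complex) \<times> (complex \<times> complex poly) \<Rightarrow> complex \<times> complex \<Rightarrow> complex \<times> complex"
    where "f = (\<lambda>((c1, c2), (c3, c4)) (z, w). (c1 * z + c2, c3 * w + poly c4 z))"
  assume "finite (symmetry_parameters p q)"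
  then have "finite (f ` symmetry_parameters p q)" by blast
  moreover have "julia_symmetries p q \<subseteq> f ` symmetry_parameters p q"
  proof
    fix \<gamma> assume \<gamma>: "\<gamma> \<in> julia_symmetries p q"
    then have "\<gamma> \<in> skew_isometries" by (simp add: julia_symmetries_def)
    then obtain c1 c2 c3 c4 where c: "cmod c1 = 1" "cmod c3 = 1"
      "\<gamma> = (\<lambda>(z, w). (c1 * z + c2, c3 * w + poly c4 z))"
      unfolding skew_isometries_def by blast
    then have "((c1, c2), (c3, c4)) \<in> symmetry_parameters p q"
      using \<gamma> by (simp add: symmetry_parameters_def)
    moreover have "\<gamma> = f ((c1, c2), (c3, c4))" unfolding c(3) f_def by simp
    ultimately show "\<gamma> \<in> f ` symmetry_parameters p q" by blast
  qed
  ultimately show False using assms finite_subset by blast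
qed

context normalized
begin

text \<open>
  The centroids over \<open>p(z)\<close> are matched by applying \<open>fibre_symmetry_step\<close> a second time, over \<open>p(z)\<close>.
\<close>

lemma transfer_fibres:
  assumes z: "regular_point p q z" "regular_point p q z'" and \<alpha>: "\<alpha> \<noteq> 0"
    and T: "fibre_julia p q z' = poly [:\<beta>, \<alpha>:] ` fibre_julia p q z"
  obtains \<alpha>' \<beta>' where "\<alpha>' \<noteq> 0" "fibre_julia p q (poly p z') = poly [:\<beta>', \<alpha>':] ` fibre_julia p q (poly p z)"
    "\<alpha> * cen z + \<beta> = cen z'"
    "\<And>j. generic z \<Longrightarrow> generic z' \<Longrightarrow>
       ratfun_eval (coeff S j) (\<kappa> z') * \<alpha> ^ j = \<alpha>' * ratfun_eval (coeff S j) (\<kappa> z)"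
proof -
  obtain \<alpha>' \<beta>' where 1: "\<alpha>' \<noteq> 0" "pcompose (fibre q z') [:\<beta>, \<alpha>:] = pcompose [:\<beta>', \<alpha>':] (fibre q z)"
    "fibre_julia p q (poly p z') = poly [:\<beta>', \<alpha>':] ` fibre_julia p q (poly p z)"
    "\<alpha> * cen z + \<beta> = cen z'"
    by (rule fibre_symmetry_step[OF q z \<alpha> T])
  have 2: "\<alpha>' * cen (poly p z) + \<beta>' = cen (poly p z')"
    by (rule fibre_symmetry_step[OF q regular_point_step[OF z(1)] regular_point_step[OF z(2)] 1(1) 1(3)])
  show thesis
    using transfer[OF _ _ 1(2) 1(4) 2] by (intro that[OF 1(1) 1(3) 1(4)])
qed

text \<open>
  Two symmetries with the same \<open>\<sigma>\<close> differ by affine symmetries of the sets \<open>X\<^sub>z\<close>, which over regular points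
  fix the centroid; so the translation part \<open>c4\<close> is determined by \<open>c3\<close>, and there are infinitely many \<open>c3\<close>. For \<open>e\<close> of large
  order, \<open>S\<^sub>j e\<^sup>j = e\<^sup>d S\<^sub>j\<close> at infinitely many points leaves only \<open>S\<^sub>d\<close>.
\<close>

lemma fibre_rotations_imp_monomial:
  assumes M: "infinite M" and c1: "cmod c1 = 1"
    and sym: "\<And>c3 c4. (c3, c4) \<in> M \<Longrightarrow> cmod c3 = 1 \<and>
      (\<lambda>(z, w). (c1 * z + c2, c3 * w + poly c4 z)) \<in> julia_symmetries p q"
  shows "S = monom (coeff S (degree q)) (degree q)"
proof -
  define R where "R = {z \<in> julia_base p. regular_point p q z}"
  have R: "infinite R"
  proof -
    have "infinite {z \<in> julia_base p. regular_point p q z \<and> log_tame (degree q) p b (0 + 1 * (z - 0))}"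
      by (rule infinite_regular_points[OF p q]) simp_all
    moreover have "{z \<in> julia_base p. regular_point p q z \<and> log_tame (degree q) p b (0 + 1 * (z - 0))} \<subseteq> R"
      by (auto simp: R_def)
    ultimately show ?thesis using finite_subset by blast
  qed
  obtain k3 k4 where k: "(k3, k4) \<in> M" using M by (metis finite.emptyI ex_in_conv surj_pair)
  have k3: "k3 \<noteq> 0" using sym[OF k] by auto
  have c10: "c1 \<noteq> 0" using c1 by auto
  have X: "fibre_julia p q z = poly [:(poly c4 z - poly k4 z) / k3, c3 / k3:] ` fibre_julia p q z"
    if c: "(c3, c4) \<in> M" and z: "z \<in> R" for c3 c4 z
  proof -
    have z': "z \<in> julia_base p" "fibre_julia p q z \<noteq> {}"
      using z regular_point_fibre_julia(2)[OF _ q] by (auto simp: R_def)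
    define Y where "Y = fibre_julia p q z"
    define g where "g y = (y - poly k4 z) / k3" for y
    have "poly [:poly k4 z, k3:] ` Y = poly [:poly c4 z, c3:] ` Y"
      using symmetry_fibre(2)[of c1 c2 k3 k4, OF _ c10 z'] symmetry_fibre(2)[of c1 c2 c3 c4, OF _ c10 z'] sym[OF k] sym[OF c]
      by (simp add: Y_def)
    then have "g ` poly [:poly k4 z, k3:] ` Y = g ` poly [:poly c4 z, c3:] ` Y" by simp
    moreover have "g (poly [:poly k4 z, k3:] y) = y" for y using k3 by (simp add: g_def)
    moreover have "g (poly [:poly c4 z, c3:] y) = poly [:(poly c4 z - poly k4 z) / k3, c3 / k3:] y" for y
      by (simp add: g_def add_divide_distrib diff_divide_distrib)
    ultimately show ?thesis by (simp only: image_image Y_def[symmetric] image_ident)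
  qed
  have step: "\<exists>\<alpha>'. (c3 / k3) * cen z + (poly c4 z - poly k4 z) / k3 = cen z \<and>
      (generic z \<longrightarrow> (\<forall>j. ratfun_eval (coeff S j) (\<kappa> z) * (c3 / k3) ^ j = \<alpha>' * ratfun_eval (coeff S j) (\<kappa> z)))"
    if c: "(c3, c4) \<in> M" and z: "z \<in> R" for c3 c4 z
  proof -
    have "c3 / k3 \<noteq> 0" using sym[OF c] k3 by auto
    moreover have "regular_point p q z" using z by (simp add: R_def)
    ultimately show ?thesis using transfer_fibres[OF _ _ _ X[OF c z]] by metis
  qed
  have "inj_on fst M"
  proof (rule inj_onI)
    fix u v assume uv: "u \<in> M" "v \<in> M" "fst u = fst v"
    obtain c3 c4 c4' where u: "u = (c3, c4)" "v = (c3, c4')" using uv(3) by (metis prod.collapse)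
    have "poly c4 z = poly c4' z" if z: "z \<in> R" for z
    proof -
      have "(c3 / k3) * cen z + (poly c4 z - poly k4 z) / k3 = (c3 / k3) * cen z + (poly c4' z - poly k4 z) / k3"
        using step[of c3 c4 z] step[of c3 c4' z] uv(1,2) z by (metis u)
      then show ?thesis using k3 by simp
    qed
    then have "R \<subseteq> {z. poly (c4 - c4') z = 0}" by auto
    then have "c4 - c4' = 0" using R poly_roots_finite finite_subset by blast
    then show "u = v" by (simp add: u)
  qed
  then have "infinite (fst ` M)" using M finite_imageD by blast
  moreover have "inj_on (\<lambda>c. c / k3) (fst ` M)" using k3 by (auto intro!: inj_onI)
  ultimately have "infinite ((\<lambda>c. c / k3) ` fst ` M)" using finite_imageD by blast
  from exists_high_order[OF this, of "degree q"] obtain c3 c4 where c: "(c3, c4) \<in> M"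
    "\<And>k. 1 \<le> k \<Longrightarrow> k \<le> degree q \<Longrightarrow> (c3 / k3) ^ k \<noteq> 1"
    by auto
  define e where "e = c3 / k3"
  have e0: "e \<noteq> 0" using sym[OF c(1)] k3 by (auto simp: e_def)
  have inf: "infinite (R \<inter> {z. generic z})"
  proof
    assume "finite (R \<inter> {z. generic z})"
    then have "finite ((R \<inter> {z. generic z}) \<union> {z. \<not> generic z})" using finite_not_generic by blast
    moreover have "R \<subseteq> (R \<inter> {z. generic z}) \<union> {z. \<not> generic z}" by blast
    ultimately show False using R finite_subset by blast
  qed
  have zero: "coeff S j = 0" if j: "j < degree q" for j
  proof (rule ratfun_eqI)
    show "infinite (\<kappa> ` (R \<inter> {z. generic z}))"
      using inf finite_imageD inj_on_subset[OF inj_\<kappa>] by blast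
    fix x assume "x \<in> \<kappa> ` (R \<inter> {z. generic z})"
    then obtain z where z: "z \<in> R" "generic z" "x = \<kappa> z" by blast
    obtain \<alpha>' where \<alpha>': "\<And>j. ratfun_eval (coeff S j) (\<kappa> z) * e ^ j = \<alpha>' * ratfun_eval (coeff S j) (\<kappa> z)"
      using step[OF c(1) z(1)] z(2) unfolding e_def by blast
    have "ratfun_eval (coeff S (degree q)) (\<kappa> z) = poly B (\<kappa> z)"
      using has_value_to_fract[of B "\<kappa> z"] by (simp add: has_value_iff coeff_S_degree)
    moreover have "poly B (\<kappa> z) \<noteq> 0" using poly_B_nonzero z(2) by (simp add: generic_def)
    ultimately have ed: "\<alpha>' = e ^ degree q" using \<alpha>'[of "degree q"] by simp
    have "ratfun_eval (coeff S j) (\<kappa> z) = 0"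
    proof (rule ccontr)
      assume "ratfun_eval (coeff S j) (\<kappa> z) \<noteq> 0"
      then have "e ^ j = e ^ degree q" using \<alpha>'[of j] by (simp add: ed)
      also have "\<dots> = e ^ (j + (degree q - j))" using j by simp
      finally have "e ^ j * 1 = e ^ j * e ^ (degree q - j)" by (simp only: power_add mult_1_right)
      then have "e ^ (degree q - j) = 1" using e0 by simp
      then show False using c(2)[of "degree q - j"] j by (simp add: e_def)
    qed
    then show "\<exists>y. has_value (coeff S j) x y \<and> has_value 0 x y"
      using z has_value_0 by (auto simp: has_value_iff generic_def)
  qed
  show ?thesis
  proof (rule poly_eqI)
    fix j show "coeff S j = coeff (monom (coeff S (degree q)) (degree q)) j"
      using zero[of j] degree_S coeff_eq_0[of S j] by (cases j "degree q" rule: linorder_cases) auto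
  qed
qed

lemma base_symmetry_fixes_centroid:
  assumes "((c1, c2), g) \<in> symmetry_parameters p q"
  shows "c1 * \<zeta> + c2 = \<zeta>" "poly [:c2, c1:] -` base_core p q = base_core p q" "c1 \<noteq> 0"
proof -
  obtain c3 c4 where g: "g = (c3, c4)" by (cases g)
  have c: "cmod c1 = 1" "(\<lambda>(z, w). (c1 * z + c2, c3 * w + poly c4 z)) \<in> julia_symmetries p q"
    using assms by (auto simp: symmetry_parameters_def g)
  then show c10: "c1 \<noteq> 0" by auto
  show E: "poly [:c2, c1:] -` base_core p q = base_core p q" by (rule symmetry_base_core[OF c(2) c10])
  show "c1 * \<zeta> + c2 = \<zeta>" unfolding \<zeta>_def by (rule base_symmetry_step[OF p q c10 E])
qed

lemma power_base:
  assumes P: "\<And>x. poly p (\<zeta> + x) = \<zeta> + lead_coeff p * x ^ degree p"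
  shows "fst F = Z ^ degree p" "\<kappa> (poly p z) = \<kappa> z ^ degree p"
proof -
  have a: "a1 * lead_coeff p = a1 ^ degree p"
    unfolding a1[symmetric] using p by (metis One_nat_def Suc_pred less_le_trans pos2 power_Suc)
  show "\<kappa> (poly p z) = \<kappa> z ^ degree p"
    using P[of "z - \<zeta>"] a by (simp add: \<kappa>_def power_mult_distrib flip: mult.assoc)
  have "smult a1 (pcompose p [:\<zeta>, 1 / a1:] - [:\<zeta>:]) = monom 1 (degree p)"
    unfolding poly_eq_poly_eq_iff[symmetric]
  proof
    fix x
    have "a1 * (lead_coeff p * (x / a1) ^ degree p) = (a1 * (x / a1)) ^ degree p"
      unfolding power_mult_distrib a[symmetric] by simp
    then show "poly (smult a1 (pcompose p [:\<zeta>, 1 / a1:] - [:\<zeta>:])) x = poly (monom 1 (degree p)) x"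
      using P[of "x / a1"] nonzero by (simp add: poly_pcompose poly_monom)
  qed
  then show "fst F = Z ^ degree p" unfolding fst_F by (simp add: to_fract_monom)
qed

text \<open>
  Since \<open>p\<close> is a centred power, \<open>infinite_regular_points\<close> applies to the rotation \<open>\<sigma>\<close> and gives infinitely many
  \<open>z\<close> such that both \<open>z\<close> and \<open>\<sigma>(z)\<close> are regular; \<open>transfer_fibres\<close> is applied over \<open>z\<close> and over \<open>p(z)\<close>.
\<close>

lemma symmetric_pairs:
  assumes P: "\<And>x. poly p (\<zeta> + x) = \<zeta> + lead_coeff p * x ^ degree p"
    and \<gamma>: "((c1, c2), (c3, c4)) \<in> symmetry_parameters p q"
  shows "\<exists>A. infinite A \<and> (\<forall>x\<in>A. rotation_pair S B (degree p) c1 c3 x)"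
proof -
  have c: "cmod c1 = 1" "cmod c3 = 1" "(\<lambda>(z, w). (c1 * z + c2, c3 * w + poly c4 z)) \<in> julia_symmetries p q"
    using \<gamma> by (auto simp: symmetry_parameters_def)
  have c0: "c1 \<noteq> 0" "c3 \<noteq> 0" using c by auto
  have c2: "c2 = \<zeta> - c1 * \<zeta>" using base_symmetry_fixes_centroid(1)[OF \<gamma>] by (simp add: algebra_simps)
  define \<sigma> where "\<sigma> z = c1 * z + c2" for z
  have \<sigma>: "\<sigma> z = \<zeta> + c1 * (z - \<zeta>)" for z by (simp add: \<sigma>_def c2 algebra_simps)
  have \<kappa>\<sigma>: "\<kappa> (\<sigma> z) = c1 * \<kappa> z" for z by (simp add: \<sigma> \<kappa>_def)
  define G where "G = {z \<in> julia_base p. regular_point p q z \<and> log_tame (degree q) p b (\<zeta> + c1 * (z - \<zeta>))}"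
  have G: "infinite G"
    unfolding G_def
  proof (rule infinite_regular_points[OF p q c(1)])
    show "poly p (\<zeta> + c1 ^ (degree p ^ k) * z) - \<zeta> = c1 ^ (degree p ^ Suc k) * (poly p (\<zeta> + z) - \<zeta>)" for k z
    proof -
      have "(c1 ^ (degree p ^ k) * z) ^ degree p = c1 ^ (degree p ^ Suc k) * z ^ degree p"
        by (simp add: power_mult_distrib mult.commute flip: power_mult)
      then show ?thesis by (simp add: P del: power_Suc)
    qed
  qed
  \<comment> \<open>all four fibres that occur are to be generic; \<open>z \<noteq> \<zeta>\<close> makes the coordinate nonzero\<close>
  define H where "H = {z. generic z \<and> generic (\<sigma> z) \<and> generic (poly p z) \<and> generic (poly p (\<sigma> z)) \<and> z \<noteq> \<zeta>}"
  have H: "finite (- H)"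
  proof -
    define N where "N = {z. \<not> generic z}"
    have N: "finite N" unfolding N_def by (rule finite_not_generic)
    have p0: "degree p > 0" using p by simp
    have s0: "degree [:c2, c1:] > 0" using c0 by simp
    have "finite (N \<union> poly [:c2, c1:] -` N \<union> poly p -` N \<union> poly [:c2, c1:] -` (poly p -` N) \<union> {\<zeta>})"
      by (intro finite_UnI finite_poly_vimage[OF p0] finite_poly_vimage[OF s0] N) simp
    moreover have "- H \<subseteq> N \<union> poly [:c2, c1:] -` N \<union> poly p -` N \<union> poly [:c2, c1:] -` (poly p -` N) \<union> {\<zeta>}"
      by (auto simp: H_def N_def \<sigma>_def add.commute mult.commute)
    ultimately show ?thesis by (rule finite_subset[rotated])
  qed
  have inf: "infinite (G \<inter> H)"
  proof
    assume "finite (G \<inter> H)"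
    then have "finite ((G \<inter> H) \<union> - H)" using H by blast
    moreover have "G \<subseteq> (G \<inter> H) \<union> - H" by blast
    ultimately show False using G finite_subset by blast
  qed
  have main: "rotation_pair S B (degree p) c1 c3 x"
    if x: "x \<in> \<kappa> ` (G \<inter> H)" for x
  proof -
    obtain z where z: "z \<in> G" "z \<in> H" "x = \<kappa> z" using x by blast
    have gen: "generic z" "generic (\<sigma> z)" "generic (poly p z)" "generic (poly p (\<sigma> z))" "z \<noteq> \<zeta>"
      using z(2) by (auto simp: H_def)
    have zJ: "z \<in> julia_base p" and rz: "regular_point p q z" using z(1) by (auto simp: G_def)
    have X: "fibre_julia p q z \<noteq> {}" by (rule regular_point_fibre_julia(2)[OF rz q])
    have \<sigma>J: "\<sigma> z \<in> julia_base p" and TX: "fibre_julia p q (\<sigma> z) = poly [:poly c4 z, c3:] ` fibre_julia p q z"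
      unfolding \<sigma>_def using symmetry_fibre[OF c(3) c0(1) zJ X] by auto
    have r\<sigma>: "regular_point p q (\<sigma> z)"
      using z(1) \<sigma>J julia_base_subset[OF p] by (auto simp: regular_point_def G_def \<sigma>)
    obtain \<alpha> \<beta> where 1: "\<alpha> \<noteq> 0" "fibre_julia p q (poly p (\<sigma> z)) = poly [:\<beta>, \<alpha>:] ` fibre_julia p q (poly p z)"
      "\<And>j. ratfun_eval (coeff S j) (\<kappa> (\<sigma> z)) * c3 ^ j = \<alpha> * ratfun_eval (coeff S j) (\<kappa> z)"
    proof (rule transfer_fibres[OF rz r\<sigma> c0(2) TX])
      fix \<alpha> \<beta> assume "\<alpha> \<noteq> 0" "fibre_julia p q (poly p (\<sigma> z)) = poly [:\<beta>, \<alpha>:] ` fibre_julia p q (poly p z)"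
        "\<And>j. generic z \<Longrightarrow> generic (\<sigma> z) \<Longrightarrow> ratfun_eval (coeff S j) (\<kappa> (\<sigma> z)) * c3 ^ j = \<alpha> * ratfun_eval (coeff S j) (\<kappa> z)"
      then show thesis using gen by (intro that)
    qed
    obtain \<alpha>' where 2: "\<And>j. ratfun_eval (coeff S j) (\<kappa> (poly p (\<sigma> z))) * \<alpha> ^ j = \<alpha>' * ratfun_eval (coeff S j) (\<kappa> (poly p z))"
    proof (rule transfer_fibres[OF regular_point_step[OF rz] regular_point_step[OF r\<sigma>] 1(1,2)])
      fix \<alpha>' assume "\<And>j. generic (poly p z) \<Longrightarrow> generic (poly p (\<sigma> z)) \<Longrightarrow>
        ratfun_eval (coeff S j) (\<kappa> (poly p (\<sigma> z))) * \<alpha> ^ j = \<alpha>' * ratfun_eval (coeff S j) (\<kappa> (poly p z))"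
      then show thesis using gen by (intro that)
    qed
    have k: "c1 * x = \<kappa> (\<sigma> z)" "x ^ degree p = \<kappa> (poly p z)" "(c1 * x) ^ degree p = \<kappa> (poly p (\<sigma> z))"
      using power_base(2)[OF P] by (simp_all add: z(3) \<kappa>\<sigma>)
    have x0: "\<kappa> z \<noteq> 0" using gen(5) nonzero by (simp add: \<kappa>_def)
    have ok: "poly B (\<kappa> y) \<noteq> 0 \<and> (\<forall>j. regular_at (coeff S j) (\<kappa> y))" if "generic y" for y
      using that poly_B_nonzero by (simp add: generic_def)
    show ?thesis
      unfolding rotation_pair_def k(3) unfolding k(1,2) unfolding z(3)
    proof (intro conjI ballI)
      fix y assume "y \<in> {\<kappa> z, \<kappa> (\<sigma> z), \<kappa> (poly p z), \<kappa> (poly p (\<sigma> z))}"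
      then have "\<exists>v. generic v \<and> y = \<kappa> v" using gen by auto
      then obtain v where "generic v" "y = \<kappa> v" by blast
      then show "poly B y \<noteq> 0" "\<forall>j. regular_at (coeff S j) y" using ok by simp_all
    next
      show "\<exists>\<alpha> \<alpha>'. \<forall>j. ratfun_eval (coeff S j) (\<kappa> (\<sigma> z)) * c3 ^ j = \<alpha> * ratfun_eval (coeff S j) (\<kappa> z) \<and>
          ratfun_eval (coeff S j) (\<kappa> (poly p (\<sigma> z))) * \<alpha> ^ j = \<alpha>' * ratfun_eval (coeff S j) (\<kappa> (poly p z))"
        by (intro exI[of _ \<alpha>] exI[of _ \<alpha>'] allI conjI 1(3) 2)
    qed (rule x0)
  qed
  have "infinite (\<kappa> ` (G \<inter> H))"
    using inf finite_imageD inj_on_subset[OF inj_\<kappa>] by blast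
  then show ?thesis
    by - (rule exI[of _ "\<kappa> ` (G \<inter> H)"], rule conjI, assumption, rule ballI, rule main)
qed

text \<open>
  Each \<open>\<sigma>\<close> fixes the centroid of \<open>p\<close> and is thus determined by its linear part.
\<close>

lemma infinite_base_rotations:
  assumes inf: "infinite (fst ` symmetry_parameters p q)"
  shows "\<exists>c1 c2 c3 c4. ((c1, c2), (c3, c4)) \<in> symmetry_parameters p q \<and> (\<forall>k. 1 \<le> k \<longrightarrow> k \<le> N \<longrightarrow> c1 ^ k \<noteq> 1)"
proof -
  have "inj_on fst (fst ` symmetry_parameters p q)"
  proof (rule inj_onI)
    fix u v assume uv: "u \<in> fst ` symmetry_parameters p q" "v \<in> fst ` symmetry_parameters p q" "fst u = fst v"
    obtain c1 c2 g where u: "u = (c1, c2)" "((c1, c2), g) \<in> symmetry_parameters p q" using uv(1) by fastforce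
    obtain d1 d2 h where v: "v = (d1, d2)" "((d1, d2), h) \<in> symmetry_parameters p q" using uv(2) by fastforce
    show "u = v"
      using base_symmetry_fixes_centroid(1)[OF u(2)] base_symmetry_fixes_centroid(1)[OF v(2)] uv(3)
      by (simp add: u v) (metis add_left_cancel)
  qed
  then have "infinite (fst ` fst ` symmetry_parameters p q)" using inf finite_imageD by blast
  from exists_high_order[OF this, of N] show ?thesis by (auto simp: image_iff) blast
qed

lemma monomial_case:
  assumes "S = monom (coeff S (degree q)) (degree q)"
  shows "(case_i (degree p) (degree q) (degree b) F \<or> case_iii (degree p) (degree q) (degree b) F) \<and> is_polynomial_map F"
proof
  show "is_polynomial_map F"
  proof (rule is_polynomial_mapI[OF fst_F])
    fix j show "\<exists>v. coeff (snd F) j = to_fract v"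
    proof (cases "j = degree q")
      case True then show ?thesis using coeff_S_degree by (auto simp: S_def)
    next
      case False
      then have "coeff S j = 0" using assms by (metis coeff_monom)
      then show ?thesis by (intro exI[of _ 0]) (simp add: S_def)
    qed
  qed
  show "case_i (degree p) (degree q) (degree b) F \<or> case_iii (degree p) (degree q) (degree b) F"
  proof (cases "fst F = Z ^ degree p \<and> coeff S (degree q) = Z ^ degree b")
    case True
    then have "F = (Z ^ degree p, monom (Z ^ degree b) (degree q))"
      using assms by (metis S_def prod.collapse)
    then show ?thesis by (simp add: case_i_def)
  next
    case False
    then show ?thesis using assms by (auto simp: case_iii_def S_def)
  qed
qed

lemma classification:
  assumes inf: "infinite (julia_symmetries p q)"
  defines "\<delta> \<equiv> degree p" and "d \<equiv> degree q" and "l \<equiv> degree b"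
  shows "((case_i \<delta> d l F \<or> case_ii \<delta> d F \<or> case_iii \<delta> d l F) \<and> is_polynomial_map F) \<or>
    (\<exists>r s. case_iv \<delta> d l F r s \<and> (real_of_int s / real_of_int r > 0 \<longrightarrow> is_polynomial_map F))"
proof (cases "S = monom (coeff S d) d")
  case True
  then show ?thesis using monomial_case unfolding \<delta>_def d_def l_def by blast
next
  case nonmonomial: False
  have base_inf: "infinite (fst ` symmetry_parameters p q)"
  proof
    assume fin: "finite (fst ` symmetry_parameters p q)"
    from pigeonhole_infinite[OF infinite_symmetry_parameters[OF inf] fin]
    obtain a where a: "a \<in> symmetry_parameters p q" "infinite {a' \<in> symmetry_parameters p q. fst a' = fst a}" by blast
    obtain c1 c2 where c: "fst a = (c1, c2)" by (cases "fst a")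
    define M where "M = snd ` {a' \<in> symmetry_parameters p q. fst a' = fst a}"
    have "inj_on snd {a' \<in> symmetry_parameters p q. fst a' = fst a}" 
      by (rule inj_onI) (metis (mono_tags, lifting) mem_Collect_eq prod_eqI)
    then have "infinite M" unfolding M_def using a(2) finite_imageD by blast
    moreover have "cmod c1 = 1" using a(1) c by (cases a) (auto simp: symmetry_parameters_def)
    moreover have "cmod c3 = 1 \<and> (\<lambda>(z, w). (c1 * z + c2, c3 * w + poly c4 z)) \<in> julia_symmetries p q"
      if "(c3, c4) \<in> M" for c3 c4
      using that c by (auto simp: M_def symmetry_parameters_def)
    ultimately have "S = monom (coeff S d) d" unfolding d_def by (rule fibre_rotations_imp_monomial)
    then show False using nonmonomial by blast
  qed
  obtain c1 c2 c3 c4 where \<gamma>: "((c1, c2), (c3, c4)) \<in> symmetry_parameters p q"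
    "\<And>k. 1 \<le> k \<Longrightarrow> k \<le> degree p \<Longrightarrow> c1 ^ k \<noteq> 1"
    using infinite_base_rotations[OF base_inf] by blast
  have P: "poly p (\<zeta> + x) = \<zeta> + lead_coeff p * x ^ degree p" for x
    unfolding \<zeta>_def
    using base_symmetry_fixes_centroid[OF \<gamma>(1)] \<gamma>(2) by (intro base_power_map[OF p q]) auto
  have F: "F = (Z ^ \<delta>, S)"
    using power_base(1)[OF P] by (simp add: S_def \<delta>_def prod_eq_iff)
  interpret rotation_family S B \<delta> d l
  proof
    show "2 \<le> d" "degree S = d" "coeff S d = to_fract B" "lead_coeff B = 1" "degree B = l"
      using q degree_S coeff_S_degree B_monic by (simp_all add: d_def l_def)
    show "S \<noteq> monom (coeff S d) d" by (rule nonmonomial)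
    show "\<exists>c c3 A. c \<noteq> 0 \<and> c3 \<noteq> 0 \<and> (\<forall>k. 1 \<le> k \<longrightarrow> k \<le> N \<longrightarrow> c ^ k \<noteq> 1) \<and> infinite A \<and>
      (\<forall>x\<in>A. rotation_pair S B \<delta> c c3 x)" for N
    proof -
      obtain c1 c2 c3 c4 where \<gamma>: "((c1, c2), (c3, c4)) \<in> symmetry_parameters p q"
        "\<forall>k. 1 \<le> k \<longrightarrow> k \<le> N \<longrightarrow> c1 ^ k \<noteq> 1"
        using infinite_base_rotations[OF base_inf] by blast
      have "c1 \<noteq> 0" "c3 \<noteq> 0" using \<gamma>(1) by (auto simp: symmetry_parameters_def)
      moreover note symmetric_pairs[OF P \<gamma>(1), folded \<delta>_def]
      ultimately show ?thesis using \<gamma>(2) by blast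
    qed
  qed
  have "(case_ii \<delta> d (Z ^ \<delta>, S) \<and> is_polynomial_map (Z ^ \<delta>, S)) \<or>
    (\<exists>r s. case_iv \<delta> d l (Z ^ \<delta>, S) r s \<and> (real_of_int s / real_of_int r > 0 \<longrightarrow> is_polynomial_map (Z ^ \<delta>, S)))"
    by (rule monomial_classification) (use coeff_S_polynomial in \<open>simp add: l_def\<close>)
  then show ?thesis unfolding F[symmetric] by blast
qed

end

theorem theorem5p3:
  fixes p :: "complex poly" and q :: "complex poly poly" and \<delta> d l :: nat and F :: rat_skew
  assumes "polynomial_skew_product p q"
    and "\<delta> = degree p" and "d = degree q" and "l = degree (lead_coeff q)"
    and "infinite (julia_symmetries p q)"
    and "normalized_skew_product p q F"
  shows "(case_i \<delta> d l F \<or> case_ii \<delta> d F \<or> case_iii \<delta> d l F \<or> (\<exists>r s. case_iv \<delta> d l F r s)) \<and>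
    (\<not> (\<exists>r s. case_iv \<delta> d l F r s \<and> real_of_int s / real_of_int r < 0) \<longrightarrow> is_polynomial_map F)"
proof -
  obtain a1 a2 where a: "a1 ^ (degree p - 1) = lead_coeff p"
    "a1 ^ degree (lead_coeff q) * a2 ^ (degree q - 1) = lead_coeff (lead_coeff q)"
    "normalizing_map p q a1 a2 \<circ>\<^sub>r rat_skew_of p q = F \<circ>\<^sub>r normalizing_map p q a1 a2"
    using assms(6) unfolding normalized_skew_product_def by blast
  interpret normalized p q F a1 a2
    using assms(1) a by unfold_locales (auto simp: polynomial_skew_product_def)
  have "((case_i \<delta> d l F \<or> case_ii \<delta> d F \<or> case_iii \<delta> d l F) \<and> is_polynomial_map F) \<or>
    (\<exists>r s. case_iv \<delta> d l F r s \<and> (real_of_int s / real_of_int r > 0 \<longrightarrow> is_polynomial_map F))"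
    unfolding assms(2-4) by (rule classification[OF assms(5)])
  then show ?thesis
  proof
    assume "\<exists>r s. case_iv \<delta> d l F r s \<and> (real_of_int s / real_of_int r > 0 \<longrightarrow> is_polynomial_map F)"
    then obtain r s where rs: "case_iv \<delta> d l F r s" "real_of_int s / real_of_int r > 0 \<longrightarrow> is_polynomial_map F" by blast
    have "real_of_int s / real_of_int r \<noteq> 0" using rs(1) by (simp add: case_iv_def)
    then have "is_polynomial_map F" if "\<not> real_of_int s / real_of_int r < 0" using rs(2) that by linarith
    then show ?thesis using rs(1) by blast
  qed blast
qed

end
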